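(* Let $(\Sigma,\mathcal{R},N,\mathcal{U})$ be a transition system specification with successors (TSSS) in De Simone format, and let $\underline{\leftrightarrow}_{ep}$ denote ep-bisimilarity on the states of its associated labelled transition system with successors. Then ep-bisimilarity is a lean congruence: if $p\in\mathbb{P}^r(\Sigma)$ is a (possibly open) process expression and $\rho,\nu$ are two closed $\Sigma$-substitutions such that $\rho(x)\;\underline{\leftrightarrow}_{ep}\;\nu(x)$ for all process variables $x\in\mathcal{V}_{\mathcal P}$, then $p[\rho]\;\underline{\leftrightarrow}_{ep}\;p[\nu]$.
   Context: **LTSS.** Fix sets $\mathcal{L}$ of transition labels, $Act\subseteq\mathcal{L}$ of actions, and $\mathcal{N}$ of rule names. A labelled transition system with successors (LTSS) is a tuple $(S,Tr,source,target,\ell,\leadsto)$ with $S,Tr$ sets (states, transitions), $source,target:Tr\to S$, $\ell:Tr\to\mathcal{L}$, and $\leadsto\;\subseteq Tr\times Tr\times Tr$ (write $t\leadsto_u v$ for $(t,u,v)\in\;\leadsto$) such that $t\leadsto_u v$ implies $source(t)=source(u)$ and $source(v)=target(u)$. Let $en(p)=\{t\in Tr\mid source(t)=p\}$. **Ep-bisimilarity.** An ep-bisimulation is a relation $\mathscr{R}\subseteq S\times S\times\mathrm{Pow}(Tr\times Tr)$ such that 1. if $(p,q,R)\in\mathscr{R}$ then $R\subseteq en(p)\times en(q)$, every $t\in en(p)$ is $R$-related to some $u\in en(q)$, every $u\in en(q)$ is $R$-related from some $t\in en(p)$, and $t\,R\,u$ implies $\ell(t)=\ell(u)$; 2. if $(p,q,R)\in\mathscr{R}$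 and $v\,R\,w$ then $(target(v),target(w),R')\in\mathscr{R}$ for some $R'$ such that (a) if $t\,R\,u$ and $t\leadsto_v t'$ then $\exists u'.\ u\leadsto_w u'\wedge t'\,R'\,u'$, and (b) if $t\,R\,u$ and $u\leadsto_w u'$ then $\exists t'.\ t\leadsto_v t'\wedge t'\,R'\,u'$. $p\;\underline{\leftrightarrow}_{ep}\;q$ iff $(p,q,R)\in\mathscr{R}$ for some ep-bisimulation $\mathscr{R}$ and some $R$. **Process expressions.** $\mathcal{V}_{\mathcal P}$ is an infinite set of process variables. A process signature $\Sigma$ is a set of pairs $(Op,n)$ of an operator symbol $Op\notin\mathcal{V}_{\mathcal P}$ and an arity $n\in\mathbb{N}$. $\mathbb{P}^r(\Sigma)$ is defined inductively: it contains $\mathcal{V}_{\mathcal P}$; it contains $Op(p_1,\dots,p_n)$ for $(Op,n)\in\Sigma$ and $p_i\in\mathbb{P}^r(\Sigma)$; and it contains the recursive call $\langle X|S\rangle$ for $V_S\subseteq\mathcal{V}_{\mathcal P}$, $S:V_S\to\mathbb{P}^r(\Sigma)$ (a recursive specification, $S_Y:=S(Y)$) and $X\in V_S$. In $\langle X|S\rangle$ the variables of $V_S$ are bound (the $S_Y$ are subexpressions). $var(p)$ is the set of variables occurring free in $p$; $p$ is closed if $var(p)=\emptyset$; $\mathrm{P}^r(\Sigma)$ is the set of closed expressions. A $\Sigma$-substitution is a partial function $\sigma:\mathcal{V}_{\mathcal P}\rightharpoonup\mathbb{P}^r(\Sigma)$; it is closed if it is a total function into $\mathrm{P}^r(\Sigma)$.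 $p[\sigma]$ is capture-avoiding simultaneous substitution. $\langle p|S\rangle$ abbreviates $p$ with each free $Y\in V_S$ replaced by $\langle Y|S\rangle$. **TSS, (open) transitions.** A literal is $p\xrightarrow{a}q$ with $p,q\in\mathbb{P}^r(\Sigma)$, $a\in\mathcal{L}$. A transition rule is $\frac{H}{\lambda}$ with $H$ a finite list of literals and $\lambda$ a literal. A TSS $(\Sigma,\mathcal{R},N)$ consists of $\Sigma$, a set $\mathcal{R}$ of transition rules and a naming $N:\mathcal{R}\to\mathcal{N}$. Let $\mathcal{V}_{\mathcal T}$ be an infinite set of transition variables disjoint from $\mathcal{V}_{\mathcal P}$. An open transition is a well-founded ordered tree whose nodes are labelled by pairs $(\mu,r)$ (literal, rule name) or $(\mu,tx)$ (literal, $tx\in\mathcal{V}_{\mathcal T}$), such that nodes labelled $(\mu,tx)$ are leaves; the same $tx$ always occurs with the same $\mu$; and if a node is labelled $(\mu,r)$ and its children carry the literals $\mu_1,\dots,\mu_k$ in order, then $\frac{\mu_1,\dots,\mu_k}{\mu}$ is a substitution instance of a rule with name $r$. If the root literal of $\mathring t$ is $p\xrightarrow{a}q$, put $src_\circ(\mathring t)=p$, $\ell_\circ(\mathring t)=a$, $tar_\circ(\mathring t)=q$. A (closed) transition is an open transition without transition variables and with only closed literals; $Tr$ is the set of these, with $source,\ell,target$ given by $src_\circ,\ell_\circ,tar_\circ$. The single-node open transition labelled $(\mu,tx)$ is written $(tx::\mu)$. **De Simone format for TSSs.** $(\Sigma,\mathcal{R},N)$ is in De Simone format if for every recursive call $\langle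 X|S\rangle$, $\alpha\in Act$ and $\ell\in\mathcal{L}\setminus Act$ it has the recursion rules $$\frac{\langle S_X|S\rangle\xrightarrow{\alpha}y}{\langle X|S\rangle\xrightarrow{\alpha}y}\ (\text{name }rec_{Act}),\qquad \frac{\langle S_X|S\rangle\xrightarrow{\ell}y}{\langle X|S\rangle\xrightarrow{\ell}\langle X|S\rangle}\ (\text{name }rec_{In})\qquad\text{for some }y\notin var(\langle S_X|S\rangle),$$ and every other rule (a De Simone rule) has the form $\frac{\{x_i\xrightarrow{a_i}y_i\mid i\in I\}}{Op(x_1,\dots,x_n)\xrightarrow{a}q}$ with $(Op,n)\in\Sigma$ (its type), $I\subseteq\{1,\dots,n\}$ (its trigger set), $a,a_i\in\mathcal{L}$, the $x_i$ ($1\le i\le n$) and $y_i$ ($i\in I$) pairwise distinct process variables, and $q$ (its target) a univariate expression (each variable has at most one free occurrence) with free variables only among $x_i$ ($i\notin I$) and $y_i$ ($i\in I$), such that each subexpression $\langle X|S\rangle$ of $q$ is closed, and if $a\in\mathcal{L}\setminus Act$ then all $a_i\in\mathcal{L}\setminus Act$ and $q=Op(z_1,\dots,z_n)$ with $z_i=y_i$ if $i\in I$ and $z_i=x_i$ otherwise. The trigger of the rule is $(\ell_1,\dots,\ell_n)$ with $\ell_i=a_i$ if $i\in I$ and $\ell_i=*$ otherwise. Different De Simone rules with the same name must have the same type, target and trigger set but different triggers; the names $rec_{Act},rec_{In}$ are not names of De Simone rules. In such a TSS, open transitions are written as expressions: $r(E_1,\dots,E_n)$ is the open transition whose root applies the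 De Simone rule named $r$ (arity $n$, trigger set $I_r$) with direct subtransition $E_i$ for $i\in I_r$ and with $i$-th source argument the process expression $E_i$ for $i\notin I_r$; $rec_{Act}(X,S,E)$ and $rec_{In}(X,S,E)$ are the open transitions with source $\langle X|S\rangle$ whose root applies the corresponding recursion rule to the direct subtransition $E$ (with source $\langle S_X|S\rangle$). The rule names $r$ of De Simone rules are called ($n$-ary) transition constructors. **Transition substitutions.** A $(\Sigma,\mathcal{R})$-substitution $\sigma$ partially maps process variables to process expressions and transition variables to open transitions; it is closed if it is total with values closed expressions and closed transitions. It matches $\mathring t$ if, whenever $(p\xrightarrow{a}q,tx)$ labels a node of $\mathring t$ and $\sigma(tx)$ is defined, $\ell_\circ(\sigma(tx))=a$, $src_\circ(\sigma(tx))=p[\sigma]$ and $tar_\circ(\sigma(tx))=q[\sigma]$. In that case $\mathring t[\sigma]$ is obtained by applying $\sigma$ to all process expressions and replacing each leaf $(tx::\mu)$ with $\sigma(tx)$ defined by $\sigma(tx)$. **TSSS.** A successor literal is $\mathring t\leadsto_{\mathring u}\mathring v$ with $\mathring t,\mathring u,\mathring v$ open transitions, $src_\circ(\mathring t)=src_\circ(\mathring u)$ and $src_\circ(\mathring v)=tar_\circ(\mathring u)$. A successor rule is $\frac{H}{\lambda}$ with $H$ a finite list of successor literals and $\lambda$ a successor literal. A TSSS $(\Sigma,\mathcal{R},N,\mathcal{U})$ is a TSS with a set $\mathcal{U}$ of successor rules. Its associated LTSS has state set $\mathrm{P}^r(\Sigma)$, its set of transitions $Tr$ is the set of all closed transitions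 of the TSS $(\Sigma,\mathcal{R},N)$ (open transitions without transition variables and with only closed literals), with $source,\ell,target$ given by $src_\circ,\ell_\circ,tar_\circ$, and $t\leadsto_u v$ iff the closed literal $t\leadsto_u v$ is derivable by a well-founded proof tree (of closed successor literals) each of whose steps is a substitution instance, by a matching $(\Sigma,\mathcal{R})$-substitution, of a rule in $\mathcal{U}$. **De Simone format for TSSSs.** $(\Sigma,\mathcal{R},N,\mathcal{U})$ is in De Simone format if $(\Sigma,\mathcal{R},N)$ is, and, first, for every recursive call $\langle X|S\rangle$ and $xa,ya,za\in\mathcal{L}$, $\mathcal{U}$ has a rule $$\frac{(tx::\langle S_X|S\rangle\xrightarrow{xa}x')\leadsto_{(ty::\langle S_X|S\rangle\xrightarrow{ya}y')}(tz::y'\xrightarrow{za}z')}{rec_\chi(X,S,tx::\langle S_X|S\rangle\xrightarrow{xa}x')\leadsto_{rec_\zeta(X,S,ty::\langle S_X|S\rangle\xrightarrow{ya}y')}\mathring u}$$ where $rec_\chi=rec_{Act}$ if $xa\in Act$ and $rec_{In}$ otherwise; $rec_\zeta=rec_{Act}$ if $ya\in Act$ and $rec_{In}$ otherwise; $\mathring u=(tz::y'\xrightarrow{za}z')$ if $ya\in Act$ and $\mathring u=rec_\chi(X,S,tx::\langle S_X|S\rangle\xrightarrow{xa}x')$ otherwise; $x',y',z'$ are distinct process variables not occurring in $\langle X|S\rangle$, and $tx,ty,tz$ are distinct transition variables. Second, every other rule of $\mathcal{U}$ has the form $$\frac{\{(tx_i::x_i\xrightarrow{xa_i}x'_i)\leadsto_{(ty_i::x_i\xrightarrow{ya_i}y'_i)}(tz_i::y'_i\xrightarrow{za_i}z'_i)\mid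 i\in I\}}{r(xe_1,\dots,xe_n)\leadsto_{s(ye_1,\dots,ye_n)}\mathring v}$$ where - $I\subseteq\{1,\dots,n\}$; all $x_i,x'_i,y'_i,z'_i$ are pairwise distinct process variables and all $tx_i,ty_i,tz_i$ are pairwise distinct transition variables; - if $i\in I$ then $xe_i=(tx_i::x_i\xrightarrow{xa_i}x'_i)$ and $ye_i=(ty_i::x_i\xrightarrow{ya_i}y'_i)$; - if $i\notin I$ then $xe_i$ is either $x_i$ or $(tx_i::x_i\xrightarrow{xa_i}x'_i)$, and $ye_i$ is either $x_i$ or $(ty_i::x_i\xrightarrow{ya_i}y'_i)$; - $r,s$ are $n$-ary transition constructors such that $r(xe_1,\dots,xe_n)$, $s(ye_1,\dots,ye_n)$ and $\mathring v$ are open transitions with $src_\circ(r(xe_1,\dots,xe_n))=src_\circ(s(ye_1,\dots,ye_n))$ and $src_\circ(\mathring v)=tar_\circ(s(ye_1,\dots,ye_n))$; - $\mathring v$ is univariate and contains no other variable expressions than: $x_i$ or $(tz_i::x_i\xrightarrow{za_i}z'_i)$ for $i$ with $xe_i=ye_i=x_i$; $(tx_i::x_i\xrightarrow{xa_i}x'_i)$ for $i$ with $xe_i\ne x_i$ and $ye_i=x_i$; $y'_i$ or $(tz_i::y'_i\xrightarrow{za_i}z'_i)$ for $i\notin I$ with $ye_i\neq x_i$; and $(tz_i::y'_i\xrightarrow{za_i}z'_i)$ for $i\in I$; - if $\ell_\circ(s(ye_1,\dots,ye_n))\in\mathcal{L}\setminus Act$, then $ya_i\in\mathcal{L}\setminus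 Act$ for $i\in I$; for $i\notin I$, either $xe_i=x_i$ or $ye_i=x_i$; and $\mathring v=r(ze_1,\dots,ze_n)$, where $ze_i=(tz_i::y'_i\xrightarrow{za_i}z'_i)$ if $i\in I$, $ze_i=xe_i$ if $i\notin I$ and $ye_i=x_i$, and $ze_i=y'_i$ otherwise. *)

theory Defs
  imports Main
begin

section \<open>Process expressions\<close>

text \<open>
  Raw process expressions.  The specification in a recursive call is a partial function whose
  domain is the set of variables it binds; it may be infinite.
\<close>

datatype ('v, 'o) rexp =
    RVar 'v
  | ROp 'o "('v, 'o) rexp list"
  | RRec 'v "'v \<Rightarrow> ('v, 'o) rexp option"

primrec rfv :: "('v, 'o) rexp \<Rightarrow> 'v set" where
  "rfv (RVar x) = {x}"
| "rfv (ROp f ps) = \<Union>(set (map rfv ps))"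
| "rfv (RRec X S) = \<Union>(ran (\<lambda>Y. map_option rfv (S Y))) - dom S"

text \<open>
  Literal replacement of free variables; it avoids capture exactly when \<open>capture_free\<close> holds.
\<close>

primrec rsubst :: "('v, 'o) rexp \<Rightarrow> ('v \<rightharpoonup> ('v, 'o) rexp) \<Rightarrow> ('v, 'o) rexp" where
  "rsubst (RVar x) \<sigma> = (case \<sigma> x of None \<Rightarrow> RVar x | Some q \<Rightarrow> q)"
| "rsubst (ROp f ps) \<sigma> = ROp f (map (\<lambda>p. rsubst p \<sigma>) ps)"
| "rsubst (RRec X S) \<sigma> = RRec X (\<lambda>Y. map_option (\<lambda>p. rsubst p (\<sigma> |` (- dom S))) (S Y))"

primrec capture_free :: "('v, 'o) rexp \<Rightarrow> ('v \<rightharpoonup> ('v, 'o) rexp) \<Rightarrow> bool" where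
  "capture_free (RVar x) \<sigma> \<longleftrightarrow> True"
| "capture_free (ROp f ps) \<sigma> \<longleftrightarrow> (\<forall>b \<in> set (map (\<lambda>p. capture_free p \<sigma>) ps). b)"
| "capture_free (RRec X S) \<sigma> \<longleftrightarrow>
     (\<forall>y \<in> rfv (RRec X S). \<forall>q. \<sigma> y = Some q \<longrightarrow> rfv q \<inter> dom S = {}) \<and>
     (\<forall>b \<in> ran (\<lambda>Y. map_option (\<lambda>p. capture_free p (\<sigma> |` (- dom S))) (S Y)). b)"

text \<open>
  Two raw expressions are related by \<open>alpha E\<close> if they agree up to the names of bound variables,
  free variables being matched by the relation \<open>E\<close>; ordinary alpha-equivalence is \<open>alpha Id\<close>.
  The variables of a (possibly infinite) specification are renamed by a bijection \<open>f\<close>.  The head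
  variable of an ill-formed recursive call, one outside the domain, is ignored; such calls do not
  belong to \<open>expr \<Sigma>\<close> below.
\<close>

definition rext :: "('v \<times> 'v) set \<Rightarrow> 'v set \<Rightarrow> 'v set \<Rightarrow> ('v \<Rightarrow> 'v) \<Rightarrow> ('v \<times> 'v) set" where
  "rext E V W f = {(x, y) \<in> E. x \<notin> V \<and> y \<notin> W} \<union> {(Y, f Y) |Y. Y \<in> V}"

inductive alpha :: "('v \<times> 'v) set \<Rightarrow> ('v, 'o) rexp \<Rightarrow> ('v, 'o) rexp \<Rightarrow> bool" where
  alpha_Var: "(x, y) \<in> E \<Longrightarrow> alpha E (RVar x) (RVar y)"
| alpha_Op: "list_all2 (alpha E) ps qs \<Longrightarrow> alpha E (ROp f ps) (ROp f qs)"
| alpha_Rec: "bij_betw f (dom S) (dom S') \<Longrightarrow> X \<in> dom S \<longleftrightarrow> X' \<in> dom S' \<Longrightarrow>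
    (X \<in> dom S \<longrightarrow> X' = f X) \<Longrightarrow>
    \<forall>Y p p'. S Y = Some p \<longrightarrow> S' (f Y) = Some p' \<longrightarrow> alpha (rext E (dom S) (dom S') f) p p' \<Longrightarrow>
    alpha E (RRec X S) (RRec X' S')"

lemma alpha_mono: "alpha E p q \<Longrightarrow> E \<subseteq> F \<Longrightarrow> alpha F p q"
proof (induction arbitrary: F rule: alpha.induct)
  case (alpha_Op E ps qs f)
  then show ?case by (auto intro!: alpha.alpha_Op elim: list_all2_mono)
next
  case (alpha_Rec f S S' X X' E)
  have "rext E (dom S) (dom S') f \<subseteq> rext F (dom S) (dom S') f"
    using alpha_Rec.prems by (auto simp: rext_def)
  with alpha_Rec show ?case by (intro alpha.alpha_Rec[where f = f]) blast+
qed (auto intro: alpha.intros)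

lemma alpha_refl: "alpha Id p p"
proof (induction p)
  case (RRec X S)
  have *: "rext Id (dom S) (dom S) id = Id"
    by (auto simp: rext_def)
  show ?case
    by (rule alpha_Rec[where f = id]) (use RRec in \<open>auto simp: *\<close>, metis option.set_intros range_eqI)
qed (auto intro: alpha_Var alpha_Op list.rel_refl_strong)

lemma alpha_sym: "alpha E p q \<Longrightarrow> alpha (E\<inverse>) q p"
proof (induction rule: alpha.induct)
  case (alpha_Op E ps qs f)
  then show ?case by (auto intro!: alpha.alpha_Op simp: list_all2_conv_all_nth)
next
  case (alpha_Rec f S S' X X' E)
  let ?g = "inv_into (dom S) f"
  have g: "bij_betw ?g (dom S') (dom S)"
    using alpha_Rec.hyps(1) by (rule bij_betw_inv_into)
  have gf: "\<And>Y. Y \<in> dom S \<Longrightarrow> ?g (f Y) = Y" and fg: "\<And>Y. Y \<in> dom S' \<Longrightarrow> f (?g Y) = Y"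
    using alpha_Rec.hyps(1) by (auto simp: bij_betw_inv_into_left bij_betw_inv_into_right)
  have e: "(rext E (dom S) (dom S') f)\<inverse> = rext (E\<inverse>) (dom S') (dom S) ?g"
  proof -
    have "b \<in> dom S \<and> a = f b \<longleftrightarrow> a \<in> dom S' \<and> b = ?g a" for a b
      using gf fg bij_betwE[OF alpha_Rec.hyps(1)] bij_betwE[OF g] by metis
    then show ?thesis unfolding rext_def by blast
  qed
  show ?case
  proof (rule alpha.alpha_Rec[OF g])
    show "\<forall>Y p p'. S' Y = Some p \<longrightarrow> S (?g Y) = Some p' \<longrightarrow> alpha (rext (E\<inverse>) (dom S') (dom S) ?g) p p'"
      using alpha_Rec.IH fg unfolding e[symmetric] by (metis domI)
    show "X' \<in> dom S' \<longleftrightarrow> X \<in> dom S" "X' \<in> dom S' \<longrightarrow> X = ?g X'"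
      using alpha_Rec.hyps(2,3) gf by metis+
  qed
qed (auto intro: alpha.intros)

lemma alpha_trans: "alpha E p q \<Longrightarrow> alpha F q r \<Longrightarrow> alpha (E O F) p r"
proof (induction arbitrary: F r rule: alpha.induct)
  case (alpha_Var x y E)
  from alpha_Var(2) show ?case
    by cases (use alpha_Var in \<open>auto intro!: alpha.intros\<close>)
next
  case (alpha_Op E ps qs f)
  from alpha_Op(2) show ?case
    by cases (use alpha_Op(1) in \<open>auto intro!: alpha.alpha_Op simp: list_all2_conv_all_nth\<close>)
next
  case (alpha_Rec f S S' X X' E)
  from alpha_Rec.prems show ?case
  proof cases
    case (alpha_Rec g S'' X'')
    note 1 = alpha_Rec.hyps
    note h = \<open>bij_betw f (dom S) (dom S')\<close> \<open>bij_betw g (dom S') (dom S'')\<close>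
    have c: "rext E (dom S) (dom S') f O rext F (dom S') (dom S'') g
        \<subseteq> rext (E O F) (dom S) (dom S'') (g \<circ> f)"
      using bij_betwE[OF h(1)] unfolding rext_def by fastforce
    have b: "bij_betw (g \<circ> f) (dom S) (dom S'')" using h by (rule bij_betw_trans)
    show ?thesis unfolding alpha_Rec(1)
    proof (rule alpha.alpha_Rec[OF b])
      show "\<forall>Y p p'. S Y = Some p \<longrightarrow> S'' ((g \<circ> f) Y) = Some p' \<longrightarrow>
         alpha (rext (E O F) (dom S) (dom S'') (g \<circ> f)) p p'"
      proof (intro allI impI)
        fix Y p p' assume a: "S Y = Some p" "S'' ((g \<circ> f) Y) = Some p'"
        from a(1) obtain q where q: "S' (f Y) = Some q" using bij_betwE[OF h(1)] by blast
        have "alpha (rext E (dom S) (dom S') f O rext F (dom S') (dom S'') g) p p'"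
          using \<open>\<forall>Y p p'. S Y = Some p \<longrightarrow> S' (f Y) = Some p' \<longrightarrow> alpha _ p p' \<and> _\<close>
            alpha_Rec(5) a q by auto
        then show "alpha (rext (E O F) (dom S) (dom S'') (g \<circ> f)) p p'"
          using c by (rule alpha_mono)
      qed
      show "X \<in> dom S \<longleftrightarrow> X'' \<in> dom S''" "X \<in> dom S \<longrightarrow> X'' = (g \<circ> f) X"
        using 1 alpha_Rec(3,4) by simp_all
    qed
  qed
qed

lemma alpha_rfv: "alpha E p q \<Longrightarrow> x \<in> rfv p \<Longrightarrow> \<exists>y \<in> rfv q. (x, y) \<in> E"
proof (induction arbitrary: x rule: alpha.induct)
  case (alpha_Op E ps qs f)
  then show ?case by (fastforce simp: list_all2_conv_all_nth set_conv_nth)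
next
  case (alpha_Rec f S S' X X' E)
  then obtain Y p where Y: "S Y = Some p" "x \<in> rfv p" "x \<notin> dom S" by (auto simp: ran_def)
  then obtain p' where p': "S' (f Y) = Some p'" using bij_betwE[OF alpha_Rec.hyps(1)] by blast
  with alpha_Rec.IH Y obtain y where "y \<in> rfv p'" "(x, y) \<in> rext E (dom S) (dom S') f" by blast
  with Y p' show ?case by (force simp: rext_def ran_def)
qed auto

lemma alpha_restrict: "alpha E p q \<Longrightarrow> alpha (E \<inter> rfv p \<times> rfv q) p q"
proof (induction rule: alpha.induct)
  case (alpha_Op E ps qs f)
  have l: "length ps = length qs" using alpha_Op by (rule list_all2_lengthD)
  have "alpha (E \<inter> rfv (ROp f ps) \<times> rfv (ROp f qs)) (ps ! i) (qs ! i)" if i: "i < length ps" for i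
  proof (rule alpha_mono)
    show "alpha (E \<inter> rfv (ps ! i) \<times> rfv (qs ! i)) (ps ! i) (qs ! i)"
      using list_all2_nthD[OF alpha_Op i] by blast
    have "ps ! i \<in> set ps" "qs ! i \<in> set qs" using i l by simp_all
    then show "E \<inter> rfv (ps ! i) \<times> rfv (qs ! i) \<subseteq> E \<inter> rfv (ROp f ps) \<times> rfv (ROp f qs)"
      unfolding rfv.simps set_map by blast
  qed
  with l show ?case by (intro alpha.alpha_Op list_all2_all_nthI)
next
  case (alpha_Rec f S S' X X' E)
  show ?case
  proof (rule alpha.alpha_Rec[OF alpha_Rec.hyps(1-3)], intro allI impI)
    fix Y p p' assume a: "S Y = Some p" "S' (f Y) = Some p'"
    then have "alpha (rext E (dom S) (dom S') f \<inter> rfv p \<times> rfv p') p p'"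
      using alpha_Rec.IH by blast
    then show "alpha (rext (E \<inter> rfv (RRec X S) \<times> rfv (RRec X' S')) (dom S) (dom S') f) p p'"
    proof (rule alpha_mono)
      have "rfv p \<subseteq> \<Union>(ran (\<lambda>Y. map_option rfv (S Y)))" "rfv p' \<subseteq> \<Union>(ran (\<lambda>Y. map_option rfv (S' Y)))"
        using a by (force simp: ran_def)+
      then show "rext E (dom S) (dom S') f \<inter> rfv p \<times> rfv p' \<subseteq>
          rext (E \<inter> rfv (RRec X S) \<times> rfv (RRec X' S')) (dom S) (dom S') f"
        unfolding rext_def rfv.simps by blast
    qed
  qed
qed (auto intro: alpha.intros)

lemma alpha_rsubst:
  "alpha E p q \<Longrightarrow> capture_free p \<sigma> \<Longrightarrow> capture_free q \<tau> \<Longrightarrow>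
    \<forall>x y. (x, y) \<in> E \<longrightarrow> x \<in> rfv p \<longrightarrow> y \<in> rfv q \<longrightarrow>
      \<sigma> x = None \<and> \<tau> y = None \<and> (x, y) \<in> F \<or>
      (\<exists>a b. \<sigma> x = Some a \<and> \<tau> y = Some b \<and> alpha F a b) \<Longrightarrow>
    alpha F (rsubst p \<sigma>) (rsubst q \<tau>)"
proof (induction arbitrary: F \<sigma> \<tau> rule: alpha.induct)
  case (alpha_Var x y E)
  then show ?case by (fastforce intro: alpha.intros)
next
  case (alpha_Op E ps qs f)
  have "alpha F (rsubst (ps ! i) \<sigma>) (rsubst (qs ! i) \<tau>)" if i: "i < length ps" for i
  proof -
    from alpha_Op(1) i have l: "i < length qs" by (simp add: list_all2_lengthD)
    with i have s: "ps ! i \<in> set ps" "qs ! i \<in> set qs" by simp_all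
    have IH: "capture_free (ps ! i) \<sigma>' \<Longrightarrow> capture_free (qs ! i) \<tau>' \<Longrightarrow>
      \<forall>x y. (x, y) \<in> E \<longrightarrow> x \<in> rfv (ps ! i) \<longrightarrow> y \<in> rfv (qs ! i) \<longrightarrow>
        \<sigma>' x = None \<and> \<tau>' y = None \<and> (x, y) \<in> F' \<or>
        (\<exists>a b. \<sigma>' x = Some a \<and> \<tau>' y = Some b \<and> alpha F' a b) \<Longrightarrow>
      alpha F' (rsubst (ps ! i) \<sigma>') (rsubst (qs ! i) \<tau>')" for \<sigma>' \<tau>' F'
      using list_all2_nthD[OF alpha_Op(1) i] by blast
    show ?thesis
    proof (rule IH)
      show "capture_free (ps ! i) \<sigma>" "capture_free (qs ! i) \<tau>"
        using alpha_Op.prems(1,2) s by simp_all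
      show "\<forall>x y. (x, y) \<in> E \<longrightarrow> x \<in> rfv (ps ! i) \<longrightarrow> y \<in> rfv (qs ! i) \<longrightarrow>
        \<sigma> x = None \<and> \<tau> y = None \<and> (x, y) \<in> F \<or>
        (\<exists>a b. \<sigma> x = Some a \<and> \<tau> y = Some b \<and> alpha F a b)"
        using alpha_Op.prems(3) s unfolding rfv.simps set_map by blast
    qed
  qed
  with list_all2_lengthD[OF alpha_Op(1)] show ?case
    unfolding rsubst.simps by (intro alpha.alpha_Op list_all2_all_nthI) simp_all
next
  case (alpha_Rec f S S' X X' E)
  let ?\<sigma> = "\<sigma> |` (- dom S)" and ?\<tau> = "\<tau> |` (- dom S')"
  have d: "dom (\<lambda>Y. map_option (\<lambda>p. rsubst p ?\<sigma>) (S Y)) = dom S"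
    "dom (\<lambda>Y. map_option (\<lambda>p. rsubst p ?\<tau>) (S' Y)) = dom S'" by auto
  show ?case unfolding rsubst.simps
  proof (rule alpha.alpha_Rec, unfold d)
    show "\<forall>Y p p'. map_option (\<lambda>p. rsubst p ?\<sigma>) (S Y) = Some p \<longrightarrow>
      map_option (\<lambda>p. rsubst p ?\<tau>) (S' (f Y)) = Some p' \<longrightarrow>
      alpha (rext F (dom S) (dom S') f) p p'"
    proof (clarsimp)
      fix Y p p' assume a: "S Y = Some p" "S' (f Y) = Some p'"
      have IH: "capture_free p \<sigma>' \<Longrightarrow> capture_free p' \<tau>' \<Longrightarrow>
        \<forall>x y. (x, y) \<in> rext E (dom S) (dom S') f \<longrightarrow> x \<in> rfv p \<longrightarrow> y \<in> rfv p' \<longrightarrow>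
          \<sigma>' x = None \<and> \<tau>' y = None \<and> (x, y) \<in> F' \<or>
          (\<exists>a b. \<sigma>' x = Some a \<and> \<tau>' y = Some b \<and> alpha F' a b) \<Longrightarrow>
        alpha F' (rsubst p \<sigma>') (rsubst p' \<tau>')" for \<sigma>' \<tau>' F'
        using alpha_Rec.IH a by blast
      show "alpha (rext F (dom S) (dom S') f) (rsubst p ?\<sigma>) (rsubst p' ?\<tau>)"
      proof (rule IH)
        show "capture_free p ?\<sigma>" using alpha_Rec.prems(1) a(1) by (force simp: ran_def)
        show "capture_free p' ?\<tau>" using alpha_Rec.prems(2) a(2) by (force simp: ran_def)
        show "\<forall>x y. (x, y) \<in> rext E (dom S) (dom S') f \<longrightarrow> x \<in> rfv p \<longrightarrow> y \<in> rfv p' \<longrightarrow>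
          ?\<sigma> x = None \<and> ?\<tau> y = None \<and> (x, y) \<in> rext F (dom S) (dom S') f \<or>
          (\<exists>a b. ?\<sigma> x = Some a \<and> ?\<tau> y = Some b \<and> alpha (rext F (dom S) (dom S') f) a b)"
        proof (intro allI impI)
          fix x y assume e: "(x, y) \<in> rext E (dom S) (dom S') f" "x \<in> rfv p" "y \<in> rfv p'"
          show "?\<sigma> x = None \<and> ?\<tau> y = None \<and> (x, y) \<in> rext F (dom S) (dom S') f \<or>
            (\<exists>a b. ?\<sigma> x = Some a \<and> ?\<tau> y = Some b \<and> alpha (rext F (dom S) (dom S') f) a b)"
          proof (cases "x \<in> dom S")
            case True
            with e(1) have "y = f x" by (auto simp: rext_def)
            with True bij_betwE[OF alpha_Rec.hyps(1)] show ?thesis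
              by (auto simp: rext_def restrict_map_def)
          next
            case False
            with e(1) have xy: "(x, y) \<in> E" "y \<notin> dom S'" by (auto simp: rext_def)
            have fx: "x \<in> rfv (RRec X S)" using False e(2) a(1) by (force simp: ran_def)
            have fy: "y \<in> rfv (RRec X' S')" using xy(2) e(3) a(2) by (force simp: ran_def)
            consider "\<sigma> x = None" "\<tau> y = None" "(x, y) \<in> F"
              | b c where "\<sigma> x = Some b" "\<tau> y = Some c" "alpha F b c"
              using alpha_Rec.prems(3)[rule_format, OF xy(1) fx fy] by (elim disjE exE conjE)
            then show ?thesis
            proof cases
              case 1
              with False xy(2) show ?thesis by (auto simp: rext_def restrict_map_def)
            next
              case 2
              from alpha_Rec.prems(1) fx 2(1) have "rfv b \<inter> dom S = {}"
                unfolding capture_free.simps by blast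
              moreover from alpha_Rec.prems(2) fy 2(2) have "rfv c \<inter> dom S' = {}"
                unfolding capture_free.simps by blast
              ultimately have "F \<inter> rfv b \<times> rfv c \<subseteq> rext F (dom S) (dom S') f"
                unfolding rext_def by blast
              with alpha_restrict[OF 2(3)] have "alpha (rext F (dom S) (dom S') f) b c"
                by (rule alpha_mono)
              with 2 False xy(2) show ?thesis by simp
            qed
          qed
        qed
      qed
    qed
  qed (use alpha_Rec.hyps in auto)
qed

lemma capture_free_closed: "(\<And>x q. \<sigma> x = Some q \<Longrightarrow> rfv q = {}) \<Longrightarrow> capture_free p \<sigma>"
proof (induction p arbitrary: \<sigma>)
  case (RRec X S)
  have "capture_free p (\<sigma> |` (- dom S))" if "S Y = Some p" for Y p
  proof (rule RRec.IH)
    show "S Y \<in> range S" by (rule rangeI)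
    show "p \<in> set_option (S Y)" using that by simp
  qed (use RRec.prems in \<open>auto simp: restrict_map_def split: if_splits\<close>)
  moreover have "\<forall>y q. \<sigma> y = Some q \<longrightarrow> rfv q \<inter> dom S = {}"
    using RRec.prems by blast
  ultimately show ?case by (auto simp: ran_def)
qed auto

text \<open>
  Process expressions are identified up to alpha-equivalence.  This is what makes
  capture-avoiding substitution, with renaming of bound variables, single-valued.
\<close>

quotient_type ('v, 'o) pexp = "('v, 'o) rexp" / "alpha Id"
proof (rule equivpI)
  show "reflp (alpha Id :: ('v, 'o) rexp \<Rightarrow> _)" by (auto intro: reflpI alpha_refl)
  show "symp (alpha Id :: ('v, 'o) rexp \<Rightarrow> _)" by (auto intro!: sympI dest: alpha_sym)
  show "transp (alpha Id :: ('v, 'o) rexp \<Rightarrow> _)" by (auto intro!: transpI dest: alpha_trans)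
qed

lift_definition PVar :: "'v \<Rightarrow> ('v, 'o) pexp" is RVar .

lift_definition POp :: "'o \<Rightarrow> ('v, 'o) pexp list \<Rightarrow> ('v, 'o) pexp" is ROp
  by (rule alpha_Op)

lift_definition PRec :: "'v \<Rightarrow> ('v \<rightharpoonup> ('v, 'o) pexp) \<Rightarrow> ('v, 'o) pexp" is RRec
proof -
  fix X and S S' :: "'v \<rightharpoonup> ('v, 'o) rexp" assume a: "\<And>Y. rel_option (alpha Id) (S Y) (S' Y)"
  have r: "\<And>Y. S Y = None \<longleftrightarrow> S' Y = None"
    by (metis a option.rel_sel)
  then have d: "dom S = dom S'" by (simp add: dom_def)
  have *: "rext Id (dom S') (dom S') id = Id" by (auto simp: rext_def)
  show "alpha Id (RRec X S) (RRec X S')"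
    by (rule alpha_Rec[where f = id]) (use a in \<open>auto simp: d *, metis option.rel_inject(2)\<close>)
qed

lift_definition fv :: "('v, 'o) pexp \<Rightarrow> 'v set" is rfv
  by (blast dest: alpha_rfv alpha_rfv[OF alpha_sym])

text \<open>
  \<open>subst_to \<sigma> p q\<close> says \<open>q = p[\<sigma>]\<close>: bound variables are first renamed so that no capture occurs.
  It is a partial function of \<open>\<sigma>\<close> and \<open>p\<close>, because with infinite specifications there may be too
  few variables left for a renaming; it is defined for every \<open>p\<close> if the values of \<open>\<sigma>\<close> are closed.
\<close>

definition subst_to ::
  "('v \<rightharpoonup> ('v, 'o) pexp) \<Rightarrow> ('v, 'o) pexp \<Rightarrow> ('v, 'o) pexp \<Rightarrow> bool" where
  "subst_to \<sigma> p q \<longleftrightarrow> (\<exists>p0. abs_pexp p0 = p \<and> capture_free p0 (map_option rep_pexp \<circ> \<sigma>) \<and>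
     q = abs_pexp (rsubst p0 (map_option rep_pexp \<circ> \<sigma>)))"

lemma subst_to_unique:
  fixes \<sigma> :: "'v \<rightharpoonup> ('v, 'o) pexp"
  shows "subst_to \<sigma> p q \<Longrightarrow> subst_to \<sigma> p q' \<Longrightarrow> q = q'"
proof -
  assume "subst_to \<sigma> p q" "subst_to \<sigma> p q'"
  then obtain p0 p1 where a: "abs_pexp p0 = p" "capture_free p0 (map_option rep_pexp \<circ> \<sigma>)"
      "q = abs_pexp (rsubst p0 (map_option rep_pexp \<circ> \<sigma>))"
      "abs_pexp p1 = p" "capture_free p1 (map_option rep_pexp \<circ> \<sigma>)"
      "q' = abs_pexp (rsubst p1 (map_option rep_pexp \<circ> \<sigma>))"
    unfolding subst_to_def by blast
  then have "alpha Id p0 p1" by (metis pexp.abs_eq_iff)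
  then have "alpha Id (rsubst p0 (map_option rep_pexp \<circ> \<sigma>)) (rsubst p1 (map_option rep_pexp \<circ> \<sigma>))"
  proof (rule alpha_rsubst[OF _ a(2) a(5)], intro allI impI)
    fix x y :: 'v assume "(x, y) \<in> Id"
    then show "(map_option rep_pexp \<circ> \<sigma>) x = None \<and> (map_option rep_pexp \<circ> \<sigma>) y = None \<and> (x, y) \<in> Id \<or>
      (\<exists>b c. (map_option rep_pexp \<circ> \<sigma>) x = Some b \<and> (map_option rep_pexp \<circ> \<sigma>) y = Some c \<and> alpha Id b c)"
      by (cases "\<sigma> x") (simp_all add: alpha_refl)
  qed
  with a show ?thesis by (simp add: pexp.abs_eq_iff)
qed

definition psubst :: "('v, 'o) pexp \<Rightarrow> ('v \<rightharpoonup> ('v, 'o) pexp) \<Rightarrow> ('v, 'o) pexp" where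
  "psubst p \<sigma> = (THE q. subst_to \<sigma> p q)"

lemma psubst_eqI: "subst_to \<sigma> p q \<Longrightarrow> psubst p \<sigma> = q"
  unfolding psubst_def using subst_to_unique by blast

lemma subst_to_psubst_closed:
  assumes "\<And>x q. \<sigma> x = Some q \<Longrightarrow> fv q = {}"
  shows "subst_to \<sigma> p (psubst p \<sigma>)"
proof -
  have "capture_free (rep_pexp p) (map_option rep_pexp \<circ> \<sigma>)"
    by (rule capture_free_closed) (use assms in \<open>auto simp: fv.rep_eq\<close>)
  then have "\<exists>q. subst_to \<sigma> p q"
    unfolding subst_to_def by (metis Quotient_abs_rep[OF Quotient_pexp])
  then show ?thesis using psubst_eqI by metis
qed

lemma alpha_rep_pexp: "alpha Id (rep_pexp p) (rep_pexp q) \<longleftrightarrow> p = q"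
  by (metis Quotient_abs_rep[OF Quotient_pexp] pexp.abs_eq_iff)

inductive_cases alpha_OpE: "alpha E (ROp f ps) (ROp g qs)"

lemma POp_eq_iff: "POp f ps = POp g qs \<longleftrightarrow> f = g \<and> ps = qs"
proof
  assume "POp f ps = POp g qs"
  then have "alpha Id (ROp f (map rep_pexp ps)) (ROp g (map rep_pexp qs))"
    by (simp add: POp_def pexp.abs_eq_iff)
  then show "f = g \<and> ps = qs"
    by (rule alpha_OpE) (simp add: list.rel_map alpha_rep_pexp list.rel_eq)
qed simp

text \<open>
  The following predicates look at an arbitrary representative \<open>PRec X S\<close> of a recursive call;
  none of them depends on the names of bound variables.
\<close>

inductive_set expr :: "('o \<times> nat) set \<Rightarrow> ('v, 'o) pexp set" for \<Sigma> where
  "PVar x \<in> expr \<Sigma>"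
| "(f, length ps) \<in> \<Sigma> \<Longrightarrow> \<forall>p \<in> set ps. p \<in> expr \<Sigma> \<Longrightarrow> POp f ps \<in> expr \<Sigma>"
| "X \<in> dom S \<Longrightarrow> \<forall>Y p. S Y = Some p \<longrightarrow> p \<in> expr \<Sigma> \<Longrightarrow> PRec X S \<in> expr \<Sigma>"

definition cexpr :: "('o \<times> nat) set \<Rightarrow> ('v, 'o) pexp set" where
  "cexpr \<Sigma> = {p \<in> expr \<Sigma>. fv p = {}}"

definition recursive_call :: "('v, 'o) pexp \<Rightarrow> bool" where
  "recursive_call p \<longleftrightarrow> (\<exists>X S. p = PRec X S \<and> X \<in> dom S)"

inductive subexp :: "('v, 'o) pexp \<Rightarrow> ('v, 'o) pexp \<Rightarrow> bool" for r where
  "subexp r r"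
| "p \<in> set ps \<Longrightarrow> subexp r p \<Longrightarrow> subexp r (POp f ps)"
| "S Y = Some p \<Longrightarrow> subexp r p \<Longrightarrow> subexp r (PRec X S)"

text \<open>\<open>once x p\<close>: there is at most one free occurrence of \<open>x\<close> in \<open>p\<close>.\<close>

inductive once :: "'v \<Rightarrow> ('v, 'o) pexp \<Rightarrow> bool" for x where
  "x \<notin> fv p \<Longrightarrow> once x p"
| "once x (PVar x)"
| "i < length ps \<Longrightarrow> once x (ps ! i) \<Longrightarrow> \<forall>j < length ps. j \<noteq> i \<longrightarrow> x \<notin> fv (ps ! j) \<Longrightarrow>
    once x (POp f ps)"
| "S Y = Some p \<Longrightarrow> once x p \<Longrightarrow> \<forall>Z q. Z \<noteq> Y \<longrightarrow> S Z = Some q \<longrightarrow> x \<notin> fv q \<Longrightarrow>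
    once x (PRec X S)"

definition univariate :: "('v, 'o) pexp \<Rightarrow> bool" where
  "univariate p \<longleftrightarrow> (\<forall>x. once x p)"

definition is_subst :: "('o \<times> nat) set \<Rightarrow> ('v \<rightharpoonup> ('v, 'o) pexp) \<Rightarrow> bool" where
  "is_subst \<Sigma> \<sigma> \<longleftrightarrow> ran \<sigma> \<subseteq> expr \<Sigma>"

definition closed_subst :: "('o \<times> nat) set \<Rightarrow> ('v \<rightharpoonup> ('v, 'o) pexp) \<Rightarrow> bool" where
  "closed_subst \<Sigma> \<sigma> \<longleftrightarrow> dom \<sigma> = UNIV \<and> ran \<sigma> \<subseteq> cexpr \<Sigma>"

text \<open>\<open>unfolds c p\<close>: \<open>c\<close> is a recursive call \<open>\<langle>X|S\<rangle>\<close> and \<open>p\<close> is \<open>\<langle>S\<^sub>X|S\<rangle>\<close>.\<close>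

definition unfolds :: "('v, 'o) pexp \<Rightarrow> ('v, 'o) pexp \<Rightarrow> bool" where
  "unfolds c p \<longleftrightarrow> (\<exists>X S b. c = PRec X S \<and> S X = Some b \<and>
     subst_to (\<lambda>Y. if Y \<in> dom S then Some (PRec Y S) else None) b p)"


section \<open>Transition system specifications and open transitions\<close>

type_synonym ('v, 'o, 'l) lit = "('v, 'o) pexp \<times> 'l \<times> ('v, 'o) pexp"
type_synonym ('v, 'o, 'l) rule = "('v, 'o, 'l) lit list \<times> ('v, 'o, 'l) lit"

datatype 'n rname = RecAct | RecIn | Name 'n

record ('v, 'o, 'l, 'n) tss =
  signature :: "('o \<times> nat) set"
  rules :: "('v, 'o, 'l) rule set"
  naming :: "('v, 'o, 'l) rule \<Rightarrow> 'n rname"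

fun lit_ok :: "('o \<times> nat) set \<Rightarrow> ('v, 'o, 'l) lit \<Rightarrow> bool" where
  "lit_ok \<Sigma> (p, a, q) \<longleftrightarrow> p \<in> expr \<Sigma> \<and> q \<in> expr \<Sigma>"

fun lit_closed :: "('v, 'o, 'l) lit \<Rightarrow> bool" where
  "lit_closed (p, a, q) \<longleftrightarrow> fv p = {} \<and> fv q = {}"

fun lit_inst :: "('v \<rightharpoonup> ('v, 'o) pexp) \<Rightarrow> ('v, 'o, 'l) lit \<Rightarrow> ('v, 'o, 'l) lit \<Rightarrow> bool" where
  "lit_inst \<sigma> (p, a, q) (p', a', q') \<longleftrightarrow> subst_to \<sigma> p p' \<and> a' = a \<and> subst_to \<sigma> q q'"

definition is_tss :: "('v, 'o, 'l, 'n, 'z) tss_scheme \<Rightarrow> bool" where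
  "is_tss T \<longleftrightarrow> (\<forall>(H, c) \<in> rules T. \<forall>m \<in> set (c # H). lit_ok (signature T) m)"

text \<open>Trees are well-founded because they are finitely branching elements of a datatype.\<close>

datatype ('v, 'w, 'o, 'l, 'n) otree =
    TVar 'w "('v, 'o, 'l) lit"
  | Node "('v, 'o, 'l) lit" "'n rname" "('v, 'w, 'o, 'l, 'n) otree list"

primrec root :: "('v, 'w, 'o, 'l, 'n) otree \<Rightarrow> ('v, 'o, 'l) lit" where
  "root (TVar tx m) = m"
| "root (Node m r ts) = m"

definition src :: "('v, 'w, 'o, 'l, 'n) otree \<Rightarrow> ('v, 'o) pexp" where "src t = fst (root t)"
definition lab :: "('v, 'w, 'o, 'l, 'n) otree \<Rightarrow> 'l" where "lab t = fst (snd (root t))"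
definition tar :: "('v, 'w, 'o, 'l, 'n) otree \<Rightarrow> ('v, 'o) pexp" where "tar t = snd (snd (root t))"

primrec leaves :: "('v, 'w, 'o, 'l, 'n) otree \<Rightarrow> ('w \<times> ('v, 'o, 'l) lit) list" where
  "leaves (TVar tx m) = [(tx, m)]"
| "leaves (Node m r ts) = concat (map leaves ts)"

primrec lits :: "('v, 'w, 'o, 'l, 'n) otree \<Rightarrow> ('v, 'o, 'l) lit list" where
  "lits (TVar tx m) = [m]"
| "lits (Node m r ts) = m # concat (map lits ts)"

inductive derivation ::
  "('v, 'o, 'l, 'n, 'z) tss_scheme \<Rightarrow> ('v, 'w, 'o, 'l, 'n) otree \<Rightarrow> bool" for T where
  "lit_ok (signature T) m \<Longrightarrow> derivation T (TVar tx m)"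
| "(H, c) \<in> rules T \<Longrightarrow> naming T (H, c) = r \<Longrightarrow> is_subst (signature T) \<sigma> \<Longrightarrow>
    list_all2 (lit_inst \<sigma>) H (map root ts) \<Longrightarrow> lit_inst \<sigma> c m \<Longrightarrow> lit_ok (signature T) m \<Longrightarrow>
    \<forall>t \<in> set ts. derivation T t \<Longrightarrow> derivation T (Node m r ts)"

definition open_trans :: "('v, 'o, 'l, 'n, 'z) tss_scheme \<Rightarrow> ('v, 'w, 'o, 'l, 'n) otree \<Rightarrow> bool" where
  "open_trans T t \<longleftrightarrow> derivation T t \<and>
     (\<forall>tx m m'. (tx, m) \<in> set (leaves t) \<longrightarrow> (tx, m') \<in> set (leaves t) \<longrightarrow> m = m')"

definition closed_trans :: "('v, 'o, 'l, 'n, 'z) tss_scheme \<Rightarrow> ('v, 'w, 'o, 'l, 'n) otree set" where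
  "closed_trans T = {t. open_trans T t \<and> leaves t = [] \<and> (\<forall>m \<in> set (lits t). lit_closed m)}"


section \<open>De Simone format for TSSs\<close>

text \<open>
  The label set is the whole type \<open>'l\<close>; \<open>Act\<close> is a subset of it.  \<open>rec_rule Act c p y a\<close> is the
  recursion rule with label \<open>a\<close> for the recursive call \<open>c\<close> with unfolding \<open>p\<close>.
\<close>

definition rec_name :: "'l set \<Rightarrow> 'l \<Rightarrow> 'n rname" where
  "rec_name Act a = (if a \<in> Act then RecAct else RecIn)"

definition rec_rule ::
  "'l set \<Rightarrow> ('v, 'o) pexp \<Rightarrow> ('v, 'o) pexp \<Rightarrow> 'v \<Rightarrow> 'l \<Rightarrow> ('v, 'o, 'l) rule" where
  "rec_rule Act c p y a = ([(p, a, PVar y)], (c, a, if a \<in> Act then PVar y else c))"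

text \<open>
  A trigger is a list over labels and \<open>None\<close>, the latter standing for \<open>*\<close>; its length is the arity.
  Argument positions are counted from \<open>0\<close>, and the premises of a De Simone rule are listed in the
  order of the argument positions.
\<close>

definition trigger_set :: "'l option list \<Rightarrow> nat set" where
  "trigger_set g = {i. i < length g \<and> g ! i \<noteq> None}"

definition ds_rule :: "'l set \<Rightarrow> ('o \<times> nat) set \<Rightarrow> ('v, 'o, 'l) rule \<Rightarrow>
    'o \<Rightarrow> 'l option list \<Rightarrow> 'l \<Rightarrow> ('v, 'o) pexp \<Rightarrow> bool" where
  "ds_rule Act \<Sigma> ru f g a q \<longleftrightarrow> (\<exists>n I x y.
     n = length g \<and> I = trigger_set g \<and>
     ru = (map (\<lambda>i. (PVar (x i), the (g ! i), PVar (y i))) (sorted_list_of_set I),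
           (POp f (map (\<lambda>i. PVar (x i)) [0..<n]), a, q)) \<and>
     (f, n) \<in> \<Sigma> \<and>
     inj_on x {..<n} \<and> inj_on y I \<and> x ` {..<n} \<inter> y ` I = {} \<and>
     q \<in> expr \<Sigma> \<and> univariate q \<and> fv q \<subseteq> x ` ({..<n} - I) \<union> y ` I \<and>
     (\<forall>r. subexp r q \<longrightarrow> recursive_call r \<longrightarrow> fv r = {}) \<and>
     (a \<notin> Act \<longrightarrow> (\<forall>i \<in> I. the (g ! i) \<notin> Act) \<and>
        q = POp f (map (\<lambda>i. PVar (if i \<in> I then y i else x i)) [0..<n])))"

text \<open>
  Recursion rules are required for those calls whose unfolding exists, which includes all
  closed ones (see \<open>subst_to\<close>).
\<close>

definition de_simone_tss :: "'l set \<Rightarrow> ('v, 'o, 'l, 'n, 'z) tss_scheme \<Rightarrow> bool" where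
  "de_simone_tss Act T \<longleftrightarrow> is_tss T \<and>
     (\<forall>c \<in> expr (signature T). \<forall>p a. unfolds c p \<longrightarrow>
        (\<exists>y. y \<notin> fv p \<and> rec_rule Act c p y a \<in> rules T \<and>
             naming T (rec_rule Act c p y a) = rec_name Act a)) \<and>
     (\<forall>ru \<in> rules T.
        (\<exists>c \<in> expr (signature T). \<exists>p y a. unfolds c p \<and> y \<notin> fv p \<and>
           ru = rec_rule Act c p y a \<and> naming T ru = rec_name Act a) \<or>
        (\<exists>f g a q r. ds_rule Act (signature T) ru f g a q \<and> naming T ru = Name r)) \<and>
     (\<forall>ru \<in> rules T. \<forall>ru' \<in> rules T. \<forall>f g a q f' g' a' q'.
        ru \<noteq> ru' \<longrightarrow> naming T ru = naming T ru' \<longrightarrow>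
        ds_rule Act (signature T) ru f g a q \<longrightarrow> ds_rule Act (signature T) ru' f' g' a' q' \<longrightarrow>
        f = f' \<and> length g = length g' \<and> q = q' \<and> trigger_set g = trigger_set g' \<and> g \<noteq> g')"


section \<open>Open transitions as expressions\<close>

text \<open>
  \<open>constructor Act T r n I\<close>: \<open>r\<close> is an \<open>n\<close>-ary transition constructor with trigger set \<open>I\<close>.
\<close>

definition constructor ::
  "'l set \<Rightarrow> ('v, 'o, 'l, 'n, 'z) tss_scheme \<Rightarrow> 'n \<Rightarrow> nat \<Rightarrow> nat set \<Rightarrow> bool" where
  "constructor Act T r n I \<longleftrightarrow> (\<exists>ru \<in> rules T. \<exists>f g a q.
     ds_rule Act (signature T) ru f g a q \<and> naming T ru = Name r \<and>
     n = length g \<and> I = trigger_set g)"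

type_synonym ('v, 'w, 'o, 'l, 'n) targ = "('v, 'o) pexp + ('v, 'w, 'o, 'l, 'n) otree"

text \<open>
  \<open>applied Act T r es t\<close>: \<open>t\<close> is the open transition \<open>r(es)\<close>.  Its label and target are determined by
  \<open>r\<close> and \<open>es\<close>, because \<open>t\<close> has to be a valid open transition.
\<close>

definition applied :: "'l set \<Rightarrow> ('v, 'o, 'l, 'n, 'z) tss_scheme \<Rightarrow> 'n \<Rightarrow>
    ('v, 'w, 'o, 'l, 'n) targ list \<Rightarrow> ('v, 'w, 'o, 'l, 'n) otree \<Rightarrow> bool" where
  "applied Act T r es t \<longleftrightarrow> open_trans T t \<and>
     constructor Act T r (length es) {i. i < length es \<and> \<not> isl (es ! i)} \<and>
     (\<exists>f a q. t = Node (POp f (map (case_sum id src) es), a, q) (Name r) [u. Inr u \<leftarrow> es])"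

text \<open>\<open>rec_applied Act c u\<close> is \<open>rec\<^sub>A\<^sub>c\<^sub>t(X, S, u)\<close> or \<open>rec\<^sub>I\<^sub>n(X, S, u)\<close>, for \<open>c = \<langle>X|S\<rangle>\<close>.\<close>

definition rec_applied ::
  "'l set \<Rightarrow> ('v, 'o) pexp \<Rightarrow> ('v, 'w, 'o, 'l, 'n) otree \<Rightarrow> ('v, 'w, 'o, 'l, 'n) otree" where
  "rec_applied Act c u =
     Node (c, lab u, if lab u \<in> Act then tar u else c) (rec_name Act (lab u)) [u]"

text \<open>
  When an open transition is read as an expression, its variable expressions are its leaves
  \<open>(tx :: m)\<close>, given by \<open>leaves\<close>, and the variables in the process expressions that are displayed:
  the arguments of transition constructors outside the trigger set, and the recursive calls.
  The literals of the nodes are not part of the expression.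
\<close>

definition op_args :: "('v, 'o) pexp \<Rightarrow> ('v, 'o) pexp list" where
  "op_args p = (THE ps. \<exists>f. p = POp f ps)"

definition ctor_triggers :: "'l set \<Rightarrow> ('v, 'o, 'l, 'n, 'z) tss_scheme \<Rightarrow> 'n \<Rightarrow> nat set" where
  "ctor_triggers Act T r = (THE I. \<exists>n. constructor Act T r n I)"

primrec displayed :: "'l set \<Rightarrow> ('v, 'o, 'l, 'n, 'z) tss_scheme \<Rightarrow>
    ('v, 'w, 'o, 'l, 'n) otree \<Rightarrow> ('v, 'o) pexp list" where
  "displayed Act T (TVar tx m) = []"
| "displayed Act T (Node m r ts) =
     (case r of Name r \<Rightarrow> nths (op_args (fst m)) (- ctor_triggers Act T r) | _ \<Rightarrow> [fst m]) @
     concat (map (displayed Act T) ts)"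

definition proc_vars :: "'l set \<Rightarrow> ('v, 'o, 'l, 'n, 'z) tss_scheme \<Rightarrow>
    ('v, 'w, 'o, 'l, 'n) otree \<Rightarrow> 'v set" where
  "proc_vars Act T t = \<Union>(fv ` set (displayed Act T t))"

definition univariate_trans :: "'l set \<Rightarrow> ('v, 'o, 'l, 'n, 'z) tss_scheme \<Rightarrow>
    ('v, 'w, 'o, 'l, 'n) otree \<Rightarrow> bool" where
  "univariate_trans Act T t \<longleftrightarrow> distinct (map fst (leaves t)) \<and>
     (\<forall>p \<in> set (displayed Act T t). univariate p) \<and>
     (\<forall>i < length (displayed Act T t). \<forall>j < length (displayed Act T t). i \<noteq> j \<longrightarrow>
        fv (displayed Act T t ! i) \<inter> fv (displayed Act T t ! j) = {})"


section \<open>TSSs with successors\<close>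

type_synonym ('v, 'w, 'o, 'l, 'n) slit =
  "('v, 'w, 'o, 'l, 'n) otree \<times> ('v, 'w, 'o, 'l, 'n) otree \<times> ('v, 'w, 'o, 'l, 'n) otree"
type_synonym ('v, 'w, 'o, 'l, 'n) srule =
  "('v, 'w, 'o, 'l, 'n) slit list \<times> ('v, 'w, 'o, 'l, 'n) slit"

text \<open>The triple \<open>(t, u, v)\<close> stands for the successor literal \<open>t \<leadsto>\<^sub>u v\<close>.\<close>

record ('v, 'w, 'o, 'l, 'n) tsss = "('v, 'o, 'l, 'n) tss" +
  srules :: "('v, 'w, 'o, 'l, 'n) srule set"

fun is_slit :: "('v, 'o, 'l, 'n, 'z) tss_scheme \<Rightarrow> ('v, 'w, 'o, 'l, 'n) slit \<Rightarrow> bool" where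
  "is_slit T (t, u, v) \<longleftrightarrow> open_trans T t \<and> open_trans T u \<and> open_trans T v \<and>
     src t = src u \<and> src v = tar u"

definition is_tsss :: "('v, 'w, 'o, 'l, 'n) tsss \<Rightarrow> bool" where
  "is_tsss T \<longleftrightarrow> is_tss T \<and> (\<forall>(H, c) \<in> srules T. \<forall>s \<in> set (c # H). is_slit T s)"

text \<open>
  A substitution for process and transition variables is a pair of \<open>\<sigma>\<close> and \<open>\<tau>\<close>.
\<close>

definition is_tsubst :: "('v, 'o, 'l, 'n, 'z) tss_scheme \<Rightarrow>
    ('w \<rightharpoonup> ('v, 'w, 'o, 'l, 'n) otree) \<Rightarrow> bool" where
  "is_tsubst T \<tau> \<longleftrightarrow> (\<forall>w \<in> ran \<tau>. open_trans T w)"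

definition matches :: "('v \<rightharpoonup> ('v, 'o) pexp) \<Rightarrow> ('w \<rightharpoonup> ('v, 'w, 'o, 'l, 'n) otree) \<Rightarrow>
    ('v, 'w, 'o, 'l, 'n) otree \<Rightarrow> bool" where
  "matches \<sigma> \<tau> t \<longleftrightarrow>
     (\<forall>(tx, m) \<in> set (leaves t). \<forall>w. \<tau> tx = Some w \<longrightarrow> lit_inst \<sigma> m (root w))"

inductive tree_inst :: "('v \<rightharpoonup> ('v, 'o) pexp) \<Rightarrow> ('w \<rightharpoonup> ('v, 'w, 'o, 'l, 'n) otree) \<Rightarrow>
    ('v, 'w, 'o, 'l, 'n) otree \<Rightarrow> ('v, 'w, 'o, 'l, 'n) otree \<Rightarrow> bool" for \<sigma> \<tau> where
  "\<tau> tx = Some w \<Longrightarrow> tree_inst \<sigma> \<tau> (TVar tx m) w"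
| "\<tau> tx = None \<Longrightarrow> lit_inst \<sigma> m m' \<Longrightarrow> tree_inst \<sigma> \<tau> (TVar tx m) (TVar tx m')"
| "lit_inst \<sigma> m m' \<Longrightarrow> list_all2 (tree_inst \<sigma> \<tau>) ts ts' \<Longrightarrow>
    tree_inst \<sigma> \<tau> (Node m r ts) (Node m' r ts')"

fun slit_inst :: "('v \<rightharpoonup> ('v, 'o) pexp) \<Rightarrow> ('w \<rightharpoonup> ('v, 'w, 'o, 'l, 'n) otree) \<Rightarrow>
    ('v, 'w, 'o, 'l, 'n) slit \<Rightarrow> ('v, 'w, 'o, 'l, 'n) slit \<Rightarrow> bool" where
  "slit_inst \<sigma> \<tau> (t, u, v) (t', u', v') \<longleftrightarrow>
     matches \<sigma> \<tau> t \<and> matches \<sigma> \<tau> u \<and> matches \<sigma> \<tau> v \<and>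
     tree_inst \<sigma> \<tau> t t' \<and> tree_inst \<sigma> \<tau> u u' \<and> tree_inst \<sigma> \<tau> v v'"

inductive succ :: "('v, 'w, 'o, 'l, 'n) tsss \<Rightarrow> ('v, 'w, 'o, 'l, 'n) slit \<Rightarrow> bool" for T where
  "(H, c) \<in> srules T \<Longrightarrow> is_subst (signature T) \<sigma> \<Longrightarrow> is_tsubst T \<tau> \<Longrightarrow>
    list_all2 (slit_inst \<sigma> \<tau>) H H' \<Longrightarrow> slit_inst \<sigma> \<tau> c (t, u, v) \<Longrightarrow>
    t \<in> closed_trans T \<Longrightarrow> u \<in> closed_trans T \<Longrightarrow> v \<in> closed_trans T \<Longrightarrow> is_slit T (t, u, v) \<Longrightarrow>
    \<forall>s \<in> set H'. succ T s \<Longrightarrow> succ T (t, u, v)"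


section \<open>De Simone format for TSSSs\<close>

definition rec_srule :: "'l set \<Rightarrow> ('v, 'o) pexp \<Rightarrow> ('v, 'o) pexp \<Rightarrow> 'l \<Rightarrow> 'l \<Rightarrow> 'l \<Rightarrow>
    'v \<Rightarrow> 'v \<Rightarrow> 'v \<Rightarrow> 'w \<Rightarrow> 'w \<Rightarrow> 'w \<Rightarrow> ('v, 'w, 'o, 'l, 'n) srule" where
  "rec_srule Act c p xa ya za x' y' z' tx ty tz =
     (let X = TVar tx (p, xa, PVar x');
          Y = TVar ty (p, ya, PVar y');
          Z = TVar tz (PVar y', za, PVar z')
      in ([(X, Y, Z)],
          (rec_applied Act c X, rec_applied Act c Y,
           if ya \<in> Act then Z else rec_applied Act c X)))"

definition rec_srule_vars ::
  "('v, 'o) pexp \<Rightarrow> 'v \<Rightarrow> 'v \<Rightarrow> 'v \<Rightarrow> 'w \<Rightarrow> 'w \<Rightarrow> 'w \<Rightarrow> bool" where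
  "rec_srule_vars c x' y' z' tx ty tz \<longleftrightarrow>
     distinct [x', y', z'] \<and> {x', y', z'} \<inter> fv c = {} \<and> distinct [tx, ty, tz]"

text \<open>
  In \<open>ds_srule\<close>, \<open>A\<close> and \<open>B\<close> are the sets of positions at which the arguments of \<open>r\<close> and of \<open>s\<close>,
  respectively, are transitions rather than process expressions.
\<close>

definition ds_srule :: "'l set \<Rightarrow> ('v, 'w, 'o, 'l, 'n) tsss \<Rightarrow>
    ('v, 'w, 'o, 'l, 'n) srule \<Rightarrow> bool" where
  "ds_srule Act T ru \<longleftrightarrow>
     (\<exists>n I A B x x' y' z' xa ya za tx ty tz r s t u v X Y Z Z0 xe ye.
       X = (\<lambda>i. TVar (tx i) (PVar (x i), xa i, PVar (x' i))) \<and>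
       Y = (\<lambda>i. TVar (ty i) (PVar (x i), ya i, PVar (y' i))) \<and>
       Z = (\<lambda>i. TVar (tz i) (PVar (y' i), za i, PVar (z' i))) \<and>
       Z0 = (\<lambda>i. (tz i, (PVar (x i), za i, PVar (z' i)))) \<and>
       xe = (\<lambda>i. if i \<in> A then Inr (X i) else Inl (PVar (x i))) \<and>
       ye = (\<lambda>i. if i \<in> B then Inr (Y i) else Inl (PVar (x i))) \<and>
       ru = (map (\<lambda>i. (X i, Y i, Z i)) (sorted_list_of_set I), (t, u, v)) \<and>
       A \<subseteq> {..<n} \<and> B \<subseteq> {..<n} \<and> I \<subseteq> A \<inter> B \<and>
       distinct (map x [0..<n] @ map x' [0..<n] @ map y' [0..<n] @ map z' [0..<n]) \<and>
       distinct (map tx [0..<n] @ map ty [0..<n] @ map tz [0..<n]) \<and>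
       applied Act T r (map xe [0..<n]) t \<and>
       applied Act T s (map ye [0..<n]) u \<and>
       open_trans T v \<and> src t = src u \<and> src v = tar u \<and>
       univariate_trans Act T v \<and>
       proc_vars Act T v \<subseteq> x ` ({..<n} - A - B) \<union> y' ` (B - I) \<and>
       set (leaves v) \<subseteq> Z0 ` ({..<n} - A - B) \<union>
         (\<Union>i \<in> A - B. set (leaves (X i))) \<union> (\<Union>i \<in> B. set (leaves (Z i))) \<and>
       (lab u \<notin> Act \<longrightarrow>
          (\<forall>i \<in> I. ya i \<notin> Act) \<and> A \<inter> B \<subseteq> I \<and>
          applied Act T r (map (\<lambda>i. if i \<in> I then Inr (Z i)
            else if i \<notin> B then xe i else Inl (PVar (y' i))) [0..<n]) v))"

text \<open>
  The successor rule for a recursive call needs three process variables that are not free in it.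
  Closed calls always have them; an open call with infinitely many free variables may not,
  and then no rule is required.
\<close>

definition de_simone_tsss :: "'l set \<Rightarrow> ('v, 'w, 'o, 'l, 'n) tsss \<Rightarrow> bool" where
  "de_simone_tsss Act T \<longleftrightarrow> is_tsss T \<and> de_simone_tss Act T \<and>
     (\<forall>c \<in> expr (signature T). \<forall>p xa ya za. unfolds c p \<longrightarrow>
        (\<exists>x' y' z'. distinct [x', y', z'] \<and> {x', y', z'} \<inter> fv c = {}) \<longrightarrow>
        (\<exists>x' y' z' tx ty tz. rec_srule_vars c x' y' z' tx ty tz \<and>
           rec_srule Act c p xa ya za x' y' z' tx ty tz \<in> srules T)) \<and>
     (\<forall>ru \<in> srules T.
        (\<exists>c \<in> expr (signature T). \<exists>p xa ya za x' y' z' tx ty tz.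
           unfolds c p \<and> rec_srule_vars c x' y' z' tx ty tz \<and>
           ru = rec_srule Act c p xa ya za x' y' z' tx ty tz) \<or>
        ds_srule Act T ru)"


section \<open>Labelled transition systems with successors\<close>

record ('s, 't, 'l) ltss =
  states :: "'s set"
  transitions :: "'t set"
  source :: "'t \<Rightarrow> 's"
  target :: "'t \<Rightarrow> 's"
  label :: "'t \<Rightarrow> 'l"
  successors :: "('t \<times> 't \<times> 't) set"

definition is_ltss :: "('s, 't, 'l) ltss \<Rightarrow> bool" where
  "is_ltss L \<longleftrightarrow>
     (\<forall>t \<in> transitions L. source L t \<in> states L \<and> target L t \<in> states L) \<and>
     successors L \<subseteq> transitions L \<times> transitions L \<times> transitions L \<and>
     (\<forall>(t, u, v) \<in> successors L. source L t = source L u \<and> source L v = target L u)"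

definition en :: "('s, 't, 'l) ltss \<Rightarrow> 's \<Rightarrow> 't set" where
  "en L p = {t \<in> transitions L. source L t = p}"

definition ep_bisimulation :: "('s, 't, 'l) ltss \<Rightarrow> ('s \<times> 's \<times> ('t \<times> 't) set) set \<Rightarrow> bool" where
  "ep_bisimulation L \<R> \<longleftrightarrow>
     \<R> \<subseteq> states L \<times> states L \<times> Pow (transitions L \<times> transitions L) \<and>
     (\<forall>(p, q, R) \<in> \<R>.
        R \<subseteq> en L p \<times> en L q \<and>
        (\<forall>t \<in> en L p. \<exists>u \<in> en L q. (t, u) \<in> R) \<and>
        (\<forall>u \<in> en L q. \<exists>t \<in> en L p. (t, u) \<in> R) \<and>
        (\<forall>(t, u) \<in> R. label L t = label L u)) \<and>
     (\<forall>(p, q, R) \<in> \<R>. \<forall>(v, w) \<in> R. \<exists>R'. (target L v, target L w, R') \<in> \<R> \<and>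
        (\<forall>t u t'. (t, u) \<in> R \<longrightarrow> (t, v, t') \<in> successors L \<longrightarrow>
           (\<exists>u'. (u, w, u') \<in> successors L \<and> (t', u') \<in> R')) \<and>
        (\<forall>t u u'. (t, u) \<in> R \<longrightarrow> (u, w, u') \<in> successors L \<longrightarrow>
           (\<exists>t'. (t, v, t') \<in> successors L \<and> (t', u') \<in> R')))"

definition ep_bisimilar :: "('s, 't, 'l) ltss \<Rightarrow> 's \<Rightarrow> 's \<Rightarrow> bool" where
  "ep_bisimilar L p q \<longleftrightarrow> (\<exists>\<R> R. ep_bisimulation L \<R> \<and> (p, q, R) \<in> \<R>)"

definition ltss_of :: "('v, 'w, 'o, 'l, 'n) tsss \<Rightarrow>
    (('v, 'o) pexp, ('v, 'w, 'o, 'l, 'n) otree, 'l) ltss" where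
  "ltss_of T = \<lparr>states = cexpr (signature T), transitions = closed_trans T,
     source = src, target = tar, label = lab, successors = {s. succ T s}\<rparr>"

lemma is_ltss_ltss_of: "is_ltss (ltss_of T)"
proof -
  have "src t \<in> cexpr (signature T) \<and> tar t \<in> cexpr (signature T)" if "t \<in> closed_trans T" for t
  proof -
    obtain p a q where m: "root t = (p, a, q)" by (cases "root t")
    have "derivation T t" using that by (simp add: closed_trans_def open_trans_def)
    then have "lit_ok (signature T) (root t)" by cases simp_all
    moreover have "lit_closed (root t)" using that by (cases t) (simp_all add: closed_trans_def)
    ultimately show ?thesis by (simp add: m src_def tar_def cexpr_def)
  qed
  moreover have "t \<in> closed_trans T \<and> u \<in> closed_trans T \<and> v \<in> closed_trans T \<and>
      src t = src u \<and> src v = tar u" if "succ T (t, u, v)" for t u v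
    using that by cases simp
  ultimately show ?thesis by (auto simp: is_ltss_def ltss_of_def)
qed

end

theory Submission
  imports Defs
begin

text \<open>
  Replace the free variables of an open expression by holes, that is, by fresh constants.  This
  turns the expression into a closed context \<open>C\<close>, and filling the holes with the closed expressions
  \<open>\<rho> x\<close> gives back the substituted expression.  Contexts are used instead of open expressions because
  an open recursive call may have no unfolding: a specification may bind so many variables that none
  is left for renaming.  A closed call always has one.

  Let \<open>W x\<close> relate the transitions of \<open>\<rho> x\<close> with those of \<open>\<nu> x\<close>.  Two transitions from \<open>C[\<rho>]\<close> and from
  \<open>C[\<nu>]\<close> are related along \<open>C\<close> if they apply the same rules while they follow the structure of \<open>C\<close>,
  and their subtransitions at the holes are related by \<open>W\<close>.  The least set of triples that contains
  all ep-bisimulations and is closed under contexts in this way is an ep-bisimulation.  Indeed, after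
  a transition of \<open>f(p\<^sub>1, \<dots>, p\<^sub>n)\<close> the target of the applied rule is the next context; its holes are
  filled with the arguments that did not move and with the targets of those that did.  A successor
  derivation for the left transitions is turned into one for the right transitions by instantiating
  the same successor rule with the related transitions.
\<close>


section \<open>Substitution\<close>

text \<open>The third component of a triple shapes the argument. It is not enough to relate two
  states: one must say which of their transitions correspond, and the same two states may arise from
  different contexts with different correspondences. So the correspondence is attached to the
  context and not to the pair of states. Inductions run along transitions or derivations. Unfolding
  a recursive call does not make the context smaller, but it does strip a node off the transition. A
  rule name alone does not determine a De Simone rule; the name together with the labels of the
  subtransitions does. Labels are therefore carried along, and related transitions become instances
  of one rule with one target. Finally, transition rules and successor rules use different
  variables. A successor rule yields its result along an instance of the target \<open>q\<close> of
  a transition rule, while the next triple is formed along \<open>q\<close> itself.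
  \<open>ctx_rel_subst\<close> mediates, and there the closedness of recursive calls in
  \<open>q\<close> keeps holes out of specifications.\<close>

text \<open>The rule generated by the datatype phrases the hypothesis for specifications through
  \<open>range\<close> and \<open>set_option\<close>, which is awkward to instantiate.\<close>

lemma rexp_induct [case_names RVar ROp RRec]:
  assumes "\<And>x. P (RVar x)"
    and "\<And>f ps. (\<And>p. p \<in> set ps \<Longrightarrow> P p) \<Longrightarrow> P (ROp f ps)"
    and "\<And>X S. (\<And>Y p. S Y = Some p \<Longrightarrow> P p) \<Longrightarrow> P (RRec X S)"
  shows "P p"
proof (induction p)
  case (RRec X S)
  show ?case
  proof (rule assms(3))
    show "P p" if "S Y = Some p" for Y p
      using RRec[of "S Y" p] that by (metis option.set_intros rangeI)
  qed
qed (use assms in blast)+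

lemma ran_map_option: "ran (\<lambda>Y. map_option f (S Y)) = f ` ran S"
  by (force simp: ran_def)

lemma rfv_RRec: "rfv (RRec X S) = {x. x \<notin> dom S \<and> (\<exists>Y p. S Y = Some p \<and> x \<in> rfv p)}"
  by (auto simp: ran_def)

lemma capture_free_RRec: "capture_free (RRec X S) \<sigma> \<longleftrightarrow>
    (\<forall>y \<in> rfv (RRec X S). \<forall>q. \<sigma> y = Some q \<longrightarrow> rfv q \<inter> dom S = {}) \<and>
    (\<forall>Y p. S Y = Some p \<longrightarrow> capture_free p (\<sigma> |` (- dom S)))"
  unfolding capture_free.simps ran_map_option by (auto simp: ran_def)

lemma capture_free_ROp: "capture_free (ROp f ps) \<sigma> \<longleftrightarrow> (\<forall>p \<in> set ps. capture_free p \<sigma>)"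
  by auto

lemma rsubst_cong:
  "(\<And>x. x \<in> rfv p \<Longrightarrow> \<sigma> x = \<tau> x) \<Longrightarrow> rsubst p \<sigma> = rsubst p \<tau>"
proof (induction p arbitrary: \<sigma> \<tau> rule: rexp_induct)
  case (RRec X S)
  have "rsubst p (\<sigma> |` (- dom S)) = rsubst p (\<tau> |` (- dom S))" if "S Y = Some p" for Y p
    using that
  proof (rule RRec.IH)
    fix x assume "x \<in> rfv p"
    then show "(\<sigma> |` (- dom S)) x = (\<tau> |` (- dom S)) x"
      using RRec.prems[of x] that by (auto simp: rfv_RRec restrict_map_def simp del: rfv.simps)
  qed
  then show ?case by (auto simp: fun_eq_iff intro!: option.map_cong)
next
  case (ROp f ps)
  have "rsubst p \<sigma> = rsubst p \<tau>" if "p \<in> set ps" for p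
    using that by (rule ROp.IH) (use that ROp.prems in auto)
  then show ?case by simp
qed simp

lemma capture_free_cong:
  "(\<And>x. x \<in> rfv p \<Longrightarrow> \<sigma> x = \<tau> x) \<Longrightarrow> capture_free p \<sigma> \<longleftrightarrow> capture_free p \<tau>"
proof (induction p arbitrary: \<sigma> \<tau> rule: rexp_induct)
  case (RRec X S)
  have "capture_free p (\<sigma> |` (- dom S)) = capture_free p (\<tau> |` (- dom S))" if "S Y = Some p" for Y p
    using that
  proof (rule RRec.IH)
    fix x assume "x \<in> rfv p"
    then show "(\<sigma> |` (- dom S)) x = (\<tau> |` (- dom S)) x"
      using RRec.prems[of x] that by (auto simp: rfv_RRec restrict_map_def simp del: rfv.simps)
  qed
  with RRec.prems show ?case unfolding capture_free_RRec by (metis (no_types, lifting))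
next
  case (ROp f ps)
  have "capture_free p \<sigma> \<longleftrightarrow> capture_free p \<tau>" if "p \<in> set ps" for p
    using that by (rule ROp.IH) (use that ROp.prems in auto)
  then show ?case unfolding capture_free_ROp by blast
qed simp

lemma rsubst_empty: "rsubst p Map.empty = p"
proof (induction p rule: rexp_induct)
  case (RRec X S)
  have "map_option (\<lambda>p. rsubst p Map.empty) (S Y) = S Y" for Y
    using RRec by (cases "S Y") simp_all
  then show ?case by simp
qed (simp_all add: map_idI)

lemma rfv_rsubst:
  "capture_free p \<sigma> \<Longrightarrow>
    rfv (rsubst p \<sigma>) = (\<Union>x \<in> rfv p. case \<sigma> x of None \<Rightarrow> {x} | Some q \<Rightarrow> rfv q)"
proof (induction p arbitrary: \<sigma> rule: rexp_induct)
  case (RVar x)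
  then show ?case by (auto split: option.splits)
next
  case (ROp f ps)
  then show ?case unfolding capture_free_ROp by auto
next
  case (RRec X S)
  let ?t = "\<sigma> |` (- dom S)"
  have IH: "rfv (rsubst p ?t) = (\<Union>x \<in> rfv p. case ?t x of None \<Rightarrow> {x} | Some q \<Rightarrow> rfv q)"
    if "S Y = Some p" for Y p
    by (rule RRec.IH[OF that]) (use that RRec.prems in \<open>simp add: capture_free_RRec del: capture_free.simps\<close>)
  have cf: "\<sigma> x = Some q \<Longrightarrow> rfv q \<inter> dom S = {}" if "S Y = Some p" "x \<in> rfv p" "x \<notin> dom S" for x q Y p
    using RRec.prems that unfolding capture_free_RRec rfv_RRec by blast
  have d: "dom (\<lambda>Y. map_option (\<lambda>p. rsubst p ?t) (S Y)) = dom S" by auto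
  have 1: "z \<in> rfv (rsubst (RRec X S) \<sigma>) \<longleftrightarrow>
      z \<notin> dom S \<and> (\<exists>Y p. S Y = Some p \<and> z \<in> rfv (rsubst p ?t))" for z
    unfolding rsubst.simps rfv_RRec d by auto
  have 2: "z \<in> rfv (rsubst p ?t) \<longleftrightarrow>
      (\<exists>x \<in> rfv p. x \<notin> dom S \<and> z \<in> (case \<sigma> x of None \<Rightarrow> {x} | Some q \<Rightarrow> rfv q))"
    if "S Y = Some p" "z \<notin> dom S" for z Y p
    unfolding IH[OF that(1)] using that(2) by (force simp: restrict_map_def split: option.splits if_splits)
  \<comment> \<open>Here freedom from capture enters: a variable brought in by
    \<open>\<sigma>\<close> is not bound by \<open>S\<close>.\<close>
  have 3: "z \<notin> dom S" if "S Y = Some p" "x \<in> rfv p" "x \<notin> dom S"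
      "z \<in> (case \<sigma> x of None \<Rightarrow> {x} | Some q \<Rightarrow> rfv q)" for z x Y p
    using cf[OF that(1-3)] that(3,4) by (auto split: option.splits)
  show ?case
  proof (rule set_eqI)
    fix z
    let ?K = "\<lambda>x. case \<sigma> x of None \<Rightarrow> {x} | Some q \<Rightarrow> rfv q"
    have "z \<in> rfv (rsubst (RRec X S) \<sigma>) \<longleftrightarrow>
        (\<exists>x Y p. S Y = Some p \<and> x \<in> rfv p \<and> x \<notin> dom S \<and> z \<in> ?K x)"
    proof
      assume "z \<in> rfv (rsubst (RRec X S) \<sigma>)"
      then obtain Y p where "z \<notin> dom S" "S Y = Some p" "z \<in> rfv (rsubst p ?t)" using 1 by blast
      with 2 show "\<exists>x Y p. S Y = Some p \<and> x \<in> rfv p \<and> x \<notin> dom S \<and> z \<in> ?K x" by blast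
    next
      assume "\<exists>x Y p. S Y = Some p \<and> x \<in> rfv p \<and> x \<notin> dom S \<and> z \<in> ?K x"
      then obtain x Y p where *: "S Y = Some p" "x \<in> rfv p" "x \<notin> dom S" "z \<in> ?K x" by blast
      then have "z \<notin> dom S" by (rule 3)
      with * 2 have "z \<in> rfv (rsubst p ?t)" by blast
      with * \<open>z \<notin> dom S\<close> 1 show "z \<in> rfv (rsubst (RRec X S) \<sigma>)" by blast
    qed
    also have "\<dots> \<longleftrightarrow> z \<in> (\<Union>x \<in> rfv (RRec X S). ?K x)"
      unfolding rfv_RRec UN_iff mem_Collect_eq by blast
    finally show "z \<in> rfv (rsubst (RRec X S) \<sigma>) \<longleftrightarrow> z \<in> (\<Union>x \<in> rfv (RRec X S). ?K x)" .
  qed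
qed

text \<open>The closed values of \<open>\<tau>\<close> can neither be captured nor add free
  variables, so the only danger lies in \<open>\<sigma>\<close>, and composing with
  \<open>\<tau>\<close> does not increase it.\<close>

lemma rsubst_capture_free_comp:
  assumes "capture_free p \<sigma>" and "\<And>x q. \<tau> x = Some q \<Longrightarrow> rfv q = {}"
  defines "\<rho> \<equiv> \<lambda>x. case \<sigma> x of None \<Rightarrow> \<tau> x | Some q \<Rightarrow> Some (rsubst q \<tau>)"
  shows "rsubst (rsubst p \<sigma>) \<tau> = rsubst p \<rho> \<and> capture_free p \<rho>"
  using assms(1,2) unfolding \<rho>_def
proof (induction p arbitrary: \<sigma> \<tau> rule: rexp_induct)
  case (RVar x)
  then show ?case by (auto split: option.splits)
next
  case (ROp f ps)
  then show ?case unfolding capture_free_ROp by auto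
next
  case (RRec X S)
  let ?s = "\<sigma> |` (- dom S)" and ?t = "\<tau> |` (- dom S)"
  let ?c = "\<lambda>x. case \<sigma> x of None \<Rightarrow> \<tau> x | Some q \<Rightarrow> Some (rsubst q \<tau>)"
  let ?d = "\<lambda>x. case ?s x of None \<Rightarrow> ?t x | Some q \<Rightarrow> Some (rsubst q ?t)"
  have cf: "capture_free p ?s" if "S Y = Some p" for Y p
    using RRec.prems(1) that unfolding capture_free_RRec by blast
  have cl: "rfv q = {}" if "?t x = Some q" for x q
    using RRec.prems(2) that by (simp add: restrict_map_def split: if_splits)
  have d: "dom (\<lambda>Y. map_option (\<lambda>p. rsubst p ?s) (S Y)) = dom S" by auto
  have *: "rsubst (rsubst p ?s) ?t = rsubst p (?c |` (- dom S))" "capture_free p (?c |` (- dom S))"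
    if Y: "S Y = Some p" for Y p
  proof -
    \<comment> \<open>Below the binder, \<open>?d\<close> applies the restricted
      \<open>\<tau>\<close> to the values of \<open>\<sigma>\<close>, whereas \<open>?c\<close>
      applies all of \<open>\<tau>\<close>. The difference vanishes because these values contain no
      variable bound by \<open>S\<close>.\<close>
    have e: "?d x = (?c |` (- dom S)) x" if x: "x \<in> rfv p" for x
    proof -
      have "rsubst q ?t = rsubst q \<tau>" if "\<sigma> x = Some q" "x \<notin> dom S" for q
      proof (rule rsubst_cong)
        fix z assume "z \<in> rfv q"
        then have "z \<notin> dom S"
          using RRec.prems(1) that x Y unfolding capture_free_RRec rfv_RRec by blast
        then show "?t z = \<tau> z" by simp
      qed
      then show ?thesis by (auto simp: restrict_map_def split: option.splits)
    qed
    have IH: "rsubst (rsubst p ?s) ?t = rsubst p ?d \<and> capture_free p ?d"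
      by (rule RRec.IH[OF Y cf[OF Y] cl])
    then show "rsubst (rsubst p ?s) ?t = rsubst p (?c |` (- dom S))"
      using rsubst_cong[OF e] by simp
    show "capture_free p (?c |` (- dom S))"
      using IH capture_free_cong[OF e] by simp
  qed
  have "rfv q \<inter> dom S = {}" if y: "y \<in> rfv (RRec X S)" and q: "?c y = Some q" for y q
  proof (cases "\<sigma> y")
    case None
    with q RRec.prems(2) show ?thesis by simp
  next
    case (Some r)
    have "rfv (rsubst r \<tau>) \<subseteq> rfv r"
      using rfv_rsubst[OF capture_free_closed[of \<tau> r]] RRec.prems(2)
      by (auto split: option.splits)
    then show ?thesis using Some q y RRec.prems(1) unfolding capture_free_RRec by fastforce
  qed
  then have "capture_free (RRec X S) ?c" unfolding capture_free_RRec using *(2) by blast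
  moreover have "rsubst (rsubst (RRec X S) \<sigma>) \<tau> = rsubst (RRec X S) ?c"
    unfolding rsubst.simps d using *(1)
    by (auto simp: fun_eq_iff option.map_comp intro!: option.map_cong)
  ultimately show ?case by blast
qed

text \<open>Capture depends only on the free variables of the values. This allows exchanging the
  values for other representatives of the same classes in \<open>subst_toI\<close>.\<close>

lemma capture_free_mono:
  assumes "capture_free p \<sigma>"
    and "\<And>x q. \<tau> x = Some q \<Longrightarrow> \<exists>r. \<sigma> x = Some r \<and> rfv q \<subseteq> rfv r"
  shows "capture_free p \<tau>"
  using assms
proof (induction p arbitrary: \<sigma> \<tau> rule: rexp_induct)
  case (ROp f ps)
  have "capture_free p \<tau>" if "p \<in> set ps" for p
    by (rule ROp.IH[OF that, of \<sigma>]) (use that ROp.prems in auto)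
  then show ?case unfolding capture_free_ROp by blast
next
  case (RRec X S)
  have "capture_free p (\<tau> |` (- dom S))" if Y: "S Y = Some p" for Y p
  proof (rule RRec.IH[OF Y])
    show "capture_free p (\<sigma> |` (- dom S))"
      using RRec.prems(1) Y unfolding capture_free_RRec by blast
    show "\<exists>r. (\<sigma> |` (- dom S)) x = Some r \<and> rfv q \<subseteq> rfv r" if "(\<tau> |` (- dom S)) x = Some q" for x q
      using that RRec.prems(2)[of x q] by (auto simp: restrict_map_def split: if_splits)
  qed
  moreover have "rfv q \<inter> dom S = {}" if y: "y \<in> rfv (RRec X S)" and q: "\<tau> y = Some q" for y q
  proof -
    from RRec.prems(2)[OF q] obtain r where "\<sigma> y = Some r" "rfv q \<subseteq> rfv r" by blast
    with RRec.prems(1) y show ?thesis unfolding capture_free_RRec by blast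
  qed
  ultimately show ?case unfolding capture_free_RRec by blast
qed simp

section \<open>Constructors and capture-avoiding substitution on alpha-equivalence classes\<close>

lemma PRec_abs: "PRec X (map_option abs_pexp \<circ> S) = abs_pexp (RRec X S)"
  using PRec.abs_eq[of X S] by (simp only: comp_id)

lemma abs_rep_pexp [simp]: "abs_pexp (rep_pexp p) = p"
  by (rule Quotient_abs_rep[OF Quotient_pexp])

lemma map_abs_rep_pexp [simp]: "map (abs_pexp \<circ> rep_pexp) ps = ps"
  by (simp add: map_idI)

lemma alpha_rep_abs: "alpha Id (rep_pexp (abs_pexp p)) p"
  by (simp flip: pexp.abs_eq_iff)

lemma rfv_rep_pexp [simp]: "rfv (rep_pexp p) = fv p"
  by (simp add: fv.rep_eq)

lemma fv_abs_pexp [simp]: "fv (abs_pexp p) = rfv p"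
  by (rule fv.abs_eq)

lemma PRec_eq_abs: "PRec X S = abs_pexp (RRec X (map_option rep_pexp \<circ> S))"
proof -
  have "PRec X (map_option abs_pexp \<circ> (map_option rep_pexp \<circ> S)) = abs_pexp (RRec X (map_option rep_pexp \<circ> S))"
    by (rule PRec_abs)
  moreover have "map_option abs_pexp \<circ> (map_option rep_pexp \<circ> S) = S"
    by (auto simp: fun_eq_iff option.map_comp comp_def option.map_ident)
  ultimately show ?thesis by simp
qed

lemma abs_eq_PVar: "abs_pexp p0 = PVar x \<longleftrightarrow> p0 = RVar x"
proof
  assume "abs_pexp p0 = PVar x"
  then have "alpha Id p0 (RVar x)" by (simp add: PVar.abs_eq pexp.abs_eq_iff)
  then show "p0 = RVar x" by cases simp
qed (simp add: PVar.abs_eq)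

lemma abs_eq_POp: "abs_pexp p0 = POp f ps \<longleftrightarrow> (\<exists>ps0. p0 = ROp f ps0 \<and> ps = map abs_pexp ps0)"
proof
  assume "abs_pexp p0 = POp f ps"
  then have "abs_pexp p0 = abs_pexp (ROp f (map rep_pexp ps))"
    by (metis POp.abs_eq list.map_comp map_abs_rep_pexp)
  then have "alpha Id p0 (ROp f (map rep_pexp ps))" by (simp add: pexp.abs_eq_iff)
  then show "\<exists>ps0. p0 = ROp f ps0 \<and> ps = map abs_pexp ps0"
  proof cases
    case (alpha_Op ps0)
    then have "map abs_pexp ps0 = map abs_pexp (map rep_pexp ps)"
      by (intro nth_equalityI) (auto simp: list_all2_conv_all_nth simp flip: pexp.abs_eq_iff)
    with alpha_Op show ?thesis by simp
  qed
qed (auto simp: POp.abs_eq)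

text \<open>Bound variables may have been renamed, so only the shape of the representative is
  determined.\<close>

lemma abs_eq_PRec: "abs_pexp p0 = PRec X S \<Longrightarrow> \<exists>Y S0. p0 = RRec Y S0"
proof -
  assume "abs_pexp p0 = PRec X S"
  then have "abs_pexp p0 = abs_pexp (RRec X (map_option rep_pexp \<circ> S))"
    by (simp add: PRec_eq_abs)
  then have "alpha Id p0 (RRec X (map_option rep_pexp \<circ> S))" by (simp add: pexp.abs_eq_iff)
  then show ?thesis by cases blast
qed

lemma PVar_inject [simp]: "PVar x = PVar y \<longleftrightarrow> x = y"
  using abs_eq_PVar by (metis PVar.abs_eq rexp.inject(1))

lemma PVar_neq_POp [simp]: "PVar x \<noteq> POp f ps" "POp f ps \<noteq> PVar x"
  using abs_eq_POp abs_eq_PVar by (metis rexp.distinct(1) abs_rep_pexp)+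

lemma PVar_neq_PRec [simp]: "PVar x \<noteq> PRec X S" "PRec X S \<noteq> PVar x"
  using abs_eq_PRec abs_eq_PVar by (metis rexp.distinct(3) abs_rep_pexp)+

lemma POp_neq_PRec [simp]: "POp f ps \<noteq> PRec X S" "PRec X S \<noteq> POp f ps"
  using abs_eq_PRec abs_eq_POp by (metis rexp.distinct(5) abs_rep_pexp)+

lemma pexp_cases [case_names PVar POp PRec]:
  obtains x where "p = PVar x" | f ps where "p = POp f ps" | X S where "p = PRec X S"
proof (cases "rep_pexp p")
  case (RVar x)
  then show ?thesis using that(1) by (metis PVar.abs_eq abs_rep_pexp)
next
  case (ROp f ps)
  then show ?thesis using that(2) by (metis POp.abs_eq abs_rep_pexp)
next
  case (RRec X S)
  then show ?thesis using that(3) by (metis PRec.abs_eq abs_rep_pexp)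
qed

lemma fv_PVar [simp]: "fv (PVar x) = {x}"
  by (simp add: PVar.abs_eq)

lemma fv_POp [simp]: "fv (POp f ps) = \<Union>(fv ` set ps)"
proof -
  have "POp f ps = abs_pexp (ROp f (map rep_pexp ps))"
    by (metis abs_eq_POp map_abs_rep_pexp map_map)
  then show ?thesis by simp
qed

lemma fv_PRec: "fv (PRec X S) = {x. x \<notin> dom S \<and> (\<exists>Y p. S Y = Some p \<and> x \<in> fv p)}"
  unfolding PRec_eq_abs fv_abs_pexp rfv_RRec by fastforce

text \<open>\<open>subst_to\<close> is defined with the representatives that \<open>rep_pexp\<close>
  happens to choose for the values of \<open>\<sigma>\<close>. Any other choice
  \<open>\<tau>\<close> works as well, since by \<open>alpha_rsubst\<close> alpha-equivalent values
  give alpha-equivalent results.\<close>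

lemma subst_toI:
  assumes "capture_free p \<tau>" and "\<And>x. map_option abs_pexp (\<tau> x) = \<sigma> x"
  shows "subst_to \<sigma> (abs_pexp p) (abs_pexp (rsubst p \<tau>))"
proof -
  let ?s = "map_option rep_pexp \<circ> \<sigma>"
  have s: "?s x = map_option (rep_pexp \<circ> abs_pexp) (\<tau> x)" for x
    by (simp flip: assms(2) add: option.map_comp)
  have c: "capture_free p ?s"
    using assms(1)
  proof (rule capture_free_mono)
    fix x q assume "?s x = Some q"
    then show "\<exists>r. \<tau> x = Some r \<and> rfv q \<subseteq> rfv r"
      by (auto simp: s simp del: comp_apply) simp
  qed
  have "alpha Id (rsubst p ?s) (rsubst p \<tau>)"
    using alpha_refl c assms(1)
  proof (rule alpha_rsubst, intro allI impI)
    fix x y :: 'a assume "(x, y) \<in> Id"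
    then show "?s x = None \<and> \<tau> y = None \<and> (x, y) \<in> Id \<or>
      (\<exists>b c. ?s x = Some b \<and> \<tau> y = Some c \<and> alpha Id b c)"
      unfolding s by (cases "\<tau> x") (auto simp: alpha_rep_abs)
  qed
  then have "abs_pexp (rsubst p ?s) = abs_pexp (rsubst p \<tau>)" by (simp add: pexp.abs_eq_iff)
  with c show ?thesis unfolding subst_to_def by metis
qed

lemma subst_toE:
  assumes "subst_to \<sigma> p q"
  obtains p0 where "p = abs_pexp p0" "capture_free p0 (map_option rep_pexp \<circ> \<sigma>)"
    "q = abs_pexp (rsubst p0 (map_option rep_pexp \<circ> \<sigma>))"
  using assms unfolding subst_to_def by blast

text \<open>A partial substitution leaves the variables outside its domain in place.\<close>

definition sapp :: "('v \<rightharpoonup> ('v, 'o) pexp) \<Rightarrow> 'v \<Rightarrow> ('v, 'o) pexp" where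
  "sapp \<sigma> x = (case \<sigma> x of None \<Rightarrow> PVar x | Some q \<Rightarrow> q)"

lemma sapp_Some [simp]: "\<sigma> x = Some q \<Longrightarrow> sapp \<sigma> x = q"
  by (simp add: sapp_def)

lemma subst_to_PVar: "subst_to \<sigma> (PVar x) q \<longleftrightarrow> q = sapp \<sigma> x"
proof -
  have "subst_to \<sigma> (PVar x) (sapp \<sigma> x)"
    using subst_toI[of "RVar x" "map_option rep_pexp \<circ> \<sigma>" \<sigma>]
    by (cases "\<sigma> x") (simp_all add: option.map_comp comp_def option.map_ident sapp_def PVar.abs_eq)
  then show ?thesis using subst_to_unique by blast
qed

lemma subst_to_POp_iff:
  "subst_to \<sigma> (POp f ps) q \<longleftrightarrow> (\<exists>qs. q = POp f qs \<and> list_all2 (subst_to \<sigma>) ps qs)"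
proof
  assume "subst_to \<sigma> (POp f ps) q"
  then obtain p0 where p0: "POp f ps = abs_pexp p0" "capture_free p0 (map_option rep_pexp \<circ> \<sigma>)"
    "q = abs_pexp (rsubst p0 (map_option rep_pexp \<circ> \<sigma>))" by (rule subst_toE)
  then obtain ps0 where ps0: "p0 = ROp f ps0" "ps = map abs_pexp ps0"
    using abs_eq_POp by metis
  have "q = POp f (map (\<lambda>p. abs_pexp (rsubst p (map_option rep_pexp \<circ> \<sigma>))) ps0)"
    unfolding p0 ps0 by (simp add: POp.abs_eq[symmetric] comp_def)
  moreover have "list_all2 (subst_to \<sigma>) ps (map (\<lambda>p. abs_pexp (rsubst p (map_option rep_pexp \<circ> \<sigma>))) ps0)"
    unfolding ps0 using p0(2) unfolding ps0 capture_free_ROp subst_to_def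
    by (auto simp: list_all2_conv_all_nth)
  ultimately show "\<exists>qs. q = POp f qs \<and> list_all2 (subst_to \<sigma>) ps qs" by blast
next
  assume "\<exists>qs. q = POp f qs \<and> list_all2 (subst_to \<sigma>) ps qs"
  then obtain qs where q: "q = POp f qs" and l: "list_all2 (subst_to \<sigma>) ps qs" by blast
  let ?s = "map_option rep_pexp \<circ> \<sigma>"
  \<comment> \<open>Each argument may need its own renaming of bound variables. The representatives
    chosen for the arguments are then assembled into one.\<close>
  have "\<forall>i \<in> {..<length ps}. \<exists>p0. abs_pexp p0 = ps ! i \<and> capture_free p0 ?s \<and> qs ! i = abs_pexp (rsubst p0 ?s)"
    using l by (auto simp: list_all2_conv_all_nth subst_to_def)
  from bchoice[OF this] obtain h where
    h: "\<And>i. i < length ps \<Longrightarrow> abs_pexp (h i) = ps ! i \<and> capture_free (h i) ?s \<and> qs ! i = abs_pexp (rsubst (h i) ?s)"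
    by auto
  let ?p0 = "ROp f (map h [0..<length ps])"
  have "abs_pexp ?p0 = POp f ps"
    unfolding abs_eq_POp using h by (auto intro!: nth_equalityI)
  moreover have "capture_free ?p0 ?s" unfolding capture_free_ROp using h by auto
  moreover have "q = abs_pexp (rsubst ?p0 ?s)"
    unfolding q using h l by (auto simp: POp.abs_eq[symmetric] list_all2_lengthD intro!: nth_equalityI arg_cong[where f = "POp f"])
  ultimately show "subst_to \<sigma> (POp f ps) q" unfolding subst_to_def by blast
qed

lemma fv_subst_to: "subst_to \<sigma> p q \<Longrightarrow> fv q = (\<Union>x \<in> fv p. fv (sapp \<sigma> x))"
  by (erule subst_toE)
    (auto simp: rfv_rsubst sapp_def split: option.splits)

lemma subst_to_cong:
  assumes "subst_to \<sigma> p q" and "\<And>x. x \<in> fv p \<Longrightarrow> \<sigma> x = \<tau> x"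
  shows "subst_to \<tau> p q"
  using assms(1)
proof (rule subst_toE)
  fix p0 assume *: "p = abs_pexp p0" "capture_free p0 (map_option rep_pexp \<circ> \<sigma>)"
    "q = abs_pexp (rsubst p0 (map_option rep_pexp \<circ> \<sigma>))"
  have e: "(map_option rep_pexp \<circ> \<sigma>) x = (map_option rep_pexp \<circ> \<tau>) x" if "x \<in> rfv p0" for x
    using assms(2) that * by simp
  have "capture_free p0 (map_option rep_pexp \<circ> \<tau>)"
    using *(2) capture_free_cong[of p0 "map_option rep_pexp \<circ> \<sigma>" "map_option rep_pexp \<circ> \<tau>"] e
    by blast
  moreover have "q = abs_pexp (rsubst p0 (map_option rep_pexp \<circ> \<tau>))"
    using rsubst_cong[of p0 "map_option rep_pexp \<circ> \<sigma>" "map_option rep_pexp \<circ> \<tau>"] e *(3) by simp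
  ultimately show ?thesis unfolding subst_to_def using *(1) by blast
qed

lemma subst_to_disjoint: "fv p \<inter> dom \<sigma> = {} \<Longrightarrow> subst_to \<sigma> p q \<longleftrightarrow> q = p"
proof -
  assume d: "fv p \<inter> dom \<sigma> = {}"
  have "subst_to Map.empty (abs_pexp (rep_pexp p)) (abs_pexp (rsubst (rep_pexp p) Map.empty))"
    by (rule subst_toI) (rule capture_free_closed, simp_all)
  then have "subst_to Map.empty p p" by (simp add: rsubst_empty)
  then have "subst_to \<sigma> p p"
    by (rule subst_to_cong) (use d in \<open>auto simp: domIff disjoint_iff dest: sym\<close>)
  then show ?thesis using subst_to_unique by blast
qed

section \<open>Substitutions with closed values\<close>

definition ground :: "('v \<rightharpoonup> ('v, 'o) pexp) \<Rightarrow> bool" where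
  "ground \<sigma> \<longleftrightarrow> (\<forall>x q. \<sigma> x = Some q \<longrightarrow> fv q = {})"

text \<open>Closed values cannot be captured, so no renaming is ever required and the substitution
  is defined on every expression.\<close>

lemma subst_to_ground: "ground \<sigma> \<Longrightarrow> subst_to \<sigma> p (psubst p \<sigma>)"
  by (rule subst_to_psubst_closed) (simp add: ground_def)

lemma subst_to_ground_iff: "ground \<sigma> \<Longrightarrow> subst_to \<sigma> p q \<longleftrightarrow> q = psubst p \<sigma>"
  using subst_to_ground psubst_eqI by blast

lemma psubst_PVar [simp]: "psubst (PVar x) \<sigma> = sapp \<sigma> x"
  by (rule psubst_eqI) (simp add: subst_to_PVar)

lemma psubst_POp: "ground \<sigma> \<Longrightarrow> psubst (POp f ps) \<sigma> = POp f (map (\<lambda>p. psubst p \<sigma>) ps)"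
  by (rule psubst_eqI)
    (auto simp: subst_to_POp_iff list_all2_conv_all_nth subst_to_ground)

lemma psubst_cong:
  "ground \<sigma> \<Longrightarrow> (\<And>x. x \<in> fv p \<Longrightarrow> \<sigma> x = \<tau> x) \<Longrightarrow> psubst p \<sigma> = psubst p \<tau>"
  by (rule psubst_eqI[symmetric], rule subst_to_cong, rule subst_to_ground)

lemma psubst_closed [simp]: "fv p = {} \<Longrightarrow> psubst p \<sigma> = p"
  by (rule psubst_eqI) (simp add: subst_to_disjoint)

lemma fv_psubst: "ground \<sigma> \<Longrightarrow> fv (psubst p \<sigma>) = fv p - dom \<sigma>"
  using fv_subst_to[OF subst_to_ground, of \<sigma> p]
  by (auto simp: sapp_def ground_def split: option.splits)

definition scomp ::
  "('v \<rightharpoonup> ('v, 'o) pexp) \<Rightarrow> ('v \<rightharpoonup> ('v, 'o) pexp) \<Rightarrow> ('v \<rightharpoonup> ('v, 'o) pexp)" where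
  "scomp \<sigma> \<tau> x = (case \<sigma> x of None \<Rightarrow> \<tau> x | Some q \<Rightarrow> Some (psubst q \<tau>))"

text \<open>Only the second substitution has to be ground. The first comes from instances of rules
  inside open transitions, where open values occur.\<close>

lemma subst_to_scomp:
  assumes "subst_to \<sigma> p q" and "ground \<tau>"
  shows "subst_to (scomp \<sigma> \<tau>) p (psubst q \<tau>)"
  using assms(1)
proof (rule subst_toE)
  let ?s = "map_option rep_pexp \<circ> \<sigma>" and ?t = "map_option rep_pexp \<circ> \<tau>"
  fix p0 assume *: "p = abs_pexp p0" "capture_free p0 ?s" "q = abs_pexp (rsubst p0 ?s)"
  have c: "rfv r = {}" if "?t x = Some r" for x r
    using assms(2) that by (auto simp: ground_def)
  have ps: "psubst (abs_pexp r) \<tau> = abs_pexp (rsubst r ?t)" for r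
    by (rule psubst_eqI, rule subst_toI, rule capture_free_closed)
      (use assms in \<open>auto simp: ground_def option.map_comp comp_def option.map_ident\<close>)
  let ?c = "\<lambda>x. case ?s x of None \<Rightarrow> ?t x | Some q \<Rightarrow> Some (rsubst q ?t)"
  have comp: "rsubst (rsubst p0 ?s) ?t = rsubst p0 ?c \<and> capture_free p0 ?c"
    by (rule rsubst_capture_free_comp[OF *(2)]) (rule c)
  have "psubst q \<tau> = abs_pexp (rsubst p0 ?c)"
    unfolding *(3) ps by (simp only: conjunct1[OF comp])
  moreover have "capture_free p0 ?c" using comp by (rule conjunct2)
  moreover have "map_option abs_pexp (?c x) = scomp \<sigma> \<tau> x" for x
    using ps[of "rep_pexp (the (\<sigma> x))"] by (cases "\<sigma> x")
      (auto simp: scomp_def option.map_comp comp_def option.map_ident)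
  ultimately have "subst_to (scomp \<sigma> \<tau>) (abs_pexp p0) (abs_pexp (rsubst p0 ?c))"
    by (intro subst_toI)
  with \<open>psubst q \<tau> = _\<close> *(1) show ?thesis by simp
qed

lemma psubst_psubst: "ground \<sigma> \<Longrightarrow> ground \<tau> \<Longrightarrow> psubst (psubst p \<sigma>) \<tau> = psubst p (scomp \<sigma> \<tau>)"
  by (metis psubst_eqI subst_to_ground subst_to_scomp)

lemma dom_map_option_comp [simp]: "dom (\<lambda>Y. map_option f (S Y)) = dom S"
  by (auto simp: dom_def)

lemma ground_restrict: "ground \<sigma> \<Longrightarrow> ground (\<sigma> |` A)"
  by (auto simp: ground_def restrict_map_def split: if_splits)

text \<open>As nothing can be captured, the substitution passes under the binder without renaming,
  whichever presentation \<open>S\<close> of the specification is given.\<close>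

lemma psubst_PRec:
  assumes "ground \<sigma>"
  shows "psubst (PRec X S) \<sigma> = PRec X (\<lambda>Y. map_option (\<lambda>p. psubst p (\<sigma> |` (- dom S))) (S Y))"
proof (rule psubst_eqI)
  let ?s = "map_option rep_pexp \<circ> \<sigma>" and ?S = "map_option rep_pexp \<circ> S"
  have c: "rfv r = {}" if "?s x = Some r" for x r
    using assms that by (auto simp: ground_def)
  have d: "dom ?S = dom S" by (auto simp: dom_def)
  have r: "abs_pexp (rsubst (rep_pexp p) (?s |` (- dom S))) = psubst p (\<sigma> |` (- dom S))" for p
  proof -
    have "subst_to (\<sigma> |` (- dom S)) (abs_pexp (rep_pexp p)) (abs_pexp (rsubst (rep_pexp p) (?s |` (- dom S))))"
      by (rule subst_toI, rule capture_free_closed)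
       (use assms in \<open>auto simp: ground_def restrict_map_def option.map_comp comp_def option.map_ident split: if_splits\<close>)
    then show ?thesis by (metis abs_rep_pexp psubst_eqI)
  qed
  have "subst_to \<sigma> (abs_pexp (RRec X ?S)) (abs_pexp (rsubst (RRec X ?S) ?s))"
    by (rule subst_toI, rule capture_free_closed)
      (use assms in \<open>auto simp: ground_def option.map_comp comp_def option.map_ident\<close>)
  moreover have "abs_pexp (rsubst (RRec X ?S) ?s) =
      PRec X (map_option abs_pexp \<circ> (\<lambda>Y. map_option (\<lambda>p. rsubst p (?s |` (- dom S))) (?S Y)))"
    unfolding PRec_abs rsubst.simps d ..
  moreover have "map_option abs_pexp \<circ> (\<lambda>Y. map_option (\<lambda>p. rsubst p (?s |` (- dom S))) (?S Y)) =
      (\<lambda>Y. map_option (\<lambda>p. psubst p (\<sigma> |` (- dom S))) (S Y))"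
    using r by (auto simp: fun_eq_iff option.map_comp comp_def)
  ultimately show "subst_to \<sigma> (PRec X S) (PRec X (\<lambda>Y. map_option (\<lambda>p. psubst p (\<sigma> |` (- dom S))) (S Y)))"
    unfolding PRec_eq_abs[of X S] by simp
qed


section \<open>Unfolding of recursive calls\<close>

text \<open>\<open>unfolds\<close> speaks about some presentation \<open>PRec X S\<close> of the
  call, and a call has many. Two of them differ by a bijection \<open>f\<close> of the bound
  variables. The calls that are substituted for these variables correspond under \<open>f\<close> as
  well, so \<open>alpha_rsubst\<close> identifies the two unfoldings.\<close>

lemma unfolds_unique:
  fixes c :: "('v, 'o) pexp"
  assumes "unfolds c p" and "unfolds c q"
  shows "p = q"
proof -
  from assms(1) obtain X S b where 1: "c = PRec X S" "S X = Some b"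
    "subst_to (\<lambda>Y. if Y \<in> dom S then Some (PRec Y S) else None) b p"
    unfolding unfolds_def by blast
  from assms(2) obtain X' S' b' where 2: "c = PRec X' S'" "S' X' = Some b'"
    "subst_to (\<lambda>Y. if Y \<in> dom S' then Some (PRec Y S') else None) b' q"
    unfolding unfolds_def by blast
  let ?S = "map_option rep_pexp \<circ> S" and ?S' = "map_option rep_pexp \<circ> S'"
  let ?m = "\<lambda>Y. if Y \<in> dom S then Some (PRec Y S) else None"
  let ?m' = "\<lambda>Y. if Y \<in> dom S' then Some (PRec Y S') else None"
  have d: "dom ?S = dom S" "dom ?S' = dom S'" by (auto simp: dom_def)
  have "abs_pexp (RRec X ?S) = abs_pexp (RRec X' ?S')"
    using 1(1) 2(1) unfolding PRec_eq_abs[symmetric] by simp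
  then have "alpha Id (RRec X ?S) (RRec X' ?S')" by (simp only: pexp.abs_eq_iff)
  then obtain f where f: "bij_betw f (dom S) (dom S')" "X' = f X"
    and *: "\<And>Y p p'. ?S Y = Some p \<Longrightarrow> ?S' (f Y) = Some p' \<Longrightarrow> alpha (rext Id (dom S) (dom S') f) p p'"
    by cases (use d 1(2) in auto)
  \<comment> \<open>Not only for the head variable: the body may mention any variable of the
    specification.\<close>
  have eq: "PRec Y S = PRec (f Y) S'" if "Y \<in> dom S" for Y
    unfolding PRec_eq_abs pexp.abs_eq_iff
    by (rule alpha_Rec[where f = f])
      (use f d that * bij_betwE[OF f(1)] in \<open>auto simp del: comp_apply\<close>)
  from 1(3) obtain b0 where b0: "b = abs_pexp b0" "capture_free b0 (map_option rep_pexp \<circ> ?m)"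
    "p = abs_pexp (rsubst b0 (map_option rep_pexp \<circ> ?m))" by (rule subst_toE)
  from 2(3) obtain b1 where b1: "b' = abs_pexp b1" "capture_free b1 (map_option rep_pexp \<circ> ?m')"
    "q = abs_pexp (rsubst b1 (map_option rep_pexp \<circ> ?m'))" by (rule subst_toE)
  have "alpha (rext Id (dom S) (dom S') f) (rep_pexp b) (rep_pexp b')"
    using *[of X] 1(2) 2(2) f(2) by simp
  moreover have "alpha Id b0 (rep_pexp b)" "alpha Id (rep_pexp b') b1"
    using b0(1) b1(1) by (simp_all flip: pexp.abs_eq_iff)
  ultimately have "alpha (Id O rext Id (dom S) (dom S') f O Id) b0 b1"
    by (blast intro: alpha_trans)
  then have "alpha (rext Id (dom S) (dom S') f) b0 b1" by simp
  then have "alpha Id (rsubst b0 (map_option rep_pexp \<circ> ?m)) (rsubst b1 (map_option rep_pexp \<circ> ?m'))"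
    using b0(2) b1(2)
  proof (rule alpha_rsubst, intro allI impI)
    fix x y assume "(x, y) \<in> rext Id (dom S) (dom S') f"
    then consider "x = y" "x \<notin> dom S" "y \<notin> dom S'" | "x \<in> dom S" "y = f x"
      by (auto simp: rext_def)
    then show "(map_option rep_pexp \<circ> ?m) x = None \<and> (map_option rep_pexp \<circ> ?m') y = None \<and> (x, y) \<in> Id \<or>
      (\<exists>b c. (map_option rep_pexp \<circ> ?m) x = Some b \<and> (map_option rep_pexp \<circ> ?m') y = Some c \<and> alpha Id b c)"
    proof cases
      case 2
      with bij_betwE[OF f(1)] have "y \<in> dom S'" by blast
      then show ?thesis using 2 eq[OF 2(1)] by (simp add: alpha_refl)
    qed simp
  qed
  then show "p = q" unfolding b0(3) b1(3) pexp.abs_eq_iff .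
qed

lemma fv_PRec_head: "fv (PRec X S) = fv (PRec Y S)"
  by (simp add: fv_PRec)

lemma fv_unfolds: "unfolds c p \<Longrightarrow> fv p \<subseteq> fv c"
proof -
  assume "unfolds c p"
  then obtain X S b where 1: "c = PRec X S" "S X = Some b"
    "subst_to (\<lambda>Y. if Y \<in> dom S then Some (PRec Y S) else None) b p"
    unfolding unfolds_def by blast
  have "fv (sapp (\<lambda>Y. if Y \<in> dom S then Some (PRec Y S) else None) x) \<subseteq> fv c" if "x \<in> fv b" for x
  proof (cases "x \<in> dom S")
    case True
    then show ?thesis using fv_PRec_head[of X S x] by (simp add: sapp_def 1(1))
  next
    case False
    then show ?thesis using that 1(2) unfolding sapp_def 1(1) fv_PRec by auto
  qed
  then show ?thesis unfolding fv_subst_to[OF 1(3)] by blast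
qed

text \<open>The calls substituted for the bound variables differ from \<open>c\<close> in the head
  variable only, hence are closed when \<open>c\<close> is, and the substitution is ground.\<close>

lemma unfolds_exists: "recursive_call c \<Longrightarrow> fv c = {} \<Longrightarrow> \<exists>p. unfolds c p"
proof -
  assume "recursive_call c" and cl: "fv c = {}"
  then obtain X S b where c: "c = PRec X S" "S X = Some b" unfolding recursive_call_def by blast
  have "ground (\<lambda>Y. if Y \<in> dom S then Some (PRec Y S) else None)"
    unfolding ground_def using cl fv_PRec_head[of X S] by (auto simp: c)
  with c show ?thesis unfolding unfolds_def using subst_to_ground by blast
qed

text \<open>Unfolding commutes with closing off a call. The condition on the domain makes the calls
  of the new specification closed, so that substituting them is possible without renaming.\<close>

lemma unfolds_psubst:
  assumes "unfolds c p" and g: "ground \<sigma>" and "fv c \<subseteq> dom \<sigma>"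
  shows "unfolds (psubst c \<sigma>) (psubst p \<sigma>)"
proof -
  from assms(1) obtain X S b where c: "c = PRec X S" "S X = Some b"
    "subst_to (\<lambda>Y. if Y \<in> dom S then Some (PRec Y S) else None) b p"
    unfolding unfolds_def by blast
  let ?S' = "\<lambda>Y. map_option (\<lambda>p. psubst p (\<sigma> |` (- dom S))) (S Y)"
  let ?m = "\<lambda>Y. if Y \<in> dom S then Some (PRec Y S) else None"
  let ?m' = "\<lambda>Y. if Y \<in> dom ?S' then Some (PRec Y ?S') else None"
  have P: "psubst (PRec Y S) \<sigma> = PRec Y ?S'" for Y by (rule psubst_PRec[OF g])
  have "fv (PRec Y ?S') = {}" for Y
    unfolding P[symmetric] using fv_psubst[OF g] assms(3) fv_PRec_head[of X S Y] by (auto simp: c(1))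
  then have gm: "ground ?m'" by (auto simp: ground_def)
  \<comment> \<open>Two ways to treat the body: free variables first and then the new calls, or the
    old calls first and then \<open>\<sigma>\<close>. They agree on each variable because
    \<open>\<sigma>\<close> turns \<open>PRec Y S\<close> into \<open>PRec Y ?S'\<close> and leaves
    nothing free in its own values.\<close>
  have "scomp (\<sigma> |` (- dom S)) ?m' = scomp ?m \<sigma>"
  proof
    fix Y
    show "scomp (\<sigma> |` (- dom S)) ?m' Y = scomp ?m \<sigma> Y"
      using P g by (cases "\<sigma> Y") (auto simp: scomp_def ground_def)
  qed
  moreover have "subst_to (scomp ?m \<sigma>) b (psubst p \<sigma>)"
    using c(3) g by (rule subst_to_scomp)
  ultimately have "psubst p \<sigma> = psubst (psubst b (\<sigma> |` (- dom S))) ?m'"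
    by (simp only: psubst_psubst[OF ground_restrict[OF g] gm] psubst_eqI)
  then have "subst_to ?m' (psubst b (\<sigma> |` (- dom S))) (psubst p \<sigma>)"
    using gm by (simp only: subst_to_ground_iff)
  then show ?thesis unfolding unfolds_def
    using c(2) P[of X] c(1) by (intro exI[of _ X] exI[of _ ?S'] exI) auto
qed

lemma unfolds_recursive_call: "unfolds c p \<Longrightarrow> recursive_call c"
  unfolding unfolds_def recursive_call_def by blast

lemma recursive_call_neq [simp]: "\<not> recursive_call (PVar x)" "\<not> recursive_call (POp f ps)"
  by (simp_all add: recursive_call_def)

section \<open>Membership in \<open>expr\<close>, read off representatives\<close>

primrec rexpr :: "('o \<times> nat) set \<Rightarrow> ('v, 'o) rexp \<Rightarrow> bool" where
  "rexpr \<Sigma> (RVar x) \<longleftrightarrow> True"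
| "rexpr \<Sigma> (ROp f ps) \<longleftrightarrow> (f, length ps) \<in> \<Sigma> \<and> (\<forall>b \<in> set (map (rexpr \<Sigma>) ps). b)"
| "rexpr \<Sigma> (RRec X S) \<longleftrightarrow> X \<in> dom S \<and> (\<forall>b \<in> ran (\<lambda>Y. map_option (rexpr \<Sigma>) (S Y)). b)"

lemma rexpr_RRec: "rexpr \<Sigma> (RRec X S) \<longleftrightarrow> X \<in> dom S \<and> (\<forall>Y p. S Y = Some p \<longrightarrow> rexpr \<Sigma> p)"
  unfolding rexpr.simps ran_map_option by (auto simp: ran_def)

text \<open>\<open>expr\<close> is generated from some presentation of each recursive call.
  Invariance of the structural predicate \<open>rexpr\<close> gives inversion rules for an arbitrary
  presentation, such as \<open>expr_PRec_iff\<close>.\<close>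

lemma alpha_rexpr: "alpha E p q \<Longrightarrow> rexpr \<Sigma> p \<Longrightarrow> rexpr \<Sigma> q"
proof (induction rule: alpha.induct)
  case (alpha_Op E ps qs f)
  then show ?case by (auto simp: list_all2_conv_all_nth set_conv_nth)
next
  case (alpha_Rec f S S' X X' E)
  have "rexpr \<Sigma> p'" if p': "S' Z = Some p'" for Z p'
  proof -
    obtain Y where Y: "Y \<in> dom S" "Z = f Y"
      using bij_betw_imp_surj_on[OF alpha_Rec.hyps(1)] p' by (metis domI imageE)
    then obtain p where "S Y = Some p" by blast
    with Y p' alpha_Rec.IH alpha_Rec.prems show ?thesis unfolding rexpr_RRec by blast
  qed
  with alpha_Rec.hyps(2) alpha_Rec.prems show ?case unfolding rexpr_RRec by blast
qed simp

lemma expr_imp_rexpr: "p \<in> expr \<Sigma> \<Longrightarrow> rexpr \<Sigma> (rep_pexp p)"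
proof (induction rule: expr.induct)
  case (1 x)
  have "alpha Id (RVar x) (rep_pexp (PVar x))" by (simp flip: pexp.abs_eq_iff add: PVar.abs_eq)
  then show ?case by (rule alpha_rexpr) simp
next
  case (2 f ps)
  have "alpha Id (ROp f (map rep_pexp ps)) (rep_pexp (POp f ps))"
    by (simp flip: pexp.abs_eq_iff POp.abs_eq)
  then show ?case by (rule alpha_rexpr) (use 2 in simp)
next
  case (3 X S)
  have "alpha Id (RRec X (map_option rep_pexp \<circ> S)) (rep_pexp (PRec X S))"
    by (simp flip: pexp.abs_eq_iff PRec_eq_abs)
  then show ?case by (rule alpha_rexpr) (use 3 in \<open>auto simp: rexpr_RRec simp del: rexpr.simps\<close>)
qed

lemma abs_expr_iff: "abs_pexp p \<in> expr \<Sigma> \<longleftrightarrow> rexpr \<Sigma> p"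
proof
  assume "abs_pexp p \<in> expr \<Sigma>"
  from expr_imp_rexpr[OF this] show "rexpr \<Sigma> p" using alpha_rep_abs alpha_rexpr by blast
next
  show "rexpr \<Sigma> p \<Longrightarrow> abs_pexp p \<in> expr \<Sigma>"
  proof (induction p rule: rexp_induct)
    case (RVar x)
    then show ?case using expr.intros(1)[of x] by (simp add: PVar.abs_eq)
  next
    case (ROp f ps)
    then show ?case using expr.intros(2)[of f "map abs_pexp ps" \<Sigma>] by (simp add: POp.abs_eq)
  next
    case (RRec X S)
    have "PRec X (map_option abs_pexp \<circ> S) \<in> expr \<Sigma>"
      by (rule expr.intros(3)) (use RRec in \<open>auto simp: rexpr_RRec simp del: rexpr.simps\<close>)
    then show ?case by (simp add: PRec_abs)
  qed
qed

lemma rexpr_rep_pexp [simp]: "rexpr \<Sigma> (rep_pexp p) \<longleftrightarrow> p \<in> expr \<Sigma>"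
  by (simp flip: abs_expr_iff)

lemma expr_PVar [simp]: "PVar x \<in> expr \<Sigma>"
  by (rule expr.intros)

lemma expr_POp_iff: "POp f ps \<in> expr \<Sigma> \<longleftrightarrow> (f, length ps) \<in> \<Sigma> \<and> set ps \<subseteq> expr \<Sigma>"
proof -
  have "POp f ps = abs_pexp (ROp f (map rep_pexp ps))" by (simp flip: POp.abs_eq)
  then show ?thesis by (auto simp: abs_expr_iff)
qed

lemma expr_PRec_iff: "PRec X S \<in> expr \<Sigma> \<longleftrightarrow> X \<in> dom S \<and> ran S \<subseteq> expr \<Sigma>"
proof -
  have "(\<forall>Y p. (map_option rep_pexp \<circ> S) Y = Some p \<longrightarrow> rexpr \<Sigma> p) \<longleftrightarrow>
      (\<forall>Y p. S Y = Some p \<longrightarrow> rexpr \<Sigma> (rep_pexp p))"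
    unfolding comp_apply map_option_eq_Some by blast
  then show ?thesis unfolding PRec_eq_abs abs_expr_iff rexpr_RRec by (auto simp: ran_def dom_def)
qed

lemma rexpr_rsubst:
  "rexpr \<Sigma> p \<Longrightarrow> (\<And>x q. \<sigma> x = Some q \<Longrightarrow> rexpr \<Sigma> q) \<Longrightarrow> rexpr \<Sigma> (rsubst p \<sigma>)"
proof (induction p arbitrary: \<sigma> rule: rexp_induct)
  case (RRec X S)
  have "rexpr \<Sigma> (rsubst p (\<sigma> |` (- dom S)))" if "S Y = Some p" for Y p
    using that
  proof (rule RRec.IH)
    show "rexpr \<Sigma> p" using RRec.prems(1) that unfolding rexpr_RRec by blast
    show "rexpr \<Sigma> q" if "(\<sigma> |` (- dom S)) x = Some q" for x q
      using that RRec.prems(2) by (simp add: restrict_map_def split: if_splits)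
  qed
  then show ?case using RRec.prems(1) unfolding rsubst.simps rexpr_RRec by auto
qed (auto split: option.splits)

lemma expr_subst_to: "p \<in> expr \<Sigma> \<Longrightarrow> ran \<sigma> \<subseteq> expr \<Sigma> \<Longrightarrow> subst_to \<sigma> p q \<Longrightarrow> q \<in> expr \<Sigma>"
  by (erule subst_toE) (force simp: abs_expr_iff intro!: rexpr_rsubst dest: ranI)

lemma expr_psubst: "p \<in> expr \<Sigma> \<Longrightarrow> ground \<sigma> \<Longrightarrow> ran \<sigma> \<subseteq> expr \<Sigma> \<Longrightarrow> psubst p \<sigma> \<in> expr \<Sigma>"
  using expr_subst_to subst_to_ground by blast

lemma expr_unfolds: "unfolds c p \<Longrightarrow> c \<in> expr \<Sigma> \<Longrightarrow> p \<in> expr \<Sigma>"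
proof -
  assume "unfolds c p" and c: "c \<in> expr \<Sigma>"
  then obtain X S b where 1: "c = PRec X S" "S X = Some b"
    "subst_to (\<lambda>Y. if Y \<in> dom S then Some (PRec Y S) else None) b p"
    unfolding unfolds_def by blast
  have S: "ran S \<subseteq> expr \<Sigma>" using c by (simp add: 1(1) expr_PRec_iff)
  show ?thesis
  proof (rule expr_subst_to[OF _ _ 1(3)])
    show "b \<in> expr \<Sigma>" using S 1(2) by (auto simp: ran_def)
    show "ran (\<lambda>Y. if Y \<in> dom S then Some (PRec Y S) else None) \<subseteq> expr \<Sigma>"
      using S by (auto simp: ran_def expr_PRec_iff)
  qed
qed

lemma expr_recursive_call: "p \<in> expr \<Sigma> \<Longrightarrow> p = PRec X S \<Longrightarrow> recursive_call p"
  by (auto simp: expr_PRec_iff recursive_call_def)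


section \<open>Interpretation of operator symbols\<close>

text \<open>
  An operator symbol is either renamed (\<open>Inl\<close>) or replaced, together with its arguments, by a closed
  expression (\<open>Inr\<close>).  This covers both the passage from expressions to contexts and the filling of
  holes.
\<close>

primrec rint :: "('a \<Rightarrow> 'b + ('v, 'b) rexp) \<Rightarrow> ('v, 'a) rexp \<Rightarrow> ('v, 'b) rexp" where
  "rint \<theta> (RVar x) = RVar x"
| "rint \<theta> (ROp f ps) = (case \<theta> f of Inl g \<Rightarrow> ROp g (map (rint \<theta>) ps) | Inr c \<Rightarrow> c)"
| "rint \<theta> (RRec X S) = RRec X (\<lambda>Y. map_option (rint \<theta>) (S Y))"

context
  fixes \<theta> :: "'a \<Rightarrow> 'b + ('v, 'b) rexp"
  assumes closed: "\<And>f c. \<theta> f = Inr c \<Longrightarrow> rfv c = {}"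
begin

text \<open>The replacing expressions have to be closed: a surrounding binder could otherwise
  capture their variables, and the result would depend on the names of bound variables.\<close>

lemma alpha_rint: "alpha E p q \<Longrightarrow> alpha E (rint \<theta> p) (rint \<theta> q)"
proof (induction rule: alpha.induct)
  case (alpha_Op E ps qs f)
  show ?case
  proof (cases "\<theta> f")
    case (Inl g)
    with alpha_Op show ?thesis by (auto intro!: alpha.alpha_Op simp: list_all2_conv_all_nth)
  next
    case (Inr c)
    \<comment> \<open>A closed expression is related to itself already by the empty relation on free
      variables, hence by any \<open>E\<close>.\<close>
    have "alpha E c c"
      using alpha_restrict[OF alpha_refl[of c]] by (rule alpha_mono) (simp add: closed[OF Inr])
    then show ?thesis by (simp add: Inr)
  qed
next
  case (alpha_Rec f S S' X X' E)
  then show ?case by (auto intro!: alpha.alpha_Rec[where f = f])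
qed (simp add: alpha.alpha_Var)

text \<open>Only an inclusion, because a replaced symbol drops its arguments together with their
  variables.\<close>

lemma rfv_rint: "rfv (rint \<theta> p) \<subseteq> rfv p"
proof (induction p rule: rexp_induct)
  case (ROp f ps)
  then show ?case using closed by (cases "\<theta> f") fastforce+
next
  case (RRec X S)
  then show ?case unfolding rint.simps rfv_RRec by fastforce
qed simp

lemma rint_rsubst: "rint \<theta> (rsubst p \<sigma>) = rsubst (rint \<theta> p) (map_option (rint \<theta>) \<circ> \<sigma>)"
proof (induction p arbitrary: \<sigma> rule: rexp_induct)
  case (RVar x)
  then show ?case by (simp split: option.split)
next
  case (ROp f ps)
  show ?case
  proof (cases "\<theta> f")
    case (Inl g)
    with ROp show ?thesis by simp
  next
    case (Inr c)
    have "rsubst c (map_option (rint \<theta>) \<circ> \<sigma>) = rsubst c Map.empty"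
      by (rule rsubst_cong) (simp add: closed[OF Inr])
    then show ?thesis unfolding comp_def by (simp add: Inr rsubst_empty)
  qed
next
  case (RRec X S)
  have r: "map_option (rint \<theta>) \<circ> (\<sigma> |` (- dom S)) = (map_option (rint \<theta>) \<circ> \<sigma>) |` (- dom S)"
    by (auto simp: fun_eq_iff restrict_map_def)
  have "rint \<theta> (rsubst p (\<sigma> |` (- dom S))) = rsubst (rint \<theta> p) ((map_option (rint \<theta>) \<circ> \<sigma>) |` (- dom S))"
    if "S Y = Some p" for Y p
    unfolding r[symmetric] using that by (rule RRec)
  then show ?case unfolding comp_def by (auto simp: fun_eq_iff option.map_comp intro!: option.map_cong)
qed

text \<open>Interpretation creates no free variables, so what was safe from capture stays
  safe.\<close>

lemma capture_free_rint:
  "capture_free p \<sigma> \<Longrightarrow> capture_free (rint \<theta> p) (map_option (rint \<theta>) \<circ> \<sigma>)"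
proof (induction p arbitrary: \<sigma> rule: rexp_induct)
  case (ROp f ps)
  show ?case
  proof (cases "\<theta> f")
    case (Inl g)
    with ROp show ?thesis by simp
  next
    case (Inr c)
    have "capture_free c (map_option (rint \<theta>) \<circ> \<sigma>) \<longleftrightarrow> capture_free c Map.empty"
      by (rule capture_free_cong) (simp add: closed[OF Inr])
    moreover have "capture_free c Map.empty" by (rule capture_free_closed) simp
    ultimately show ?thesis unfolding comp_def by (simp add: Inr)
  qed
next
  case (RRec X S)
  have r: "map_option (rint \<theta>) \<circ> (\<sigma> |` (- dom S)) = (map_option (rint \<theta>) \<circ> \<sigma>) |` (- dom S)"
    by (auto simp: fun_eq_iff restrict_map_def)
  have "capture_free (rint \<theta> p) ((map_option (rint \<theta>) \<circ> \<sigma>) |` (- dom S))"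
    if "S Y = Some p" for Y p
    unfolding r[symmetric] using that
    by (rule RRec.IH) (use RRec.prems that in \<open>auto simp: capture_free_RRec simp del: capture_free.simps\<close>)
  moreover have "rfv q \<inter> dom S = {}"
    if y: "y \<in> rfv (rint \<theta> (RRec X S))" and q: "(map_option (rint \<theta>) \<circ> \<sigma>) y = Some q" for y q
  proof -
    from q obtain r where r: "\<sigma> y = Some r" "q = rint \<theta> r" by auto
    have "y \<in> rfv (RRec X S)" using y rfv_rint by blast
    with r RRec.prems have "rfv r \<inter> dom S = {}" unfolding capture_free_RRec by blast
    then show ?thesis using rfv_rint[of r] r(2) by blast
  qed
  ultimately show ?case unfolding rint.simps capture_free_RRec by auto
qed simp

end

definition interp :: "('a \<Rightarrow> 'b + ('v, 'b) pexp) \<Rightarrow> ('v, 'a) pexp \<Rightarrow> ('v, 'b) pexp" where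
  "interp \<theta> p = abs_pexp (rint (map_sum id rep_pexp \<circ> \<theta>) (rep_pexp p))"

context
  fixes \<theta> :: "'a \<Rightarrow> 'b + ('v, 'b) pexp"
  assumes closed: "\<And>f c. \<theta> f = Inr c \<Longrightarrow> fv c = {}"
begin

lemma closed_map_sum: "(map_sum id rep_pexp \<circ> \<theta>) f = Inr c \<Longrightarrow> rfv c = {}"
  using closed[of f] by (cases "\<theta> f") auto

lemma interp_abs: "interp \<theta> (abs_pexp p) = abs_pexp (rint (map_sum id rep_pexp \<circ> \<theta>) p)"
  unfolding interp_def pexp.abs_eq_iff
  by (rule alpha_rint[OF closed_map_sum alpha_rep_abs])

lemma interp_PVar [simp]: "interp \<theta> (PVar x) = PVar x"
  using interp_abs[of "RVar x"] by (simp add: PVar.abs_eq)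

lemma interp_POp:
  "interp \<theta> (POp f ps) = (case \<theta> f of Inl g \<Rightarrow> POp g (map (interp \<theta>) ps) | Inr c \<Rightarrow> c)"
proof -
  have "POp f ps = abs_pexp (ROp f (map rep_pexp ps))" by (simp flip: POp.abs_eq)
  then have "interp \<theta> (POp f ps) = abs_pexp (rint (map_sum id rep_pexp \<circ> \<theta>) (ROp f (map rep_pexp ps)))"
    by (simp only: interp_abs)
  also have "\<dots> = (case \<theta> f of Inl g \<Rightarrow> POp g (map (interp \<theta>) ps) | Inr c \<Rightarrow> c)"
    by (auto simp: interp_def[abs_def] POp.abs_eq[symmetric] comp_def split: sum.split)
  finally show ?thesis .
qed

lemma interp_PRec: "interp \<theta> (PRec X S) = PRec X (map_option (interp \<theta>) \<circ> S)"
proof -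
  have "interp \<theta> (PRec X S) =
      abs_pexp (rint (map_sum id rep_pexp \<circ> \<theta>) (RRec X (map_option rep_pexp \<circ> S)))"
    unfolding PRec_eq_abs by (rule interp_abs)
  also have "\<dots> = PRec X (map_option abs_pexp \<circ>
      (\<lambda>Y. map_option (rint (map_sum id rep_pexp \<circ> \<theta>)) ((map_option rep_pexp \<circ> S) Y)))"
    unfolding PRec_abs by simp
  also have "\<dots> = PRec X (map_option (interp \<theta>) \<circ> S)"
    by (rule arg_cong[where f = "PRec X"]) (auto simp: fun_eq_iff interp_def[abs_def] option.map_comp comp_def)
  finally show ?thesis .
qed

lemma fv_interp: "fv (interp \<theta> p) \<subseteq> fv p"
  unfolding interp_def using rfv_rint[of "map_sum id rep_pexp \<circ> \<theta>" "rep_pexp p", OF closed_map_sum] by simp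

text \<open>A representative of \<open>p\<close> that is free from capture for
  \<open>\<sigma>\<close> serves the interpreted side too, and on raw expressions interpretation and
  replacement commute literally.\<close>

lemma interp_subst_to:
  assumes "subst_to \<sigma> p q"
  shows "subst_to (map_option (interp \<theta>) \<circ> \<sigma>) (interp \<theta> p) (interp \<theta> q)"
  using assms
proof (rule subst_toE)
  let ?\<theta> = "map_sum id rep_pexp \<circ> \<theta>" and ?s = "map_option rep_pexp \<circ> \<sigma>"
  fix p0 assume *: "p = abs_pexp p0" "capture_free p0 ?s" "q = abs_pexp (rsubst p0 ?s)"
  have "subst_to (map_option (interp \<theta>) \<circ> \<sigma>) (abs_pexp (rint ?\<theta> p0))
      (abs_pexp (rsubst (rint ?\<theta> p0) (map_option (rint ?\<theta>) \<circ> ?s)))"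
  proof (rule subst_toI)
    show "capture_free (rint ?\<theta> p0) (map_option (rint ?\<theta>) \<circ> ?s)"
      by (rule capture_free_rint[OF closed_map_sum *(2)])
    show "map_option abs_pexp ((map_option (rint ?\<theta>) \<circ> ?s) x) = (map_option (interp \<theta>) \<circ> \<sigma>) x" for x
      by (simp add: option.map_comp comp_def interp_def[abs_def])
  qed
  moreover have "rint ?\<theta> (rsubst p0 ?s) = rsubst (rint ?\<theta> p0) (map_option (rint ?\<theta>) \<circ> ?s)"
    by (rule rint_rsubst) (rule closed_map_sum)
  ultimately show ?thesis unfolding *(1,3) interp_abs by simp
qed

text \<open>Interpretation keeps the binding structure and acts on the whole specification
  uniformly. The two instances used are the embedding into contexts and the filling of
  holes.\<close>

lemma interp_unfolds: "unfolds c p \<Longrightarrow> unfolds (interp \<theta> c) (interp \<theta> p)"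
proof -
  assume "unfolds c p"
  then obtain X S b where 1: "c = PRec X S" "S X = Some b"
    "subst_to (\<lambda>Y. if Y \<in> dom S then Some (PRec Y S) else None) b p"
    unfolding unfolds_def by blast
  have e: "map_option (interp \<theta>) \<circ> (\<lambda>Y. if Y \<in> dom S then Some (PRec Y S) else None) =
      (\<lambda>Y. if Y \<in> dom (map_option (interp \<theta>) \<circ> S) then Some (PRec Y (map_option (interp \<theta>) \<circ> S)) else None)"
    by (auto simp: fun_eq_iff interp_PRec dom_def)
  show ?thesis unfolding unfolds_def
  proof (intro exI conjI)
    show "interp \<theta> c = PRec X (map_option (interp \<theta>) \<circ> S)" by (simp add: 1(1) interp_PRec)
    show "(map_option (interp \<theta>) \<circ> S) X = Some (interp \<theta> b)" using 1(2) by simp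
  qed (use interp_subst_to[OF 1(3)] in \<open>simp only: e\<close>)
qed

lemma interp_expr:
  assumes "p \<in> expr \<Sigma>"
    and "\<And>f n g. (f, n) \<in> \<Sigma> \<Longrightarrow> \<theta> f = Inl g \<Longrightarrow> (g, n) \<in> \<Sigma>'"
    and "\<And>f n c. (f, n) \<in> \<Sigma> \<Longrightarrow> \<theta> f = Inr c \<Longrightarrow> c \<in> expr \<Sigma>'"
  shows "interp \<theta> p \<in> expr \<Sigma>'"
  using assms(1)
proof (induction rule: expr.induct)
  case (2 f ps)
  then show ?case
    using assms(2,3) by (cases "\<theta> f") (fastforce simp: interp_POp expr_POp_iff)+
next
  case (3 X S)
  then show ?case by (auto simp: interp_PRec expr_PRec_iff ran_def)
qed simp

end

lemma interp_interp_id: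
  assumes "\<And>f c. \<theta> f = Inr c \<Longrightarrow> fv c = {}" and "\<And>f. \<theta> (e f) = Inl f"
  shows "interp \<theta> (interp (Inl \<circ> e) p) = p"
proof -
  have "rint (map_sum id rep_pexp \<circ> \<theta>) (rint (map_sum id rep_pexp \<circ> (Inl \<circ> e)) q) = q" for q
  proof (induction q rule: rexp_induct)
    case (RRec X S)
    then show ?case by (auto simp: fun_eq_iff option.map_comp intro!: option.map_ident_strong)
  qed (auto simp: assms(2) intro: map_idI)
  then show ?thesis
    unfolding interp_def[of "Inl \<circ> e"] by (simp add: interp_abs[OF assms(1)])
qed


section \<open>Contexts\<close>

definition embed :: "('v, 'o) pexp \<Rightarrow> ('v, 'o + 'v) pexp" where
  "embed = interp (Inl \<circ> Inl)"

definition hole :: "'v \<Rightarrow> ('v, 'o + 'v) pexp" where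
  "hole x = POp (Inr x) []"

text \<open>The hole for \<open>x\<close> is the constant \<open>Inr x\<close>, while the original
  symbols live in the left summand. The result is closed whatever \<open>p\<close> is, so if it is a
  recursive call, it has an unfolding.\<close>

definition ctx_of :: "('v, 'o) pexp \<Rightarrow> ('v, 'o + 'v) pexp" where
  "ctx_of p = psubst (embed p) (Some \<circ> hole)"

definition fill :: "('v \<Rightarrow> ('v, 'o) pexp) \<Rightarrow> ('v, 'o + 'v) pexp \<Rightarrow> ('v, 'o) pexp" where
  "fill \<rho> = interp (case_sum Inl (Inr \<circ> \<rho>))"

definition hole_sig :: "('o \<times> nat) set \<Rightarrow> (('o + 'v) \<times> nat) set" where
  "hole_sig \<Sigma> = {(Inl f, n) |f n. (f, n) \<in> \<Sigma>} \<union> {(Inr k, 0) |k. True}"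

lemma dom_Some_comp [simp]: "dom (Some \<circ> f) = UNIV"
  by (auto simp: dom_def)

lemma fv_hole [simp]: "fv (hole x) = {}"
  by (simp add: hole_def)

lemma ground_hole: "ground (Some \<circ> hole)"
  by (simp add: ground_def)

lemma fv_embed: "fv (embed p) \<subseteq> fv p"
  unfolding embed_def by (rule fv_interp) simp

lemma embed_PVar [simp]: "embed (PVar x) = PVar x"
  unfolding embed_def by (rule interp_PVar) simp

lemma embed_POp: "embed (POp f ps) = POp (Inl f) (map embed ps)"
  unfolding embed_def by (subst interp_POp) simp_all

lemma embed_PRec: "embed (PRec X S) = PRec X (map_option embed \<circ> S)"
  unfolding embed_def by (rule interp_PRec) simp

lemma embed_unfolds: "unfolds c p \<Longrightarrow> unfolds (embed c) (embed p)"
  unfolding embed_def by (rule interp_unfolds) simp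

lemma fv_ctx_of [simp]: "fv (ctx_of p) = {}"
  unfolding ctx_of_def by (simp add: fv_psubst[OF ground_hole])

lemma ctx_of_PVar [simp]: "ctx_of (PVar x) = hole x"
  by (simp add: ctx_of_def)

lemma ctx_of_POp: "ctx_of (POp f ps) = POp (Inl f) (map ctx_of ps)"
  unfolding ctx_of_def embed_POp psubst_POp[OF ground_hole] by (simp add: POp_eq_iff ctx_of_def)

lemma ctx_of_closed: "fv p = {} \<Longrightarrow> ctx_of p = embed p"
  unfolding ctx_of_def using fv_embed[of p] by simp

text \<open>Passing to contexts is itself a substitution, by holes. Performed after
  \<open>\<sigma>\<close>, it composes with it to a ground substitution of the embedded
  expression.\<close>

lemma ctx_of_subst_to:
  assumes "subst_to \<sigma> q q'"
  shows "ctx_of q' = psubst (embed q) (\<lambda>x. Some (ctx_of (sapp \<sigma> x)))"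
proof -
  have "subst_to (map_option embed \<circ> \<sigma>) (embed q) (embed q')"
    unfolding embed_def by (rule interp_subst_to[OF _ assms]) simp
  from subst_to_scomp[OF this ground_hole]
  have "subst_to (scomp (map_option embed \<circ> \<sigma>) (Some \<circ> hole)) (embed q) (ctx_of q')"
    by (simp only: ctx_of_def)
  moreover have "scomp (map_option embed \<circ> \<sigma>) (Some \<circ> hole) = (\<lambda>x. Some (ctx_of (sapp \<sigma> x)))"
  proof
    show "scomp (map_option embed \<circ> \<sigma>) (Some \<circ> hole) x = Some (ctx_of (sapp \<sigma> x))" for x
      by (cases "\<sigma> x") (simp_all add: scomp_def sapp_def ctx_of_def)
  qed
  ultimately show ?thesis by (simp add: psubst_eqI)
qed

text \<open>Recursion rules inside open transitions are instantiated by a \<open>\<sigma>\<close>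
  with open values, to which \<open>unfolds_psubst\<close> does not apply. Once the instances are
  turned into contexts, the substitution is ground and it does.\<close>

lemma ctx_of_unfolds:
  assumes "unfolds c p" "subst_to \<sigma> c c'" "subst_to \<sigma> p p'"
  shows "unfolds (ctx_of c') (ctx_of p')"
  unfolding ctx_of_subst_to[OF assms(2)] ctx_of_subst_to[OF assms(3)]
  by (rule unfolds_psubst[OF embed_unfolds[OF assms(1)]]) (auto simp: ground_def)

lemma ctx_of_expr: "p \<in> expr \<Sigma> \<Longrightarrow> ctx_of p \<in> expr (hole_sig \<Sigma>)"
  unfolding ctx_of_def
proof (rule expr_psubst[OF _ ground_hole])
  show "embed p \<in> expr (hole_sig \<Sigma>)" if "p \<in> expr \<Sigma>"
    unfolding embed_def by (rule interp_expr[OF _ that]) (auto simp: hole_sig_def)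
qed (auto simp: ran_def hole_def expr_POp_iff hole_sig_def)

context
  fixes \<rho> :: "'v \<Rightarrow> ('v, 'o) pexp"
  assumes closed: "\<And>x. fv (\<rho> x) = {}"
begin

lemma fill_closed: "case_sum Inl (Inr \<circ> \<rho>) f = Inr c \<Longrightarrow> fv c = {}"
  using closed by (auto split: sum.splits)

lemma fill_hole [simp]: "fill \<rho> (hole x) = \<rho> x"
  unfolding fill_def hole_def by (subst interp_POp) (auto dest: fill_closed)

lemma fill_POp [simp]: "fill \<rho> (POp (Inl f) ps) = POp f (map (fill \<rho>) ps)"
  unfolding fill_def by (subst interp_POp) (auto dest: fill_closed)

lemma fv_fill: "fv (fill \<rho> p) \<subseteq> fv p"
  unfolding fill_def by (rule fv_interp) (rule fill_closed)

lemma fill_unfolds: "unfolds c p \<Longrightarrow> unfolds (fill \<rho> c) (fill \<rho> p)"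
  unfolding fill_def by (rule interp_unfolds) (rule fill_closed)

text \<open>Filling undoes the embedding and sends the hole for \<open>x\<close> to
  \<open>\<rho> x\<close>. As interpretation commutes with substitution, substitution by holes
  becomes substitution by \<open>\<rho>\<close>.\<close>

lemma fill_ctx_of: "fill \<rho> (ctx_of p) = psubst p (Some \<circ> \<rho>)"
proof -
  have "fill \<rho> (embed p) = p"
    unfolding fill_def embed_def by (rule interp_interp_id[OF fill_closed]) auto
  moreover have "subst_to (map_option (fill \<rho>) \<circ> (Some \<circ> hole)) (fill \<rho> (embed p)) (fill \<rho> (ctx_of p))"
    unfolding fill_def ctx_of_def
    by (rule interp_subst_to[OF _ subst_to_ground[OF ground_hole]]) (rule fill_closed)
  moreover have "map_option (fill \<rho>) \<circ> (Some \<circ> hole) = Some \<circ> \<rho>" by auto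
  ultimately show ?thesis by (simp add: psubst_eqI)
qed

lemma fill_expr: "p \<in> expr (hole_sig \<Sigma>) \<Longrightarrow> (\<And>x. \<rho> x \<in> expr \<Sigma>) \<Longrightarrow> fill \<rho> p \<in> expr \<Sigma>"
  unfolding fill_def by (rule interp_expr) (auto simp: hole_sig_def fill_closed split: sum.splits intro: fill_closed)

end


section \<open>Instances of open transitions\<close>

lemma ex_map: "distinct xs \<Longrightarrow> length ys = length xs \<Longrightarrow> \<exists>f. ys = map f xs"
proof (induction xs arbitrary: ys)
  case (Cons x xs)
  then obtain y zs where ys: "ys = y # zs" "length zs = length xs" by (cases ys) auto
  with Cons obtain f where "zs = map f xs" by auto
  with ys Cons.prems(1) have "ys = map (f(x := y)) (x # xs)" by auto
  then show ?case by blast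
qed simp

lemma finite_trigger_set [simp]: "finite (trigger_set g)"
  by (simp add: trigger_set_def)

text \<open>Rule instances are described by argument positions, substitutions by variables. The
  default \<open>d\<close> makes the valuation total, with admissible values also at variables
  foreign to the rule.\<close>

lemma ex_env:
  assumes "inj_on x A" "inj_on y B" "x ` A \<inter> y ` B = {}"
    and "\<And>i. i \<in> A \<Longrightarrow> P (x i) (a i)" "\<And>i. i \<in> B \<Longrightarrow> P (y i) (b i)" "\<And>z. P z (d z)"
  shows "\<exists>\<sigma>. (\<forall>i \<in> A. \<sigma> (x i) = a i) \<and> (\<forall>i \<in> B. \<sigma> (y i) = b i) \<and> (\<forall>z. P z (\<sigma> z))"
proof -
  let ?s = "\<lambda>z. if z \<in> x ` A then a (the_inv_into A x z)
    else if z \<in> y ` B then b (the_inv_into B y z) else d z"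
  have 1: "?s (x i) = a i" if "i \<in> A" for i
    using that assms(1) by (simp add: the_inv_into_f_f)
  have 2: "?s (y i) = b i" if "i \<in> B" for i
  proof -
    have "y i \<notin> x ` A" using that assms(3) by blast
    then show ?thesis using that assms(2) by (simp add: the_inv_into_f_f)
  qed
  have 3: "P z (?s z)" for z
  proof (cases "z \<in> x ` A")
    case True
    then obtain i where "i \<in> A" "z = x i" by blast
    then show ?thesis using assms(4) 1 by metis
  next
    case False
    note F = False
    show ?thesis
    proof (cases "z \<in> y ` B")
      case True
      then obtain i where "i \<in> B" "z = y i" by blast
      then show ?thesis using assms(5) 2 by metis
    next
      case False
      with F assms(6) show ?thesis by simp
    qed
  qed
  show ?thesis by (rule exI[of _ ?s]) (use 1 2 3 in blast)
qed

lemma ex_list_all2: "\<forall>x \<in> set xs. \<exists>y. P x y \<Longrightarrow> \<exists>ys. list_all2 P xs ys"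
  by (induction xs) (auto simp: list_all2_Cons1)

lemma lit_inst_scomp:
  "lit_inst \<sigma> h m \<Longrightarrow> lit_inst \<tau> m m' \<Longrightarrow> ground \<tau> \<Longrightarrow> lit_inst (scomp \<sigma> \<tau>) h m'"
  by (cases h; cases m; cases m') (auto simp: subst_to_ground_iff intro: subst_to_scomp)

lemma list_all2_scomp:
  "list_all2 (lit_inst \<sigma>) H (map root ts) \<Longrightarrow> list_all2 (\<lambda>t t'. lit_inst \<tau> (root t) (root t')) ts ts' \<Longrightarrow>
    ground \<tau> \<Longrightarrow> list_all2 (lit_inst (scomp \<sigma> \<tau>)) H (map root ts')"
  by (auto simp: list_all2_conv_all_nth) (blast intro: lit_inst_scomp)

inductive_cases tree_inst_TVarE: "tree_inst \<sigma> \<tau> (TVar tx m) t"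
inductive_cases tree_inst_NodeE: "tree_inst \<sigma> \<tau> (Node m r ts) t"

text \<open>The analogue for successor rules, whose several families of variables are declared
  distinct as one list.\<close>

lemma ex_env_list:
  assumes "distinct (map fst l)" "\<And>k v. (k, v) \<in> set l \<Longrightarrow> P v" "P d"
  shows "\<exists>\<sigma>. (\<forall>(k, v) \<in> set l. \<sigma> k = v) \<and> (\<forall>z. P (\<sigma> z))"
proof -
  let ?s = "\<lambda>z. case map_of l z of None \<Rightarrow> d | Some v \<Rightarrow> v"
  have "?s k = v" if "(k, v) \<in> set l" for k v
    using map_of_is_SomeI[OF assms(1) that] by simp
  moreover have "P (?s z)" for z
    using assms(2,3) by (auto split: option.split dest: map_of_SomeD)
  ultimately show ?thesis by (intro exI[of _ ?s]) auto
qed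

text \<open>A transition variable shared by the premise and the conclusion of a successor rule thus
  stands for the same transition in both.\<close>

lemma tree_inst_unique: "tree_inst \<sigma> \<tau> v a \<Longrightarrow> tree_inst \<sigma> \<tau> v b \<Longrightarrow> a = b"
proof (induction arbitrary: b rule: tree_inst.induct)
  case (1 tx w m)
  then show ?case by (auto elim: tree_inst_TVarE)
next
  case (2 tx m m')
  from 2(3) show ?case
  proof (rule tree_inst_TVarE)
    fix m'' assume "b = TVar tx m''" "lit_inst \<sigma> m m''"
    then show ?thesis using 2(2) by (cases m; cases m'; cases m'') (auto dest: subst_to_unique)
  qed (use 2 in simp)
next
  case (3 m m' ts ts' r)
  from 3(3) obtain m'' us where b: "b = Node m'' r us" "lit_inst \<sigma> m m''" "list_all2 (tree_inst \<sigma> \<tau>) ts us"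
    by (rule tree_inst_NodeE) blast
  have "m'' = m'" using 3(1) b(2) by (cases m; cases m'; cases m'') (auto dest: subst_to_unique)
  moreover have "us = ts'"
  proof (rule nth_equalityI)
    have l: "length ts = length ts'" "length ts = length us"
      using 3(2) b(3) by (simp_all add: list_all2_conv_all_nth)
    then show "length us = length ts'" by simp
    fix i assume "i < length us"
    then have i: "i < length ts" using l by simp
    show "us ! i = ts' ! i"
      using list_all2_nthD[OF 3(2) i] list_all2_nthD[OF b(3) i] by simp
  qed
  ultimately show ?case using b(1) by simp
qed

lemma tree_inst_rec_applied:
  "tree_inst \<sigma> \<tau> s t \<Longrightarrow> subst_to \<sigma> c c' \<Longrightarrow> lab t = lab s \<Longrightarrow> subst_to \<sigma> (tar s) (tar t) \<Longrightarrow>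
    tree_inst \<sigma> \<tau> (rec_applied Act c s) (rec_applied Act c' t)"
  unfolding rec_applied_def by (simp add: tree_inst.intros(3))

text \<open>The leaves of the successor rules for operators: both ends of the literal are process
  variables.\<close>

definition var_leaf :: "'w \<Rightarrow> 'v \<Rightarrow> 'l \<Rightarrow> 'v \<Rightarrow> ('v, 'w, 'o, 'l, 'n) otree" where
  "var_leaf w p a q = TVar w (PVar p, a, PVar q)"

lemma root_var_leaf [simp]: "src (var_leaf w p a q) = PVar p" "lab (var_leaf w p a q) = a" "tar (var_leaf w p a q) = PVar q"
  by (simp_all add: var_leaf_def src_def lab_def tar_def)

lemma leaves_var_leaf [simp]: "leaves (var_leaf w p a q) = [(w, (PVar p, a, PVar q))]"
  by (simp add: var_leaf_def)

lemma lit_inst_vars: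
  "lit_inst \<sigma> (PVar p, a, PVar q) (root t) \<longleftrightarrow> src t = sapp \<sigma> p \<and> lab t = a \<and> tar t = sapp \<sigma> q"
  by (cases "root t") (simp add: subst_to_PVar src_def lab_def tar_def)

lemma lit_inst_root:
  "lit_inst \<sigma> (root s) (root t) \<longleftrightarrow> subst_to \<sigma> (src s) (src t) \<and> lab t = lab s \<and> subst_to \<sigma> (tar s) (tar t)"
  by (cases "root t"; cases "root s") (simp add: src_def lab_def tar_def)

lemma tree_inst_root: "tree_inst \<sigma> \<tau> s t \<Longrightarrow> matches \<sigma> \<tau> s \<Longrightarrow> lit_inst \<sigma> (root s) (root t)"
  by (induction rule: tree_inst.induct) (auto simp: matches_def)

lemma tree_inst_var_leafI: "\<tau> w = Some t \<Longrightarrow> tree_inst \<sigma> \<tau> (var_leaf w p a q) t"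
  unfolding var_leaf_def by (rule tree_inst.intros)

lemma matches_var_leaf: "matches \<sigma> \<tau> (var_leaf w p a q) \<longleftrightarrow>
    (\<forall>t. \<tau> w = Some t \<longrightarrow> src t = sapp \<sigma> p \<and> lab t = a \<and> tar t = sapp \<sigma> q)"
  by (simp add: matches_def lit_inst_vars)

lemma concat_Inr:
  "concat (map (\<lambda>e. case e of Inl p \<Rightarrow> [] | Inr u \<Rightarrow> [u]) (map (\<lambda>i. if i \<in> A then Inr (X i) else Inl (E i)) is)) =
    map X (filter (\<lambda>i. i \<in> A) is)"
  by (induction "is") auto

lemma sorted_list_of_set_filter: "A \<subseteq> {..<n} \<Longrightarrow> filter (\<lambda>i. i \<in> A) [0..<n] = sorted_list_of_set (A :: nat set)"
proof -
  assume A: "A \<subseteq> {..<n}"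
  have "sorted_list_of_set (set (filter (\<lambda>i. i \<in> A) [0..<n])) = filter (\<lambda>i. i \<in> A) [0..<n]"
    by (rule sorted_list_of_set.idem_if_sorted_distinct) (simp_all add: sorted_filter[of id, simplified])
  moreover have "set (filter (\<lambda>i. i \<in> A) [0..<n]) = A" using A by auto
  ultimately show ?thesis by simp
qed

lemma image_disjoint_neq: "f ` A \<inter> h ` B = {} \<Longrightarrow> i \<in> A \<Longrightarrow> j \<in> B \<Longrightarrow> f i \<noteq> h j"
  by (metis disjoint_iff image_eqI)

lemma matches_Node: "matches \<sigma> \<tau> (Node m r ts) \<longleftrightarrow> (\<forall>t \<in> set ts. matches \<sigma> \<tau> t)"
  by (auto simp: matches_def)


text \<open>Premises and subtrees are lists in the order of the trigger positions, while all
  reasoning is by position. This reads a family indexed by positions as such a list.\<close>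

abbreviation along :: "nat set \<Rightarrow> (nat \<Rightarrow> 'a) \<Rightarrow> 'a list" where
  "along I f \<equiv> map f (sorted_list_of_set I)"


section \<open>Transitions in De Simone format\<close>

locale de_simone =
  fixes Act :: "'l set" and T :: "('v, 'w, 'o, 'l, 'n) tsss"
  assumes infinite_vars: "infinite (UNIV :: 'v set)"
    and de_simone: "de_simone_tsss Act T"
begin

abbreviation "\<Sigma> \<equiv> signature T"

abbreviation Tr :: "('v, 'w, 'o, 'l, 'n) otree set" where
  "Tr \<equiv> closed_trans T"

lemma dtss: "de_simone_tss Act T"
  using de_simone by (simp add: de_simone_tsss_def)

definition rule_of :: "'o \<Rightarrow> 'l option list \<Rightarrow> 'l \<Rightarrow> ('v, 'o) pexp \<Rightarrow> (nat \<Rightarrow> 'v) \<Rightarrow> (nat \<Rightarrow> 'v) \<Rightarrow>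
    ('v, 'o, 'l) rule" where
  "rule_of f g a q x y =
     (along (trigger_set g) (\<lambda>i. (PVar (x i), the (g ! i), PVar (y i))),
      (POp f (map (\<lambda>i. PVar (x i)) [0..<length g]), a, q))"

text \<open>A De Simone rule with its name and with its variables \<open>x\<close> and
  \<open>y\<close> made explicit. \<open>ds_rule\<close> hides them behind a quantifier, but
  comparing two instances of one rule requires fixed ones.\<close>

definition op_rule :: "'n \<Rightarrow> 'o \<Rightarrow> 'l option list \<Rightarrow> 'l \<Rightarrow> ('v, 'o) pexp \<Rightarrow> (nat \<Rightarrow> 'v) \<Rightarrow> (nat \<Rightarrow> 'v) \<Rightarrow> bool" where
  "op_rule r f g a q x y \<longleftrightarrow>
     rule_of f g a q x y \<in> rules T \<and> naming T (rule_of f g a q x y) = Name r \<and>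
     ds_rule Act \<Sigma> (rule_of f g a q x y) f g a q \<and>
     (f, length g) \<in> \<Sigma> \<and> inj_on x {..<length g} \<and> inj_on y (trigger_set g) \<and>
     x ` {..<length g} \<inter> y ` trigger_set g = {} \<and> q \<in> expr \<Sigma> \<and>
     fv q \<subseteq> x ` ({..<length g} - trigger_set g) \<union> y ` trigger_set g \<and>
     (\<forall>c. subexp c q \<longrightarrow> recursive_call c \<longrightarrow> fv c = {})"

lemma op_ruleI:
  assumes "ds_rule Act \<Sigma> ru f g a q" "ru \<in> rules T" "naming T ru = Name r"
  obtains x y where "op_rule r f g a q x y" "ru = rule_of f g a q x y"
proof -
  from assms(1) obtain x y where xy: "ru = rule_of f g a q x y"
     "(f, length g) \<in> \<Sigma>" "inj_on x {..<length g}" "inj_on y (trigger_set g)"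
     "x ` {..<length g} \<inter> y ` trigger_set g = {}" "q \<in> expr \<Sigma>"
     "fv q \<subseteq> x ` ({..<length g} - trigger_set g) \<union> y ` trigger_set g"
     "\<forall>c. subexp c q \<longrightarrow> recursive_call c \<longrightarrow> fv c = {}"
    unfolding ds_rule_def rule_of_def by blast
  then have "op_rule r f g a q x y" unfolding op_rule_def using assms by blast
  with xy(1) that show ?thesis by blast
qed

lemma constructor_iff:
  "constructor Act T r n I \<longleftrightarrow> (\<exists>f g a q x y. op_rule r f g a q x y \<and> n = length g \<and> I = trigger_set g)"
  unfolding constructor_def by (metis op_ruleI op_rule_def)

lemma trigger_sub: "trigger_set g \<subseteq> {..<length g}"
  by (auto simp: trigger_set_def)

lemma map_upt_eq: "map f [0..<n] = map h [0..<m] \<longleftrightarrow> n = m \<and> (\<forall>i < n. f i = h i)"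
  by (auto simp: list_eq_iff_nth_eq)

text \<open>Distinct rules of the same name agree in type, target and trigger set but differ in the
  trigger, by the format; for a single rule everything is read off its syntax. So a name and a
  trigger together determine the rule.\<close>

lemma op_rule_unique:
  assumes "op_rule r f g a q x y" "op_rule r f' g' a' q' x' y'"
  shows "f = f'" "length g = length g'" "trigger_set g = trigger_set g'"
    "g = g' \<Longrightarrow> a = a' \<and> q = q' \<and> (\<forall>i < length g. x i = x' i) \<and> (\<forall>i \<in> trigger_set g. y i = y' i)"
proof -
  have "f = f' \<and> length g = length g' \<and> trigger_set g = trigger_set g' \<and>
    (g = g' \<longrightarrow> a = a' \<and> q = q' \<and> (\<forall>i < length g. x i = x' i) \<and> (\<forall>i \<in> trigger_set g. y i = y' i))"
  proof (cases "rule_of f g a q x y = rule_of f' g' a' q' x' y'")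
    case False
    have D: "\<forall>ru \<in> rules T. \<forall>ru' \<in> rules T. \<forall>f g a q f' g' a' q'.
        ru \<noteq> ru' \<longrightarrow> naming T ru = naming T ru' \<longrightarrow>
        ds_rule Act (signature T) ru f g a q \<longrightarrow> ds_rule Act (signature T) ru' f' g' a' q' \<longrightarrow>
        f = f' \<and> length g = length g' \<and> q = q' \<and> trigger_set g = trigger_set g' \<and> g \<noteq> g'"
      using dtss unfolding de_simone_tss_def by blast
    have R: "rule_of f g a q x y \<in> rules T" "rule_of f' g' a' q' x' y' \<in> rules T"
      "naming T (rule_of f g a q x y) = naming T (rule_of f' g' a' q' x' y')"
      "ds_rule Act \<Sigma> (rule_of f g a q x y) f g a q"
      "ds_rule Act \<Sigma> (rule_of f' g' a' q' x' y') f' g' a' q'"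
      using assms unfolding op_rule_def by simp_all
    have "f = f' \<and> length g = length g' \<and> q = q' \<and> trigger_set g = trigger_set g' \<and> g \<noteq> g'"
      using bspec[OF bspec[OF D R(1)] R(2)] False R(3-5) by blast
    then show ?thesis by blast
  next
    case True
    then have *: "f = f'" "a = a'" "q = q'" "length g = length g'" "\<forall>i < length g. x i = x' i"
      unfolding rule_of_def prod.inject POp_eq_iff map_upt_eq PVar_inject by simp_all
    \<comment> \<open>The trigger positions are recovered from the sources of the premises, since
      \<open>x\<close> is injective.\<close>
    let ?s = "sorted_list_of_set (trigger_set g)" and ?s' = "sorted_list_of_set (trigger_set g')"
    note m = arg_cong[OF True, of fst, unfolded rule_of_def fst_conv]
    from arg_cong[OF m, of "map fst"] have "map (PVar \<circ> x) ?s = map ((PVar :: 'v \<Rightarrow> ('v, 'o) pexp) \<circ> x') ?s'"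
      by (simp add: comp_def)
    also have "\<dots> = map ((PVar :: 'v \<Rightarrow> ('v, 'o) pexp) \<circ> x) ?s'"
      using *(4,5) trigger_sub[of g'] by auto
    finally have "map (PVar \<circ> x) ?s = map ((PVar :: 'v \<Rightarrow> ('v, 'o) pexp) \<circ> x) ?s'" .
    moreover have "inj_on ((PVar :: 'v \<Rightarrow> ('v, 'o) pexp) \<circ> x) (set ?s \<union> set ?s')"
    proof (rule inj_on_subset)
      show "inj_on ((PVar :: 'v \<Rightarrow> ('v, 'o) pexp) \<circ> x) {..<length g}"
        using assms(1) by (simp add: op_rule_def inj_on_def)
      show "set ?s \<union> set ?s' \<subseteq> {..<length g}"
        using trigger_sub[of g'] trigger_sub[of g] *(4) by simp
    qed
    ultimately have "?s = ?s'" by (rule map_inj_on)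
    then have "trigger_set g = trigger_set g'"
      by (metis finite_trigger_set set_sorted_list_of_set)
    with * m show ?thesis by auto
  qed
  then show "f = f'" "length g = length g'" "trigger_set g = trigger_set g'"
    "g = g' \<Longrightarrow> a = a' \<and> q = q' \<and> (\<forall>i < length g. x i = x' i) \<and> (\<forall>i \<in> trigger_set g. y i = y' i)"
    by blast+
qed

lemma op_rule_constructor: "op_rule r f g a q x y \<Longrightarrow> constructor Act T r (length g) (trigger_set g)"
  unfolding constructor_iff by blast

lemma constructor_unique:
  "constructor Act T r n I \<Longrightarrow> constructor Act T r n' I' \<Longrightarrow> n = n' \<and> I = I'"
  unfolding constructor_iff using op_rule_unique by metis

lemma finite_constructor: "constructor Act T r n I \<Longrightarrow> finite I"
  unfolding constructor_iff by auto

lemma constructor_sub: "constructor Act T r n I \<Longrightarrow> I \<subseteq> {..<n}"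
  unfolding constructor_iff using trigger_sub by blast

lemma rule_cases:
  assumes "ru \<in> rules T"
  obtains (rec) c p y a where "c \<in> expr \<Sigma>" "unfolds c p" "y \<notin> fv p" "ru = rec_rule Act c p y a"
      "naming T ru = rec_name Act a"
    | (name) r f g a q x y where "op_rule r f g a q x y" "ru = rule_of f g a q x y" "naming T ru = Name r"
  using dtss assms unfolding de_simone_tss_def by (metis op_ruleI)

section \<open>Inversion and introduction of open and closed transitions\<close>

lemma derivation_Name:
  assumes "derivation T (Node m (Name r) ts)"
  obtains f g a q x y \<sigma> tf q' where "op_rule r f g a q x y" "is_subst \<Sigma> \<sigma>"
    "ts = along (trigger_set g) tf"
    "\<And>i. i \<in> trigger_set g \<Longrightarrow> derivation T (tf i) \<and> src (tf i) = sapp \<sigma> (x i) \<and>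
       lab (tf i) = the (g ! i) \<and> tar (tf i) = sapp \<sigma> (y i)"
    "subst_to \<sigma> q q'" "m = (POp f (map (\<lambda>i. sapp \<sigma> (x i)) [0..<length g]), a, q')"
  using assms
proof cases
  case (2 H c \<sigma>)
  from 2(1) show ?thesis
  proof (cases rule: rule_cases)
    case (rec c' p y a)
    then show ?thesis using 2(2) by (simp add: rec_name_def split: if_splits)
  next
    case (name r' f g a q x y)
    let ?I = "trigger_set g"
    from name 2(2) have r: "r' = r" by simp
    have H: "H = along ?I (\<lambda>i. (PVar (x i), the (g ! i), PVar (y i)))"
      and c: "c = (POp f (map (\<lambda>i. PVar (x i)) [0..<length g]), a, q)"
      using name(2) by (simp_all add: rule_of_def)
    from 2(4) have "length ts = length (sorted_list_of_set ?I)"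
      unfolding H using list_all2_lengthD by fastforce
    then obtain tf where tf: "ts = along ?I tf"
      using ex_map[OF distinct_sorted_list_of_set] by blast
    have "lit_inst \<sigma> (PVar (x i), the (g ! i), PVar (y i)) (root (tf i))" if "i \<in> ?I" for i
      using 2(4) that unfolding H tf by (auto simp: list_all2_map1 list_all2_map2 list_all2_same)
    then have h: "src (tf i) = sapp \<sigma> (x i) \<and> lab (tf i) = the (g ! i) \<and> tar (tf i) = sapp \<sigma> (y i)"
      if "i \<in> ?I" for i
      using that by (cases "root (tf i)") (fastforce simp: subst_to_PVar src_def lab_def tar_def)
    obtain p' a' q' where m: "m = (p', a', q')" by (cases m)
    have "a' = a" "subst_to \<sigma> q q'" using 2(5) by (simp_all add: c m)
    moreover have "p' = POp f (map (\<lambda>i. sapp \<sigma> (x i)) [0..<length g])"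
      using 2(5) by (auto simp: c m subst_to_POp_iff list_all2_conv_all_nth subst_to_PVar
          intro!: nth_equalityI arg_cong[where f = "POp f"])
    moreover have "\<And>i. i \<in> ?I \<Longrightarrow> derivation T (tf i) \<and> src (tf i) = sapp \<sigma> (x i) \<and>
        lab (tf i) = the (g ! i) \<and> tar (tf i) = sapp \<sigma> (y i)"
      using h 2(7) tf by simp
    ultimately show ?thesis
      by (intro that[OF name(1)[unfolded r] 2(3) tf]) (simp_all add: m)
  qed
qed

lemma sapp_expr: "is_subst \<Sigma> \<sigma> \<Longrightarrow> sapp \<sigma> x \<in> expr \<Sigma>"
  by (cases "\<sigma> x") (auto simp: sapp_def is_subst_def ran_def)

lemma derivation_NameI:
  assumes "op_rule r f g a q x y" "is_subst \<Sigma> \<sigma>"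
    "\<And>i. i \<in> trigger_set g \<Longrightarrow> derivation T (tf i) \<and> src (tf i) = sapp \<sigma> (x i) \<and>
       lab (tf i) = the (g ! i) \<and> tar (tf i) = sapp \<sigma> (y i)"
    "subst_to \<sigma> q q'"
  shows "derivation T (Node (POp f (map (\<lambda>i. sapp \<sigma> (x i)) [0..<length g]), a, q') (Name r)
    (along (trigger_set g) tf))"
proof (rule derivation.intros(2))
  show "(along (trigger_set g) (\<lambda>i. (PVar (x i), the (g ! i), PVar (y i))),
      (POp f (map (\<lambda>i. PVar (x i)) [0..<length g]), a, q)) \<in> rules T"
    "naming T (along (trigger_set g) (\<lambda>i. (PVar (x i), the (g ! i), PVar (y i))),
      (POp f (map (\<lambda>i. PVar (x i)) [0..<length g]), a, q)) = Name r"
    using assms(1) by (simp_all add: op_rule_def rule_of_def)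
  show "is_subst \<Sigma> \<sigma>" by fact
  have "lit_inst \<sigma> (PVar (x i), the (g ! i), PVar (y i)) (root (tf i))" if "i \<in> trigger_set g" for i
    using assms(3)[OF that] by (cases "root (tf i)") (simp add: src_def lab_def tar_def subst_to_PVar)
  then show "list_all2 (lit_inst \<sigma>)
     (along (trigger_set g) (\<lambda>i. (PVar (x i), the (g ! i), PVar (y i))))
     (map root (along (trigger_set g) tf))"
    by (auto simp: list_all2_map1 list_all2_map2 list_all2_same)
  show "lit_inst \<sigma> (POp f (map (\<lambda>i. PVar (x i)) [0..<length g]), a, q)
     (POp f (map (\<lambda>i. sapp \<sigma> (x i)) [0..<length g]), a, q')"
    using assms(4) by (auto simp: subst_to_POp_iff list_all2_conv_all_nth subst_to_PVar)
  show "lit_ok \<Sigma> (POp f (map (\<lambda>i. sapp \<sigma> (x i)) [0..<length g]), a, q')"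
    using assms(1,2,4) sapp_expr
    by (auto simp: op_rule_def expr_POp_iff is_subst_def intro: expr_subst_to)
qed (use assms(3) in auto)

lemma derivation_rec:
  assumes "derivation T (Node m n ts)" "\<And>r. n \<noteq> Name r"
  obtains c p y \<sigma> c' t where "c \<in> expr \<Sigma>" "unfolds c p" "y \<notin> fv p" "is_subst \<Sigma> \<sigma>" "ts = [t]"
    "derivation T t" "subst_to \<sigma> c c'" "subst_to \<sigma> p (src t)"
    "Node m n ts = rec_applied Act c' t"
    "rec_rule Act c p y (lab t) \<in> rules T" "naming T (rec_rule Act c p y (lab t)) = rec_name Act (lab t)"
    "sapp \<sigma> y = tar t"
  using assms(1)
proof cases
  case (2 H d \<sigma>)
  from 2(1) show ?thesis
  proof (cases rule: rule_cases)
    case (rec c p y a)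
    have H: "H = [(p, a, PVar y)]" and d: "d = (c, a, if a \<in> Act then PVar y else c)"
      using rec(4) by (simp_all add: rec_rule_def)
    from 2(4) obtain t where t: "ts = [t]" "lit_inst \<sigma> (p, a, PVar y) (root t)"
      unfolding H by (auto simp: list_all2_Cons1)
    then have l: "lab t = a" "subst_to \<sigma> p (src t)" "sapp \<sigma> y = tar t"
      by (cases "root t"; simp add: src_def lab_def tar_def subst_to_PVar)+
    obtain c' a' q' where m: "m = (c', a', q')" by (cases m)
    have c': "subst_to \<sigma> c c'" "a' = a" using 2(5) by (simp_all add: d m)
    \<comment> \<open>Outside \<open>Act\<close> the target of the rule is the call \<open>c\<close>
      again, and its instance coincides with the source \<open>c'\<close> because substitution is
      single-valued.\<close>
    have q': "q' = (if a \<in> Act then tar t else c')"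
      using 2(5) l(3) c'(1) subst_to_unique[of \<sigma> c] by (auto simp: d m subst_to_PVar split: if_splits)
    have n: "n = rec_name Act a" using 2(2) rec(5) by simp
    show ?thesis
    proof (rule that[OF rec(1-3) 2(3) t(1) _ c'(1) l(2)])
      show "derivation T t" using 2(7) t(1) by simp
      show "Node m n ts = rec_applied Act c' t"
        using m n c'(2) q' l t by (simp add: rec_applied_def)
    qed (use rec 2(1) l in auto)
  next
    case (name r' f g a q x y)
    then show ?thesis using 2(2) assms(2) by metis
  qed
qed

lemma closed_trans_iff:
  "t \<in> Tr \<longleftrightarrow> derivation T t \<and> leaves t = [] \<and> (\<forall>m \<in> set (lits t). lit_closed m)"
  by (auto simp: closed_trans_def open_trans_def)

lemma closed_trans_TVar [simp]: "TVar tx m \<notin> Tr"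
  by (simp add: closed_trans_iff)

lemma closed_trans_Node:
  "Node m n ts \<in> Tr \<longleftrightarrow> derivation T (Node m n ts) \<and> lit_closed m \<and> set ts \<subseteq> Tr"
proof
  assume a: "Node m n ts \<in> Tr"
  then have d: "derivation T (Node m n ts)" by (simp add: closed_trans_iff)
  then have "\<forall>t \<in> set ts. derivation T t" by cases blast
  with a d show "derivation T (Node m n ts) \<and> lit_closed m \<and> set ts \<subseteq> Tr"
    by (auto simp: closed_trans_iff)
next
  assume a: "derivation T (Node m n ts) \<and> lit_closed m \<and> set ts \<subseteq> Tr"
  then have "leaves t = [] \<and> (\<forall>m \<in> set (lits t). lit_closed m)" if "t \<in> set ts" for t
    using that closed_trans_iff by blast
  with a show "Node m n ts \<in> Tr"
    unfolding closed_trans_iff by (simp del: split_paired_All)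
qed

lemma closed_trans_cexpr: "t \<in> Tr \<Longrightarrow> src t \<in> cexpr \<Sigma> \<and> tar t \<in> cexpr \<Sigma>"
proof -
  assume t: "t \<in> Tr"
  have "lit_ok \<Sigma> (root t)" using t unfolding closed_trans_iff by (auto elim: derivation.cases)
  moreover have "lit_closed (root t)" using t by (cases t) (auto simp: closed_trans_iff)
  ultimately show ?thesis by (cases "root t") (simp add: cexpr_def src_def tar_def)
qed

text \<open>Inversion relative to a rule fixed beforehand. The labels of the subtransitions give the
  trigger, and name and trigger single out the rule. Hence transitions with the same constructor and
  equally labelled subtransitions share the target \<open>q\<close>.\<close>

lemma derivation_Name_at:
  assumes n: "op_rule r f g a q x y"
    and d: "derivation T (Node m (Name r) (along (trigger_set g) tf))"
    and l: "\<And>i. i \<in> trigger_set g \<Longrightarrow> lab (tf i) = the (g ! i)"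
  obtains \<sigma> q' where "is_subst \<Sigma> \<sigma>"
    "\<And>i. i \<in> trigger_set g \<Longrightarrow> derivation T (tf i) \<and> src (tf i) = sapp \<sigma> (x i) \<and> tar (tf i) = sapp \<sigma> (y i)"
    "subst_to \<sigma> q q'" "m = (POp f (map (\<lambda>i. sapp \<sigma> (x i)) [0..<length g]), a, q')"
  using d
proof (rule derivation_Name)
  fix f' g' a' q' x' y' \<sigma> tf' qq
  assume n': "op_rule r f' g' a' q' x' y'" and 1: "is_subst \<Sigma> \<sigma>"
    "along (trigger_set g) tf = along (trigger_set g') tf'"
    "\<And>i. i \<in> trigger_set g' \<Longrightarrow> derivation T (tf' i) \<and> src (tf' i) = sapp \<sigma> (x' i) \<and>
       lab (tf' i) = the (g' ! i) \<and> tar (tf' i) = sapp \<sigma> (y' i)"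
    "subst_to \<sigma> q' qq" "m = (POp f' (map (\<lambda>i. sapp \<sigma> (x' i)) [0..<length g']), a', qq)"
  note u = op_rule_unique(1-3)[OF n n']
  have t: "tf i = tf' i" if "i \<in> trigger_set g" for i
    using 1(2) that unfolding u(3) by simp
  have "g ! i = g' ! i" if "i < length g" for i
  proof (cases "i \<in> trigger_set g")
    case True
    from True have True': "i \<in> trigger_set g'" unfolding u(3) .
    have "the (g ! i) = the (g' ! i)" using l[OF True] 1(3)[OF True'] t[OF True] by simp
    moreover have "g ! i \<noteq> None" "g' ! i \<noteq> None"
      using True True' by (simp_all add: trigger_set_def)
    ultimately show ?thesis by auto
  next
    case False
    then have "i \<notin> trigger_set g'" unfolding u(3) .
    with False that u(2) have "g ! i = None" "g' ! i = None" by (simp_all add: trigger_set_def)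
    then show ?thesis by simp
  qed
  with u(2) have "g = g'" by (simp add: list_eq_iff_nth_eq)
  note v = op_rule_unique(4)[OF n n' this]
  show ?thesis
  proof (rule that[OF 1(1)])
    show "derivation T (tf i) \<and> src (tf i) = sapp \<sigma> (x i) \<and> tar (tf i) = sapp \<sigma> (y i)"
      if "i \<in> trigger_set g" for i
    proof -
      have "i \<in> trigger_set g'" "i < length g" using that trigger_sub[of g] unfolding u(3) by auto
      moreover have "x' i = x i" "y' i = y i" using v that calculation(2) by auto
      ultimately show ?thesis using 1(3)[of i] t[OF that] by simp
    qed
    show "subst_to \<sigma> q qq" using 1(4) v by blast
    have "map (\<lambda>i. sapp \<sigma> (x' i)) [0..<length g'] = map (\<lambda>i. sapp \<sigma> (x i)) [0..<length g]"
      unfolding map_upt_eq using u(2) v by simp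
    then show "m = (POp f (map (\<lambda>i. sapp \<sigma> (x i)) [0..<length g]), a, qq)"
      using 1(5) u(1) v by simp
  qed
qed

lemma closed_Name_at:
  assumes n: "op_rule r f g a q x y"
    and d: "Node m (Name r) (along (trigger_set g) tf) \<in> Tr"
    and l: "\<And>i. i \<in> trigger_set g \<Longrightarrow> lab (tf i) = the (g ! i)"
  obtains \<sigma> where "\<And>z. \<sigma> z \<in> cexpr \<Sigma>"
    "\<And>i. i \<in> trigger_set g \<Longrightarrow> tf i \<in> Tr \<and> src (tf i) = \<sigma> (x i) \<and> tar (tf i) = \<sigma> (y i)"
    "m = (POp f (map (\<lambda>i. \<sigma> (x i)) [0..<length g]), a, psubst q (Some \<circ> \<sigma>))"
proof -
  let ?I = "trigger_set g"
  from d have d': "derivation T (Node m (Name r) (along ?I tf))"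
    and lc: "lit_closed m" and tc: "\<And>i. i \<in> ?I \<Longrightarrow> tf i \<in> Tr"
    unfolding closed_trans_Node by auto
  obtain \<sigma> q' where 1: "is_subst \<Sigma> \<sigma>"
    "\<And>i. i \<in> ?I \<Longrightarrow> derivation T (tf i) \<and> src (tf i) = sapp \<sigma> (x i) \<and> tar (tf i) = sapp \<sigma> (y i)"
    "subst_to \<sigma> q q'" "m = (POp f (map (\<lambda>i. sapp \<sigma> (x i)) [0..<length g]), a, q')"
    by (rule derivation_Name_at[OF n d']) (use l in blast, rule that, assumption+)
  let ?V = "x ` {..<length g} \<union> y ` ?I"
  \<comment> \<open>The source of the transition is a closed expression at hand. It serves as the
    value of the variables foreign to the rule, which makes the valuation total.\<close>
  let ?p = "POp f (map (\<lambda>i. sapp \<sigma> (x i)) [0..<length g])"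
  let ?s = "\<lambda>z. if z \<in> ?V then sapp \<sigma> z else ?p"
  have c: "sapp \<sigma> z \<in> cexpr \<Sigma>" if "z \<in> ?V" for z
    using that
  proof
    assume "z \<in> x ` {..<length g}"
    then show ?thesis using lc sapp_expr[OF 1(1)] by (auto simp: 1(4) cexpr_def)
  next
    assume "z \<in> y ` ?I"
    then show ?thesis using 1(2) tc closed_trans_cexpr by force
  qed
  have p: "?p \<in> cexpr \<Sigma>" using c n by (auto simp: cexpr_def expr_POp_iff op_rule_def)
  have S: "\<sigma> z = Some (sapp \<sigma> z)" if "z \<in> ?V" for z
    using c[OF that] by (cases "\<sigma> z") (auto simp: sapp_def cexpr_def)
  have "subst_to (Some \<circ> ?s) q q'"
    using 1(3)
  proof (rule subst_to_cong)
    fix z assume "z \<in> fv q"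
    then have z: "z \<in> ?V" using n unfolding op_rule_def by blast
    then show "\<sigma> z = (Some \<circ> ?s) z" using S[OF z] by (simp only: o_apply if_True)
  qed
  then have q': "q' = psubst q (Some \<circ> ?s)" by (simp add: psubst_eqI)
  show ?thesis
  proof (rule that)
    show "?s z \<in> cexpr \<Sigma>" for z using c p by simp
    show "tf i \<in> Tr \<and> src (tf i) = ?s (x i) \<and> tar (tf i) = ?s (y i)" if "i \<in> ?I" for i
      using that 1(2)[OF that] tc trigger_sub[of g] by auto
    have "map (\<lambda>i. ?s (x i)) [0..<length g] = map (\<lambda>i. sapp \<sigma> (x i)) [0..<length g]"
      unfolding map_upt_eq by simp
    then show "m = (POp f (map (\<lambda>i. ?s (x i)) [0..<length g]), a, psubst q (Some \<circ> ?s))"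
      using 1(4) q' by (simp only:)
  qed
qed

lemma closed_Name:
  assumes "Node m (Name r) ts \<in> Tr"
  obtains f g a q x y \<sigma> tf where "op_rule r f g a q x y" "\<And>z. \<sigma> z \<in> cexpr \<Sigma>"
    "ts = along (trigger_set g) tf"
    "\<And>i. i \<in> trigger_set g \<Longrightarrow> tf i \<in> Tr \<and> src (tf i) = \<sigma> (x i) \<and>
       lab (tf i) = the (g ! i) \<and> tar (tf i) = \<sigma> (y i)"
    "m = (POp f (map (\<lambda>i. \<sigma> (x i)) [0..<length g]), a, psubst q (Some \<circ> \<sigma>))"
proof -
  have "derivation T (Node m (Name r) ts)" using assms by (simp add: closed_trans_iff)
  then show ?thesis
  proof (rule derivation_Name)
    fix f g a q x y \<sigma> tf q'
    assume n: "op_rule r f g a q x y" and ts: "ts = along (trigger_set g) tf"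
      and h: "\<And>i. i \<in> trigger_set g \<Longrightarrow> derivation T (tf i) \<and> src (tf i) = sapp \<sigma> (x i) \<and>
         lab (tf i) = the (g ! i) \<and> tar (tf i) = sapp \<sigma> (y i)"
    show ?thesis
    proof (rule closed_Name_at[OF n assms[unfolded ts]])
      show "lab (tf i) = the (g ! i)" if "i \<in> trigger_set g" for i using h[OF that] by blast
    next
      fix \<sigma>'
      assume *: "\<And>z. \<sigma>' z \<in> cexpr \<Sigma>"
        "\<And>i. i \<in> trigger_set g \<Longrightarrow> tf i \<in> Tr \<and> src (tf i) = \<sigma>' (x i) \<and> tar (tf i) = \<sigma>' (y i)"
        "m = (POp f (map (\<lambda>i. \<sigma>' (x i)) [0..<length g]), a, psubst q (Some \<circ> \<sigma>'))"
      show ?thesis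
        by (rule that[OF n *(1) ts _ *(3)]) (use * h in auto)
    qed
  qed
qed

lemma closed_NameI:
  assumes "op_rule r f g a q x y" "\<And>z. \<sigma> z \<in> cexpr \<Sigma>"
    "\<And>i. i \<in> trigger_set g \<Longrightarrow> tf i \<in> Tr \<and> src (tf i) = \<sigma> (x i) \<and>
       lab (tf i) = the (g ! i) \<and> tar (tf i) = \<sigma> (y i)"
  shows "Node (POp f (map (\<lambda>i. \<sigma> (x i)) [0..<length g]), a, psubst q (Some \<circ> \<sigma>)) (Name r)
    (along (trigger_set g) tf) \<in> Tr"
proof -
  have g: "ground (Some \<circ> \<sigma>)" using assms(2) by (auto simp: ground_def cexpr_def)
  have "derivation T (Node (POp f (map (\<lambda>i. sapp (Some \<circ> \<sigma>) (x i)) [0..<length g]), a, psubst q (Some \<circ> \<sigma>)) (Name r)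
    (along (trigger_set g) tf))"
    using assms(1)
    by (rule derivation_NameI)
      (use assms(2,3) g in \<open>auto simp: is_subst_def ran_def cexpr_def closed_trans_iff subst_to_ground\<close>)
  then show ?thesis
    using assms(2,3) g by (auto simp: closed_trans_Node cexpr_def fv_psubst)
qed

lemma closed_rec:
  assumes "Node m n ts \<in> Tr" "\<And>r. n \<noteq> Name r"
  obtains c t where "ts = [t]" "t \<in> Tr" "unfolds c (src t)" "c \<in> cexpr \<Sigma>"
    "Node m n ts = rec_applied Act c t"
proof -
  from assms(1) have "derivation T (Node m n ts)" by (simp add: closed_trans_iff)
  then show ?thesis using assms(2)
  proof (rule derivation_rec)
    fix c p y \<sigma> c' t
    assume 1: "c \<in> expr \<Sigma>" "unfolds c p" "is_subst \<Sigma> \<sigma>" "ts = [t]" "subst_to \<sigma> c c'" "subst_to \<sigma> p (src t)"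
      "Node m n ts = rec_applied Act c' t"
    from 1(4) assms(1) have t: "t \<in> Tr" by (simp add: closed_trans_Node)
    have c': "c' = src (Node m n ts)" using 1(7) by (simp add: rec_applied_def src_def)
    then have c'c: "c' \<in> cexpr \<Sigma>" using closed_trans_cexpr assms(1) by blast
    \<comment> \<open>\<open>\<sigma>\<close> may have open values elsewhere, but on the variables
      of \<open>c\<close> they are closed because \<open>c'\<close> is. The restriction is ground
      and still maps \<open>p\<close> to \<open>src t\<close>, as unfolding adds no free
      variables.\<close>
    let ?s = "\<sigma> |` fv c"
    have cl: "fv (sapp \<sigma> x) = {}" if "x \<in> fv c" for x
      using fv_subst_to[OF 1(5)] c'c that by (auto simp: cexpr_def)
    have d: "fv c \<subseteq> dom ?s"
    proof
      fix x assume "x \<in> fv c"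
      then show "x \<in> dom ?s" using cl[of x] by (cases "\<sigma> x") (auto simp: sapp_def)
    qed
    have g: "ground ?s"
      unfolding ground_def
    proof (intro allI impI)
      fix x q assume "?s x = Some q"
      then have "x \<in> fv c" "\<sigma> x = Some q" by (auto simp: restrict_map_def split: if_splits)
      with cl[of x] show "fv q = {}" by simp
    qed
    have "psubst c ?s = c'"
      by (rule psubst_eqI) (rule subst_to_cong[OF 1(5)], simp)
    moreover have "psubst p ?s = src t"
      by (rule psubst_eqI) (rule subst_to_cong[OF 1(6)], use fv_unfolds[OF 1(2)] in auto)
    ultimately have "unfolds c' (src t)" using unfolds_psubst[OF 1(2) g d] by simp
    then show ?thesis using that 1(4,7) t c'c by blast
  qed
qed

lemma closed_recI:
  assumes "c \<in> cexpr \<Sigma>" "unfolds c (src t)" "t \<in> Tr"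
  shows "rec_applied Act c t \<in> Tr"
proof -
  have cc: "c \<in> expr \<Sigma>" "fv c = {}" using assms(1) by (auto simp: cexpr_def)
  let ?a = "lab t"
  have "\<forall>c \<in> expr \<Sigma>. \<forall>p a. unfolds c p \<longrightarrow>
      (\<exists>y. y \<notin> fv p \<and> rec_rule Act c p y a \<in> rules T \<and> naming T (rec_rule Act c p y a) = rec_name Act a)"
    using dtss unfolding de_simone_tss_def by (elim conjE)
  from bspec[OF this cc(1)] assms(2) obtain y where y: "rec_rule Act c (src t) y ?a \<in> rules T"
    "naming T (rec_rule Act c (src t) y ?a) = rec_name Act ?a" "y \<notin> fv (src t)"
    by blast
  have st: "src t \<in> expr \<Sigma>" "tar t \<in> expr \<Sigma>" "fv (src t) = {}" "fv (tar t) = {}"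
    using closed_trans_cexpr[OF assms(3)] by (auto simp: cexpr_def)
  have "derivation T (Node (c, ?a, if ?a \<in> Act then tar t else c) (rec_name Act ?a) [t])"
  proof (rule derivation.intros(2))
    show "([(src t, ?a, PVar y)], (c, ?a, if ?a \<in> Act then PVar y else c)) \<in> rules T"
      "naming T ([(src t, ?a, PVar y)], (c, ?a, if ?a \<in> Act then PVar y else c)) = rec_name Act ?a"
      using y by (simp_all add: rec_rule_def)
    \<comment> \<open>\<open>c\<close> and its unfolding are closed, so \<open>y\<close> is the only
      variable of the rule.\<close>
    show "is_subst \<Sigma> [y \<mapsto> tar t]" using st by (simp add: is_subst_def)
    show "list_all2 (lit_inst [y \<mapsto> tar t]) [(src t, ?a, PVar y)] (map root [t])"
      using st by (cases "root t") (auto simp: src_def lab_def tar_def subst_to_PVar subst_to_disjoint sapp_def)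
    show "lit_inst [y \<mapsto> tar t] (c, ?a, if ?a \<in> Act then PVar y else c) (c, ?a, if ?a \<in> Act then tar t else c)"
      using cc by (auto simp: subst_to_disjoint subst_to_PVar sapp_def)
  qed (use cc st assms(3) in \<open>auto simp: closed_trans_iff\<close>)
  then show ?thesis
    using cc st assms(3) by (auto simp: rec_applied_def closed_trans_Node)
qed


section \<open>Transitions related along a context\<close>

abbreviation "\<Sigma>' \<equiv> hole_sig \<Sigma> :: (('o + 'v) \<times> nat) set"

text \<open>The root literals are left open: sources are fixed in \<open>ctx_trans\<close>, and
  agreement of the labels follows by \<open>ctx_rel_lab\<close>. For the same reason
  \<open>Rec\<close> does not compare the two recursion names, which depend on the labels only.
  Arguments outside the trigger set leave no trace in a transition, so \<open>Op\<close> imposes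
  nothing on them.\<close>

inductive ctx_rel :: "('v \<Rightarrow> (('v, 'w, 'o, 'l, 'n) otree \<times> ('v, 'w, 'o, 'l, 'n) otree) set) \<Rightarrow>
    ('v, 'o + 'v) pexp \<Rightarrow> ('v, 'w, 'o, 'l, 'n) otree \<Rightarrow> ('v, 'w, 'o, 'l, 'n) otree \<Rightarrow> bool" for W where
  hole: "(t, u) \<in> W k \<Longrightarrow> ctx_rel W (hole k) t u"
| Op: "constructor Act T r (length ps) I \<Longrightarrow> \<forall>i \<in> I. ctx_rel W (ps ! i) (tf i) (uf i) \<Longrightarrow>
    ctx_rel W (POp (Inl f) ps) (Node m (Name r) (along I tf))
      (Node m' (Name r) (along I uf))"
| Rec: "unfolds c p \<Longrightarrow> ctx_rel W p t u \<Longrightarrow> \<forall>s. r \<noteq> Name s \<Longrightarrow> \<forall>s. r' \<noteq> Name s \<Longrightarrow>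
    ctx_rel W c (Node m r [t]) (Node m' r' [u])"

lemma ctx_rel_hole [simp]: "ctx_rel W (hole k) t u \<longleftrightarrow> (t, u) \<in> W k"
proof
  assume "ctx_rel W (hole k) t u"
  then show "(t, u) \<in> W k"
    by cases (auto simp: hole_def POp_eq_iff dest: unfolds_recursive_call)
qed (rule ctx_rel.hole)

lemma ctx_rel_POp:
  assumes "ctx_rel W (POp (Inl f) ps) t u"
  obtains m m' r I tf uf where "constructor Act T r (length ps) I"
    "t = Node m (Name r) (along I tf)"
    "u = Node m' (Name r) (along I uf)"
    "\<And>i. i \<in> I \<Longrightarrow> ctx_rel W (ps ! i) (tf i) (uf i)"
  using assms
proof cases
  case (Op r qs I tf uf f' m m')
  then show ?thesis using that[of r I m tf m' uf] by (simp add: POp_eq_iff)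
qed (auto simp: hole_def POp_eq_iff dest: unfolds_recursive_call)

lemma ctx_rel_Rec:
  assumes "ctx_rel W c t u" "unfolds c p"
  obtains m m' r r' t' u' where "\<forall>s. r \<noteq> Name s" "\<forall>s. r' \<noteq> Name s"
    "t = Node m r [t']" "u = Node m' r' [u']" "ctx_rel W p t' u'"
  using assms(1)
proof cases
  case (hole k)
  then show ?thesis using assms(2) by (auto simp: hole_def dest: unfolds_recursive_call)
next
  case (Op r ps I tf uf f m m')
  then show ?thesis using assms(2) by (auto dest: unfolds_recursive_call)
next
  case (Rec q t' u' r r' m m')
  then show ?thesis using that assms(2) unfolds_unique by blast
qed

text \<open>The clauses treat both sides alike. Through this symmetry totality and the transfer of
  successors are proved in one direction only.\<close>

lemma ctx_rel_converseI: "ctx_rel W p t u \<Longrightarrow> ctx_rel (\<lambda>k. (W k)\<inverse>) p u t"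
proof (induction rule: ctx_rel.induct)
  case (Op r ps I tf uf f m m')
  then show ?case by (blast intro: ctx_rel.Op)
qed (auto intro: ctx_rel.intros)

lemma ctx_rel_converse: "ctx_rel (\<lambda>k. (W k)\<inverse>) p u t \<longleftrightarrow> ctx_rel W p t u"
  using ctx_rel_converseI[of W p t u] ctx_rel_converseI[of "\<lambda>k. (W k)\<inverse>" p u t] by auto

section \<open>Correspondences between the transitions of two fillings of a context\<close>

definition trans_from :: "('v, 'o) pexp \<Rightarrow> ('v, 'w, 'o, 'l, 'n) otree set" where
  "trans_from p = {t \<in> Tr. src t = p}"

text \<open>The third component of the triple that belongs to the context \<open>p\<close>.\<close>

definition ctx_trans where
  "ctx_trans \<rho> \<nu> W p = {(t, u). t \<in> trans_from (fill \<rho> p) \<and> u \<in> trans_from (fill \<nu> p) \<and> ctx_rel W p t u}"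

lemma ctx_trans_converse: "(ctx_trans \<rho> \<nu> W p)\<inverse> = ctx_trans \<nu> \<rho> (\<lambda>k. (W k)\<inverse>) p"
  by (auto simp: ctx_trans_def ctx_rel_converse)

text \<open>The first clause of ep-bisimulation, isolated as a property of a single triple.\<close>

definition matching where
  "matching p q R \<longleftrightarrow> p \<in> cexpr \<Sigma> \<and> q \<in> cexpr \<Sigma> \<and> R \<subseteq> trans_from p \<times> trans_from q \<and>
     (\<forall>t \<in> trans_from p. \<exists>u. (t, u) \<in> R) \<and> (\<forall>u \<in> trans_from q. \<exists>t. (t, u) \<in> R) \<and>
     (\<forall>t u. (t, u) \<in> R \<longrightarrow> lab t = lab u)"

lemma matching_converse: "matching q p (R\<inverse>) \<longleftrightarrow> matching p q R"
  by (auto simp: matching_def)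

lemma matchingD:
  assumes "matching p q R" "t \<in> trans_from p"
  shows "\<exists>u \<in> trans_from q. (t, u) \<in> R \<and> lab u = lab t"
proof -
  obtain u where u: "(t, u) \<in> R" using assms unfolding matching_def by blast
  then have "u \<in> trans_from q" "lab t = lab u" using assms(1) unfolding matching_def by blast+
  with u show ?thesis by auto
qed

lemma constructor_op_rule:
  assumes "constructor Act T r n I" "Node m (Name r) (along I tf) \<in> Tr"
  obtains f g a q x y \<sigma> where "op_rule r f g a q x y" "n = length g" "I = trigger_set g"
    "\<And>z. \<sigma> z \<in> cexpr \<Sigma>"
    "\<And>i. i \<in> I \<Longrightarrow> tf i \<in> Tr \<and> src (tf i) = \<sigma> (x i) \<and>
       lab (tf i) = the (g ! i) \<and> tar (tf i) = \<sigma> (y i)"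
    "m = (POp f (map (\<lambda>i. \<sigma> (x i)) [0..<n]), a, psubst q (Some \<circ> \<sigma>))"
  using assms(2)
proof (cases rule: closed_Name)
  case *: (1 f g a q x y \<sigma> tf')
  have nI: "n = length g" "I = trigger_set g"
    using constructor_unique[OF assms(1) op_rule_constructor[OF *(1)]] by simp_all
  have e: "tf i = tf' i" if "i \<in> I" for i
    using *(3) that unfolding nI by simp
  show ?thesis
    by (rule that[OF *(1) nI *(2)]) (use *(4,5) e nI in simp_all)
qed

lemma lab_rec_applied [simp]: "lab (rec_applied Act c t) = lab t"
  by (simp add: rec_applied_def lab_def)

lemma src_rec_applied [simp]: "src (rec_applied Act c t) = c"
  by (simp add: rec_applied_def src_def)

lemma tar_rec_applied: "tar (rec_applied Act c t) = (if lab t \<in> Act then tar t else c)"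
  by (simp add: rec_applied_def tar_def)

lemma closed_rec1:
  assumes "Node m n [t] \<in> Tr" "\<forall>r. n \<noteq> Name r"
  shows "t \<in> Tr" "unfolds (fst m) (src t)" "Node m n [t] = rec_applied Act (fst m) t"
proof -
  from assms obtain c where *: "t \<in> Tr" "unfolds c (src t)"
    "Node m n [t] = rec_applied Act c t"
    using closed_rec[OF assms(1)] by blast
  from arg_cong[OF *(3), of src] have "c = fst m" by (simp add: src_def rec_applied_def)
  with * show "t \<in> Tr" "unfolds (fst m) (src t)" "Node m n [t] = rec_applied Act (fst m) t"
    by simp_all
qed

text \<open>Equal labels at the holes propagate upwards: equally labelled subtransitions fit the
  same trigger, so the same rule is applied at the root.\<close>

lemma ctx_rel_lab:
  assumes "\<And>k t u. (t, u) \<in> W k \<Longrightarrow> lab t = lab u"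
  shows "ctx_rel W p t u \<Longrightarrow> t \<in> Tr \<Longrightarrow> u \<in> Tr \<Longrightarrow> lab t = lab u"
proof (induction rule: ctx_rel.induct)
  case (Op r ps I tf uf f m m')
  from Op.hyps Op.prems(1) obtain f g a q x y \<sigma> where *: "op_rule r f g a q x y" "I = trigger_set g"
    "\<And>i. i \<in> I \<Longrightarrow> tf i \<in> Tr \<and> src (tf i) = \<sigma> (x i) \<and>
       lab (tf i) = the (g ! i) \<and> tar (tf i) = \<sigma> (y i)"
    "m = (POp f (map (\<lambda>i. \<sigma> (x i)) [0..<length ps]), a, psubst q (Some \<circ> \<sigma>))"
    by (rule constructor_op_rule) (rule that, assumption+)
  have u: "uf i \<in> Tr" if "i \<in> I" for i
    using Op.prems(2) that finite_constructor[OF Op.hyps] by (auto simp: closed_trans_Node)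
  have "lab (uf i) = the (g ! i)" if "i \<in> trigger_set g" for i
    using *(2) *(3)[of i] u[of i] bspec[OF Op.IH, of i] that by simp
  from closed_Name_at[OF *(1) Op.prems(2)[unfolded *(2)] this]
  have "fst (snd m') = a" by fastforce
  then show ?case using *(4) by (simp add: lab_def)
next
  case (Rec c p t u r r' m m')
  from closed_rec1[OF Rec.prems(1)] closed_rec1[OF Rec.prems(2)] Rec show ?case
    by (metis lab_rec_applied)
qed (use assms in blast)

lemma closed_trans_shape:
  assumes "t \<in> Tr"
  obtains (Name) m r ts where "t = Node m (Name r) ts" "\<exists>f ps. src t = POp f ps"
    | (rec) c t' where "t = rec_applied Act c t'" "t' \<in> Tr" "unfolds c (src t')" "src t = c"
proof (cases t)
  case (TVar tx m)
  then show ?thesis using assms by simp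
next
  case (Node m n ts)
  show ?thesis
  proof (cases "\<exists>r. n = Name r")
    case True
    then obtain r where n: "n = Name r" by blast
    from closed_Name[of m r ts] assms have "\<exists>f ps. fst m = POp f ps"
      unfolding Node n by (metis fst_conv)
    then show ?thesis using Name Node n by (simp add: src_def)
  next
    case False
    then obtain c t' where "t' \<in> Tr" "unfolds c (src t')" "t = rec_applied Act c t'"
      using closed_rec[of m n ts] assms Node by metis
    then show ?thesis using rec by simp
  qed
qed

text \<open>A closed context is not a variable, and a closed recursive call has an unfolding. The
  three cases are those of \<open>ctx_rel\<close>.\<close>

lemma cexpr_hole_cases:
  assumes "p \<in> cexpr \<Sigma>'"
  obtains (hole) k where "p = hole k"
    | (Op) f ps where "p = POp (Inl f) ps" "(f, length ps) \<in> \<Sigma>" "set ps \<subseteq> cexpr \<Sigma>'"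
    | (Rec) q where "recursive_call p" "unfolds p q" "q \<in> cexpr \<Sigma>'"
proof (cases p rule: pexp_cases)
  case (PVar x)
  then show ?thesis using assms by (simp add: cexpr_def)
next
  case (POp h ps)
  with assms have e: "(h, length ps) \<in> \<Sigma>'" "set ps \<subseteq> cexpr \<Sigma>'"
    by (auto simp: cexpr_def expr_POp_iff)
  show ?thesis
  proof (cases h)
    case (Inl f)
    then show ?thesis using Op POp e by (simp add: hole_sig_def)
  next
    case (Inr k)
    then show ?thesis using hole POp e by (simp add: hole_sig_def hole_def)
  qed
next
  case (PRec X S)
  then have r: "recursive_call p"
    using expr_recursive_call[OF _ PRec] assms unfolding cexpr_def by blast
  with assms obtain q where q: "unfolds p q" using unfolds_exists by (auto simp: cexpr_def)
  then have "q \<in> cexpr \<Sigma>'" using assms fv_unfolds expr_unfolds by (fastforce simp: cexpr_def)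
  with q r Rec show ?thesis by blast
qed

lemma fill_cexpr: "p \<in> cexpr \<Sigma>' \<Longrightarrow> (\<And>k. \<rho> k \<in> cexpr \<Sigma>) \<Longrightarrow> fill \<rho> p \<in> cexpr \<Sigma>"
  using fill_expr[of \<rho> p \<Sigma>] fv_fill[of \<rho> p] by (auto simp: cexpr_def)

text \<open>Induction on \<open>t\<close>, since the context may grow by unfolding. The equality of
  labels belongs to the claim: the partners of the subtransitions must satisfy the premises of the
  same rule.\<close>

lemma ctx_rel_total:
  assumes "\<And>k. \<rho> k \<in> cexpr \<Sigma>" "\<And>k. \<nu> k \<in> cexpr \<Sigma>"
    and W: "\<And>k t. t \<in> trans_from (\<rho> k) \<Longrightarrow> \<exists>u \<in> trans_from (\<nu> k). (t, u) \<in> W k \<and> lab u = lab t"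
  shows "t \<in> Tr \<Longrightarrow> p \<in> cexpr \<Sigma>' \<Longrightarrow> src t = fill \<rho> p \<Longrightarrow>
    \<exists>u \<in> trans_from (fill \<nu> p). ctx_rel W p t u \<and> lab u = lab t"
proof (induction t arbitrary: p)
  case (TVar tx m)
  then show ?case by simp
next
  case (Node m n ts)
  have cl: "fv (\<rho> k) = {}" "fv (\<nu> k) = {}" for k using assms(1,2) by (auto simp: cexpr_def)
  from Node.prems(2) show ?case
  proof (cases rule: cexpr_hole_cases)
    case (hole k)
    then show ?thesis using W[of "Node m n ts" k] Node.prems cl
      by (auto simp: trans_from_def fill_hole)
  next
    case (Op f ps)
    with Node.prems(3) have s: "fst m = POp f (map (fill \<rho>) ps)"
      by (simp add: src_def fill_POp cl)
    from Node.prems(1) obtain r where n: "n = Name r"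
    proof (cases rule: closed_trans_shape)
      case (rec c t')
      then show ?thesis using s unfolds_recursive_call[of c] by (auto simp: src_def rec_applied_def)
    qed auto
    from Node.prems(1)[unfolded n] show ?thesis
    proof (cases rule: closed_Name)
      case *: (1 f' g a q x y \<sigma> tf)
      let ?I = "trigger_set g"
      from s *(5) have f: "f' = f" and ml: "map (\<lambda>i. \<sigma> (x i)) [0..<length g] = map (fill \<rho>) ps"
        by (simp_all add: POp_eq_iff)
      have len: "length g = length ps" using arg_cong[OF ml, of length] by simp
      have sx: "\<sigma> (x i) = fill \<rho> (ps ! i)" if "i < length ps" for i
        using arg_cong[OF ml, of "\<lambda>l. l ! i"] that len by simp
      have I: "i < length ps" if "i \<in> ?I" for i using that trigger_sub[of g] len by auto
      have "\<exists>u \<in> trans_from (fill \<nu> (ps ! i)). ctx_rel W (ps ! i) (tf i) u \<and> lab u = lab (tf i)"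
        if i: "i \<in> ?I" for i
      proof (rule Node.IH)
        show "tf i \<in> set ts" using i *(3) by simp
        show "tf i \<in> Tr" "src (tf i) = fill \<rho> (ps ! i)" using *(4)[OF i] sx[OF I[OF i]] by simp_all
        show "ps ! i \<in> cexpr \<Sigma>'" using Op(3) I[OF i] nth_mem by blast
      qed
      then obtain uf where uf: "\<And>i. i \<in> ?I \<Longrightarrow> uf i \<in> trans_from (fill \<nu> (ps ! i)) \<and>
          ctx_rel W (ps ! i) (tf i) (uf i) \<and> lab (uf i) = lab (tf i)"
        by metis
      \<comment> \<open>The instance of the rule on the right: \<open>x i\<close> stands for the
        argument filled by \<open>\<nu>\<close>, \<open>y i\<close> for the target of the partner
        found by induction. \<open>fill \<nu> p\<close> is just a closed default.\<close>
      have "\<exists>\<sigma>'. (\<forall>i \<in> {..<length g}. \<sigma>' (x i) = fill \<nu> (ps ! i)) \<and> (\<forall>i \<in> ?I. \<sigma>' (y i) = tar (uf i)) \<and>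
          (\<forall>z. \<sigma>' z \<in> cexpr \<Sigma>)"
      proof (rule ex_env)
        show "inj_on x {..<length g}" "inj_on y ?I" "x ` {..<length g} \<inter> y ` ?I = {}"
          using *(1) by (simp_all add: op_rule_def)
        show "fill \<nu> (ps ! i) \<in> cexpr \<Sigma>" if "i \<in> {..<length g}" for i
          using that Op(3) len by (auto intro!: fill_cexpr assms(2))
        show "tar (uf i) \<in> cexpr \<Sigma>" if "i \<in> ?I" for i
          using uf[OF that] closed_trans_cexpr by (auto simp: trans_from_def)
        show "fill \<nu> p \<in> cexpr \<Sigma>" using Node.prems(2) by (auto intro!: fill_cexpr assms(2))
      qed
      then obtain \<sigma>' where s': "\<And>i. i < length g \<Longrightarrow> \<sigma>' (x i) = fill \<nu> (ps ! i)"
        "\<And>i. i \<in> ?I \<Longrightarrow> \<sigma>' (y i) = tar (uf i)" "\<And>z. \<sigma>' z \<in> cexpr \<Sigma>" by auto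
      let ?u = "Node (POp f (map (\<lambda>i. \<sigma>' (x i)) [0..<length g]), a, psubst q (Some \<circ> \<sigma>')) (Name r)
        (along ?I uf)"
      have "?u \<in> Tr"
        using *(1)[unfolded f] s'(3)
      proof (rule closed_NameI)
        show "uf i \<in> Tr \<and> src (uf i) = \<sigma>' (x i) \<and> lab (uf i) = the (g ! i) \<and> tar (uf i) = \<sigma>' (y i)"
          if "i \<in> ?I" for i
          using that uf[OF that] *(4)[OF that] s' I[OF that] len by (simp add: trans_from_def)
      qed
      moreover have "map (\<lambda>i. \<sigma>' (x i)) [0..<length g] = map (fill \<nu>) ps"
        using s'(1) len by (auto intro!: nth_equalityI)
      then have "src ?u = fill \<nu> p" using Op(1) cl by (simp add: src_def fill_POp)
      moreover have "ctx_rel W p (Node m n ts) ?u"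
        unfolding Op(1) n *(3)
        by (rule ctx_rel.Op) (use uf op_rule_constructor[OF *(1)] len in simp_all)
      moreover have "lab ?u = lab (Node m n ts)" using *(5) by (simp add: lab_def)
      ultimately show ?thesis by (auto simp: trans_from_def)
    qed
  next
    case (Rec q)
    have hr: "unfolds (fill \<rho> p) (fill \<rho> q)" "unfolds (fill \<nu> p) (fill \<nu> q)"
      using fill_unfolds[OF _ Rec(2)] cl by auto
    from Node.prems(1) obtain c t' where t': "Node m n ts = rec_applied Act c t'" "t' \<in> Tr"
      "unfolds c (src t')" "src (Node m n ts) = c"
    proof (cases rule: closed_trans_shape)
      case (Name m' r ts')
      then show ?thesis using hr(1) Node.prems(3) by (auto dest: unfolds_recursive_call)
    qed auto
    have "src t' = fill \<rho> q" using t'(3,4) Node.prems(3) hr(1) unfolds_unique by metis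
    moreover have "t' \<in> set ts" using t'(1) by (simp add: rec_applied_def)
    ultimately obtain u' where u': "u' \<in> trans_from (fill \<nu> q)" "ctx_rel W q t' u'" "lab u' = lab t'"
      using Node.IH[of t' q] t'(2) Rec(3) by blast
    let ?u = "rec_applied Act (fill \<nu> p) u'"
    have "?u \<in> Tr"
      by (rule closed_recI) (use u' hr(2) fill_cexpr[OF Node.prems(2) assms(2)] in \<open>simp_all add: trans_from_def\<close>)
    moreover have "ctx_rel W p (Node m n ts) ?u"
      unfolding t'(1) rec_applied_def
      by (rule ctx_rel.Rec[OF Rec(2) u'(2)]) (simp_all add: rec_name_def)
    moreover have "lab ?u = lab (Node m n ts)" using t'(1) u'(3) by simp
    ultimately show ?thesis by (auto simp: trans_from_def)
  qed
qed

lemma matching_ctx_trans: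
  assumes "p \<in> cexpr \<Sigma>'" and m: "\<And>k. matching (\<rho> k) (\<nu> k) (W k)"
  shows "matching (fill \<rho> p) (fill \<nu> p) (ctx_trans \<rho> \<nu> W p)"
proof -
  have c: "\<And>k. \<rho> k \<in> cexpr \<Sigma>" "\<And>k. \<nu> k \<in> cexpr \<Sigma>" using m by (auto simp: matching_def)
  have 1: "\<exists>u. (t, u) \<in> ctx_trans \<rho> \<nu> W p" if "t \<in> trans_from (fill \<rho> p)" for t
  proof -
    have "\<exists>u \<in> trans_from (fill \<nu> p). ctx_rel W p t u \<and> lab u = lab t"
      by (rule ctx_rel_total[OF c matchingD[OF m]])
        (use that assms(1) in \<open>simp_all add: trans_from_def\<close>)
    with that show ?thesis by (auto simp: ctx_trans_def)
  qed
  have 2: "\<exists>t. (t, u) \<in> ctx_trans \<rho> \<nu> W p" if "u \<in> trans_from (fill \<nu> p)" for u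
  proof -
    have "matching (\<nu> k) (\<rho> k) ((W k)\<inverse>)" for k using m by (simp add: matching_converse)
    then have "\<exists>t \<in> trans_from (fill \<rho> p). ctx_rel (\<lambda>k. (W k)\<inverse>) p u t \<and> lab t = lab u"
      by (rule ctx_rel_total[OF c(2,1) matchingD])
        (use that assms(1) in \<open>simp_all add: trans_from_def\<close>)
    with that show ?thesis by (auto simp: ctx_trans_def ctx_rel_converse)
  qed
  have 3: "lab t = lab u" if "(t, u) \<in> ctx_trans \<rho> \<nu> W p" for t u
    using that ctx_rel_lab[of W p t u] m by (auto simp: ctx_trans_def trans_from_def matching_def)
  show ?thesis
    unfolding matching_def using 1 2 3 fill_cexpr[OF assms(1) c(1)] fill_cexpr[OF assms(1) c(2)]
    by (auto simp: ctx_trans_def)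
qed

text \<open>A node obtained from a rule by \<open>\<sigma>'\<close> becomes one obtained by the
  composition of \<open>\<sigma>'\<close> with \<open>\<sigma>\<close>, so closed instances of
  derivations are derivations. This constructs the new transitions on the right-hand side.\<close>

lemma ex_tree_inst:
  assumes \<sigma>: "\<And>z. \<sigma> z \<in> cexpr \<Sigma>"
  shows "derivation T v \<Longrightarrow>
    (\<And>tx m. (tx, m) \<in> set (leaves v) \<Longrightarrow> \<exists>w \<in> Tr. \<tau> tx = Some w \<and> lit_inst (Some \<circ> \<sigma>) m (root w)) \<Longrightarrow>
    \<exists>v' \<in> Tr. tree_inst (Some \<circ> \<sigma>) \<tau> v v' \<and> lit_inst (Some \<circ> \<sigma>) (root v) (root v')"
proof (induction v rule: derivation.induct)
  case (1 m tx)
  then show ?case by (auto intro: tree_inst.intros)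
next
  case (2 H c r \<sigma>' ts m)
  have g: "ground (Some \<circ> \<sigma>)" using \<sigma> by (auto simp: ground_def cexpr_def)
  have e: "ran (Some \<circ> \<sigma>) \<subseteq> expr \<Sigma>" using \<sigma> by (auto simp: ran_def cexpr_def)
  have "\<forall>t \<in> set ts. \<exists>v'. v' \<in> Tr \<and> tree_inst (Some \<circ> \<sigma>) \<tau> t v' \<and> lit_inst (Some \<circ> \<sigma>) (root t) (root v')"
  proof
    fix t assume t: "t \<in> set ts"
    have "\<exists>w \<in> Tr. \<tau> tx = Some w \<and> lit_inst (Some \<circ> \<sigma>) k (root w)"
      if "(tx, k) \<in> set (leaves t)" for tx k
      by (rule "2.prems") (use t that in auto)
    with t "2.IH" show "\<exists>v'. v' \<in> Tr \<and> tree_inst (Some \<circ> \<sigma>) \<tau> t v' \<and> lit_inst (Some \<circ> \<sigma>) (root t) (root v')"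
      by blast
  qed
  from ex_list_all2[OF this] obtain ts' where ts': "list_all2 (\<lambda>t v'. v' \<in> Tr \<and>
     tree_inst (Some \<circ> \<sigma>) \<tau> t v' \<and> lit_inst (Some \<circ> \<sigma>) (root t) (root v')) ts ts'" by blast
  obtain p a q where m: "m = (p, a, q)" by (cases m)
  let ?m = "(psubst p (Some \<circ> \<sigma>), a, psubst q (Some \<circ> \<sigma>))"
  have mi: "lit_inst (Some \<circ> \<sigma>) m ?m" using g by (simp add: m subst_to_ground)
  have ok: "lit_ok \<Sigma> ?m" using 2(6) e g by (auto simp: m intro: expr_psubst)
  have lc: "lit_closed ?m" using g by (simp add: fv_psubst)
  have d: "derivation T (Node ?m r ts')"
  proof (rule derivation.intros(2)[OF 2(1,2)])
    show "is_subst \<Sigma> (scomp \<sigma>' (Some \<circ> \<sigma>))"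
      unfolding is_subst_def
    proof
      fix z assume "z \<in> ran (scomp \<sigma>' (Some \<circ> \<sigma>))"
      then obtain x where "scomp \<sigma>' (Some \<circ> \<sigma>) x = Some z" by (auto simp: ran_def)
      then show "z \<in> expr \<Sigma>" using 2(3) e g expr_psubst[OF _ g e]
        by (cases "\<sigma>' x") (auto simp: scomp_def is_subst_def ran_def)
    qed
    show "list_all2 (lit_inst (scomp \<sigma>' (Some \<circ> \<sigma>))) H (map root ts')"
      using 2(4) by (rule list_all2_scomp[OF _ _ g]) (use ts' in \<open>auto elim: list_all2_mono\<close>)
    show "lit_inst (scomp \<sigma>' (Some \<circ> \<sigma>)) c ?m" using 2(5) mi g by (rule lit_inst_scomp)
    show "\<forall>t \<in> set ts'. derivation T t"
      using ts' by (auto simp: list_all2_conv_all_nth in_set_conv_nth closed_trans_iff)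
  qed fact
  then have "Node ?m r ts' \<in> Tr"
    using lc ts' by (auto simp: closed_trans_Node list_all2_conv_all_nth in_set_conv_nth)
  moreover have "tree_inst (Some \<circ> \<sigma>) \<tau> (Node m r ts) (Node ?m r ts')"
    using mi by (rule tree_inst.intros(3)) (use ts' in \<open>auto elim: list_all2_mono\<close>)
  moreover have "lit_inst (Some \<circ> \<sigma>) (root (Node m r ts)) (root (Node ?m r ts'))" using mi by simp
  ultimately show ?case by blast
qed

lemma tree_inst_leaves:
  "tree_inst \<sigma> \<tau> v v' \<Longrightarrow> v' \<in> Tr \<Longrightarrow> (tx, k) \<in> set (leaves v) \<Longrightarrow>
    \<exists>w \<in> Tr. \<tau> tx = Some w"
proof (induction rule: tree_inst.induct)
  case (3 m m' ts ts' r)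
  from "3.prems"(2) obtain t where t: "t \<in> set ts" "(tx, k) \<in> set (leaves t)" by auto
  then obtain i where "i < length ts" "t = ts ! i" by (auto simp: in_set_conv_nth)
  moreover have "ts' ! i \<in> Tr" if "i < length ts'" for i
    using "3.prems"(1) that unfolding closed_trans_Node by auto
  ultimately show ?case using 3(2) t by (auto simp: list_all2_conv_all_nth)
qed auto

text \<open>The open transition \<open>v\<close> prescribes the rules that both instances apply, so
  they can differ only below its leaves. This yields the correspondence between the results of two
  instances of one successor rule.\<close>

lemma ctx_rel_tree_inst:
  "derivation T v \<Longrightarrow> tree_inst \<sigma> \<tau> v v1 \<Longrightarrow> v1 \<in> Tr \<Longrightarrow>
    tree_inst \<sigma>' \<tau>' v v2 \<Longrightarrow> v2 \<in> Tr \<Longrightarrow>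
    (\<And>tx m w1 w2. (tx, m) \<in> set (leaves v) \<Longrightarrow> \<tau> tx = Some w1 \<Longrightarrow> \<tau>' tx = Some w2 \<Longrightarrow>
       ctx_rel W (ctx_of (fst m)) w1 w2) \<Longrightarrow>
    ctx_rel W (ctx_of (src v)) v1 v2"
proof (induction v arbitrary: v1 v2)
  case (TVar tx m)
  from TVar.prems(2,3) have "\<tau> tx = Some v1" by (auto elim: tree_inst_TVarE)
  moreover from TVar.prems(4,5) have "\<tau>' tx = Some v2" by (auto elim: tree_inst_TVarE)
  ultimately show ?case using TVar.prems(6) by (simp add: src_def)
next
  case (Node m n ts)
  from Node.prems(2) obtain m1 ts1 where v1: "v1 = Node m1 n ts1" "list_all2 (tree_inst \<sigma> \<tau>) ts ts1"
    by (rule tree_inst_NodeE) blast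
  from Node.prems(4) obtain m2 ts2 where v2: "v2 = Node m2 n ts2" "list_all2 (tree_inst \<sigma>' \<tau>') ts ts2"
    by (rule tree_inst_NodeE) blast
  have c1: "set ts1 \<subseteq> Tr" and c2: "set ts2 \<subseteq> Tr"
    using Node.prems(3,5) by (simp_all add: v1 v2 closed_trans_Node)
  have IH: "ctx_rel W (ctx_of (src (ts ! i))) (ts1 ! i) (ts2 ! i)"
    if i: "i < length ts" "derivation T (ts ! i)" for i
  proof (rule Node.IH)
    have l: "length ts1 = length ts" "length ts2 = length ts"
      using v1(2) v2(2) by (simp_all add: list_all2_conv_all_nth)
    show "ts ! i \<in> set ts" using i(1) by simp
    show "derivation T (ts ! i)" by fact
    show "tree_inst \<sigma> \<tau> (ts ! i) (ts1 ! i)" "tree_inst \<sigma>' \<tau>' (ts ! i) (ts2 ! i)"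
      using v1(2) v2(2) i(1) by (simp_all add: list_all2_conv_all_nth)
    show "ts1 ! i \<in> Tr" "ts2 ! i \<in> Tr"
      using c1 c2 l i(1) by (simp_all add: subset_iff)
    fix tx k w1 w2 assume "(tx, k) \<in> set (leaves (ts ! i))" "\<tau> tx = Some w1" "\<tau>' tx = Some w2"
    then show "ctx_rel W (ctx_of (fst k)) w1 w2"
      by (intro Node.prems(6)) (use i(1) in auto)
  qed
  show ?case
  proof (cases "\<exists>r. n = Name r")
    case True
    then obtain r where n: "n = Name r" by blast
    from Node.prems(1)[unfolded n] show ?thesis
    proof (cases rule: derivation_Name)
      case *: (1 f g a q x y \<sigma>r tf q')
      let ?L = "sorted_list_of_set (trigger_set g)"
      have "length ts1 = length ?L" "length ts2 = length ?L"
        using *(3) v1(2) v2(2) by (simp_all add: list_all2_conv_all_nth)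
      then obtain tf1 tf2 where tf: "ts1 = map tf1 ?L" "ts2 = map tf2 ?L"
        using ex_map[OF distinct_sorted_list_of_set] by metis
      have r: "ctx_rel W (ctx_of (sapp \<sigma>r (x i))) (tf1 i) (tf2 i)" if i: "i \<in> trigger_set g" for i
      proof -
        from i have "i \<in> set ?L" by simp
        then obtain k where k: "k < length ?L" "?L ! k = i" unfolding in_set_conv_nth by blast
        then show ?thesis using IH[of k] *(3) *(4)[OF i] tf by simp
      qed
      have "src (Node m n ts) = POp f (map (\<lambda>i. sapp \<sigma>r (x i)) [0..<length g])"
        using *(6) by (simp add: src_def)
      then show ?thesis
        unfolding v1 v2 n tf
        by (simp only: ctx_of_POp)
         (rule ctx_rel.Op, use r op_rule_constructor[OF *(1)] trigger_sub[of g] in \<open>auto simp: subset_iff\<close>)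
    qed
  next
    case False
    then have "\<And>r. n \<noteq> Name r" by blast
    with Node.prems(1) show ?thesis
    proof (cases rule: derivation_rec)
      case *: (1 c p y \<sigma>r c' t)
      from arg_cong[OF *(9), of src] have s: "src (Node m n ts) = c'" by simp
      from *(5) v1(2) v2(2) obtain t1 t2 where t12: "ts1 = [t1]" "ts2 = [t2]"
        by (auto simp: list_all2_Cons1)
      have "ctx_rel W (ctx_of (src t)) t1 t2" using IH[of 0] *(5,6) t12 by simp
      then show ?thesis
        unfolding s v1 v2 t12
        \<comment> \<open>The unfolding is taken at the level of contexts, where it is available
          although \<open>c'\<close> may be open.\<close>
        by (rule ctx_rel.Rec[OF ctx_of_unfolds[OF *(2,7,8)]]) (use False in auto)
    qed
  qed
qed

text \<open>A closed expression and all its unfoldings are free of holes, so a derivation of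
  \<open>ctx_rel\<close> never reaches a point at which \<open>W\<close> is consulted.\<close>

lemma ctx_rel_embed:
  "ctx_rel W p t u \<Longrightarrow> p = embed q \<Longrightarrow> fv q = {} \<Longrightarrow> q \<in> expr \<Sigma> \<Longrightarrow> ctx_rel W' p t u"
proof (induction arbitrary: q rule: ctx_rel.induct)
  case (hole t u k)
  then show ?case
    by (cases q rule: pexp_cases) (simp_all add: hole_def embed_POp embed_PRec POp_eq_iff)
next
  case (Op r ps I tf uf f m m')
  show ?case
  proof (cases q rule: pexp_cases)
    case (POp f' qs)
    with Op.prems have ps: "ps = map embed qs" by (simp add: embed_POp POp_eq_iff)
    have "ctx_rel W' (ps ! i) (tf i) (uf i)" if i: "i \<in> I" for i
    proof -
      have "i < length ps" using constructor_sub[OF Op.hyps] i by blast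
      then have "ps ! i = embed (qs ! i)" "qs ! i \<in> set qs" using ps by simp_all
      then show ?thesis using Op.IH i Op.prems(2,3) unfolding POp by (auto simp: expr_POp_iff)
    qed
    with Op.hyps show ?thesis by (blast intro: ctx_rel.Op)
  qed (use Op.prems in \<open>simp_all add: embed_PRec\<close>)
next
  case (Rec c p t u r r' m m')
  have "\<not> recursive_call (embed q)" if "\<not> recursive_call q"
    using that Rec.prems(3) by (cases q rule: pexp_cases) (auto simp: embed_POp dest: expr_recursive_call)
  then have "recursive_call q" using unfolds_recursive_call[OF Rec.hyps(1)] Rec.prems(1) by blast
  then obtain q' where q': "unfolds q q'" using unfolds_exists Rec.prems(2) by blast
  have "p = embed q'" using embed_unfolds[OF q'] Rec.hyps(1) Rec.prems(1) unfolds_unique by blast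
  moreover have "fv q' = {}" "q' \<in> expr \<Sigma>"
    using q' fv_unfolds expr_unfolds Rec.prems by blast+
  ultimately have "ctx_rel W' p t u" by (rule Rec.IH)
  then show ?case using Rec.hyps by (intro ctx_rel.Rec)
qed

text \<open>The context of \<open>q'\<close> refines that of \<open>q\<close>: whatever it
  prescribes below the occurrence of a variable \<open>z\<close> is delegated to
  \<open>W' z\<close>. Structural induction on \<open>q\<close> suffices because recursive calls in
  \<open>q\<close> are closed; they contain no holes, and \<open>ctx_rel_embed\<close>
  applies.\<close>

lemma ctx_rel_subst:
  assumes "q \<in> expr \<Sigma>"
  shows "(\<And>c. subexp c q \<Longrightarrow> recursive_call c \<Longrightarrow> fv c = {}) \<Longrightarrow> subst_to \<sigma> q q' \<Longrightarrow>
    ctx_rel W (ctx_of q') t u \<Longrightarrow>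
    (\<And>z t u. z \<in> fv q \<Longrightarrow> ctx_rel W (ctx_of (sapp \<sigma> z)) t u \<Longrightarrow> (t, u) \<in> W' z) \<Longrightarrow> ctx_rel W' (ctx_of q) t u"
  using assms
proof (induction q arbitrary: q' t u rule: expr.induct)
  case (1 x)
  then show ?case by (simp add: subst_to_PVar)
next
  case (2 f ps)
  from "2.prems"(2) obtain qs where q': "q' = POp f qs" "list_all2 (subst_to \<sigma>) ps qs"
    by (auto simp: subst_to_POp_iff)
  have len: "length qs = length ps" using q'(2) list_all2_lengthD by fastforce
  from "2.prems"(3) have "ctx_rel W (POp (Inl f) (map ctx_of qs)) t u" by (simp add: q' ctx_of_POp)
  then show ?case
  proof (rule ctx_rel_POp)
    fix m m' r I tf uf
    assume *: "constructor Act T r (length (map ctx_of qs)) I"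
      "t = Node m (Name r) (along I tf)"
      "u = Node m' (Name r) (along I uf)"
      "\<And>i. i \<in> I \<Longrightarrow> ctx_rel W (map ctx_of qs ! i) (tf i) (uf i)"
    have "ctx_rel W' (ctx_of (ps ! i)) (tf i) (uf i)" if i: "i \<in> I" for i
    proof -
      have l: "i < length ps" using constructor_sub[OF *(1)] i len by auto
      then have m: "ps ! i \<in> set ps" by simp
      show ?thesis
      proof (rule bspec[OF "2.IH" m, THEN conjunct2, rule_format])
        show "fv c = {}" if "subexp c (ps ! i)" "recursive_call c" for c
          using "2.prems"(1) m that by (blast intro: subexp.intros)
        show "subst_to \<sigma> (ps ! i) (qs ! i)" using q'(2) l by (simp add: list_all2_conv_all_nth)
        show "ctx_rel W (ctx_of (qs ! i)) (tf i) (uf i)" using *(4)[OF i] l len by simp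
        show "(t, u) \<in> W' z" if "z \<in> fv (ps ! i)" "ctx_rel W (ctx_of (sapp \<sigma> z)) t u" for z t u
          using "2.prems"(4) m that by auto
      qed
    qed
    then show ?thesis
      unfolding ctx_of_POp *(2,3)
      by (intro ctx_rel.Op) (use *(1) len constructor_sub[OF *(1)] in auto)
  qed
next
  case (3 X S)
  have e: "PRec X S \<in> expr \<Sigma>" using 3(1,2) by (auto simp: expr_PRec_iff ran_def)
  have c: "fv (PRec X S) = {}"
    using "3.prems"(1) 3(1) by (auto simp: recursive_call_def intro: subexp.intros)
  then have "q' = PRec X S" using "3.prems"(2) by (simp add: subst_to_disjoint)
  then have "ctx_rel W (embed (PRec X S)) t u" using "3.prems"(3) c by (simp add: ctx_of_closed)
  then have "ctx_rel W' (embed (PRec X S)) t u" using ctx_rel_embed c e by blast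
  then show ?case using c by (simp add: ctx_of_closed)
qed


section \<open>Successors\<close>

lemma open_trans_closed: "t \<in> Tr \<Longrightarrow> open_trans T t"
  by (simp add: closed_trans_def)

lemma tree_inst_var_leafD:
  "tree_inst \<sigma> \<tau> (var_leaf w p a q) t \<Longrightarrow> t \<in> Tr \<Longrightarrow> \<tau> w = Some t"
  unfolding var_leaf_def by (auto elim: tree_inst_TVarE)

lemma applied_shape:
  assumes "applied Act T r (map (\<lambda>i. if i \<in> A then Inr (X i) else Inl (E i)) [0..<n]) t" "A \<subseteq> {..<n}"
  obtains f a q where "constructor Act T r n A" "derivation T t"
    "t = Node (POp f (map (\<lambda>i. if i \<in> A then src (X i) else E i) [0..<n]), a, q) (Name r)
       (along A X)"
proof -
  let ?es = "map (\<lambda>i. if i \<in> A then Inr (X i) else Inl (E i)) [0..<n]"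
  have c: "constructor Act T r (length ?es) {i. i < length ?es \<and> \<not> isl (?es ! i)}" and d: "derivation T t"
    and e: "\<exists>f a q. t = Node (POp f (map (case_sum id src) ?es), a, q) (Name r) [u. Inr u \<leftarrow> ?es]"
    using assms(1) unfolding applied_def open_trans_def by blast+
  have "{i. i < length ?es \<and> \<not> isl (?es ! i)} = A" using assms(2) by (auto split: if_splits)
  with c have c': "constructor Act T r n A" by simp
  have e1: "map (case_sum id src) ?es = map (\<lambda>i. if i \<in> A then src (X i) else E i) [0..<n]" by auto
  have e2: "[u. Inr u \<leftarrow> ?es] = along A X"
    unfolding sorted_list_of_set_filter[OF assms(2), symmetric] by (rule concat_Inr)
  from e obtain f a q where "t = Node (POp f (map (case_sum id src) ?es), a, q) (Name r) [u. Inr u \<leftarrow> ?es]"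
    by (elim exE)
  from this[unfolded e1 e2] show ?thesis by (rule that[OF c' d])
qed

lemma succD:
  assumes "succ T (t, u, v)"
  shows "t \<in> Tr" "u \<in> Tr" "v \<in> Tr" "src t = src u" "src v = tar u"
  using assms by (cases; simp)+

lemma srule_cases:
  assumes "ru \<in> srules T"
  obtains (rec) c p xa ya za x' y' z' tx ty tz where "c \<in> expr \<Sigma>" "unfolds c p"
      "rec_srule_vars c x' y' z' tx ty tz" "ru = rec_srule Act c p xa ya za x' y' z' tx ty tz"
    | (ds) "ds_srule Act T ru"
proof -
  have "\<forall>ru \<in> srules T.
        (\<exists>c \<in> expr (signature T). \<exists>p xa ya za x' y' z' tx ty tz.
           unfolds c p \<and> rec_srule_vars c x' y' z' tx ty tz \<and>
           ru = rec_srule Act c p xa ya za x' y' z' tx ty tz) \<or>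
        ds_srule Act T ru"
    using de_simone unfolding de_simone_tsss_def by (elim conjE)
  from bspec[OF this assms] that show ?thesis by blast
qed

lemma ds_sruleE:
  assumes "ds_srule Act T ru"
  obtains n I A B x x' y' z' xa ya za tx ty tz r s f a q f' a' q' v where
    "ru = (along I (\<lambda>i. (var_leaf (tx i) (x i) (xa i) (x' i), var_leaf (ty i) (x i) (ya i) (y' i), var_leaf (tz i) (y' i) (za i) (z' i))),
       (Node (POp f (map (\<lambda>i. PVar (x i)) [0..<n]), a, q) (Name r)
          (along A (\<lambda>i. var_leaf (tx i) (x i) (xa i) (x' i))),
        Node (POp f' (map (\<lambda>i. PVar (x i)) [0..<n]), a', q') (Name s)
          (along B (\<lambda>i. var_leaf (ty i) (x i) (ya i) (y' i))), v))"
    "constructor Act T r n A" "constructor Act T s n B" "I \<subseteq> A" "I \<subseteq> B"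
    "distinct (map x [0..<n] @ map x' [0..<n] @ map y' [0..<n] @ map z' [0..<n])"
    "distinct (map tx [0..<n] @ map ty [0..<n] @ map tz [0..<n])"
    "derivation T (Node (POp f (map (\<lambda>i. PVar (x i)) [0..<n]), a, q) (Name r)
          (along A (\<lambda>i. var_leaf (tx i) (x i) (xa i) (x' i))))"
    "derivation T (Node (POp f' (map (\<lambda>i. PVar (x i)) [0..<n]), a', q') (Name s)
          (along B (\<lambda>i. var_leaf (ty i) (x i) (ya i) (y' i))))"
    "derivation T v" "src v = q'"
    "\<And>l. l \<in> set (leaves v) \<Longrightarrow> (\<exists>i < n. i \<notin> A \<and> i \<notin> B \<and> l = (tz i, (PVar (x i), za i, PVar (z' i)))) \<or>
       (\<exists>i \<in> A. i \<notin> B \<and> l = (tx i, (PVar (x i), xa i, PVar (x' i)))) \<or>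
       (\<exists>i \<in> B. l = (tz i, (PVar (y' i), za i, PVar (z' i))))"
proof -
  from assms obtain n I A B x x' y' z' xa ya za tx ty tz r s t u v X Y Z Z0 xe ye where
    X: "X = (\<lambda>i. TVar (tx i) (PVar (x i), xa i, PVar (x' i)))" and
    Y: "Y = (\<lambda>i. TVar (ty i) (PVar (x i), ya i, PVar (y' i)))" and
    Z: "Z = (\<lambda>i. TVar (tz i) (PVar (y' i), za i, PVar (z' i)))" and
    Z0: "Z0 = (\<lambda>i. (tz i, (PVar (x i), za i, PVar (z' i))))" and
    xe: "xe = (\<lambda>i. if i \<in> A then Inr (X i) else Inl (PVar (x i)))" and
    ye: "ye = (\<lambda>i. if i \<in> B then Inr (Y i) else Inl (PVar (x i)))" and
    ru: "ru = (along I (\<lambda>i. (X i, Y i, Z i)), (t, u, v))" and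
    s: "A \<subseteq> {..<n}" "B \<subseteq> {..<n}" "I \<subseteq> A \<inter> B" and
    d: "distinct (map x [0..<n] @ map x' [0..<n] @ map y' [0..<n] @ map z' [0..<n])"
      "distinct (map tx [0..<n] @ map ty [0..<n] @ map tz [0..<n])" and
    t: "applied Act T r (map xe [0..<n]) t" and
    u: "applied Act T s (map ye [0..<n]) u" and
    v: "open_trans T v" "src t = src u" "src v = tar u"
      "univariate_trans Act T v"
      "proc_vars Act T v \<subseteq> x ` ({..<n} - A - B) \<union> y' ` (B - I)" and
    l: "set (leaves v) \<subseteq> Z0 ` ({..<n} - A - B) \<union>
         (\<Union>i \<in> A - B. set (leaves (X i))) \<union> (\<Union>i \<in> B. set (leaves (Z i)))"
      "lab u \<notin> Act \<longrightarrow>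
          (\<forall>i \<in> I. ya i \<notin> Act) \<and> A \<inter> B \<subseteq> I \<and>
          applied Act T r (map (\<lambda>i. if i \<in> I then Inr (Z i)
            else if i \<notin> B then xe i else Inl (PVar (y' i))) [0..<n]) v"
    unfolding ds_srule_def by (elim exE conjE) (rule that)
  from t[unfolded xe] s(1) obtain f a q where t': "constructor Act T r n A" "derivation T t"
    "t = Node (POp f (map (\<lambda>i. if i \<in> A then src (X i) else PVar (x i)) [0..<n]), a, q)
       (Name r) (along A X)"
    by (rule applied_shape)
  from u[unfolded ye] s(2) obtain f' a' q' where u': "constructor Act T s n B" "derivation T u"
    "u = Node (POp f' (map (\<lambda>i. if i \<in> B then src (Y i) else PVar (x i)) [0..<n]), a', q')
       (Name s) (along B Y)"
    by (rule applied_shape)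
  \<comment> \<open>Leaves and plain arguments alike have source \<open>PVar (x i)\<close>, so both
    transitions of the conclusion have the same list of arguments.\<close>
  have e: "(\<lambda>i. if i \<in> A then src (X i) else PVar (x i)) = (\<lambda>i. PVar (x i))"
     "(\<lambda>i. if i \<in> B then src (Y i) else PVar (x i)) = (\<lambda>i. PVar (x i))"
    by (auto simp: src_def X Y)
  have XYZ: "X = (\<lambda>i. var_leaf (tx i) (x i) (xa i) (x' i))" "Y = (\<lambda>i. var_leaf (ty i) (x i) (ya i) (y' i))"
    "Z = (\<lambda>i. var_leaf (tz i) (y' i) (za i) (z' i))"
    unfolding X Y Z var_leaf_def by simp_all
  note t'' = t'(3)[unfolded e, unfolded XYZ] and u'' = u'(3)[unfolded e, unfolded XYZ]
  show ?thesis
  proof (rule that[OF ru[unfolded t'' u'' XYZ] t'(1) u'(1) _ _ d t'(2)[unfolded t''] u'(2)[unfolded u'']])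
    show "I \<subseteq> A" "I \<subseteq> B" "derivation T v" "src v = q'"
      using s(3) v(1,3) by (simp_all add: open_trans_def u'' tar_def)
    show "(\<exists>i < n. i \<notin> A \<and> i \<notin> B \<and> l = (tz i, (PVar (x i), za i, PVar (z' i)))) \<or>
       (\<exists>i \<in> A. i \<notin> B \<and> l = (tx i, (PVar (x i), xa i, PVar (x' i)))) \<or>
       (\<exists>i \<in> B. l = (tz i, (PVar (y' i), za i, PVar (z' i))))" if "l \<in> set (leaves v)" for l
      using subsetD[OF l(1) that] unfolding XYZ Z0 leaves_var_leaf by auto
  qed
qed

section \<open>Successors of transitions of a recursive call\<close>

lemma succ_rec:
  assumes "succ T (rec_applied Act c t1, rec_applied Act c' v1, t')"
    and t1: "t1 \<in> Tr" and v1: "v1 \<in> Tr"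
  obtains t1' where "succ T (t1, v1, t1')" "t' = (if lab v1 \<in> Act then t1' else rec_applied Act c t1)"
  using assms(1)
proof cases
  case (1 H l \<sigma> \<tau> H')
  from 1(1) show ?thesis
  proof (cases rule: srule_cases)
    case (rec d p xa ya za x' y' z' tx ty tz)
    let ?X = "TVar tx (p, xa, PVar x')" and ?Y = "TVar ty (p, ya, PVar y')" and ?Z = "TVar tz (PVar y', za, PVar z')"
    from rec(4) have H: "H = [(?X, ?Y, ?Z)]" and l: "l = (rec_applied Act d ?X, rec_applied Act d ?Y,
           if ya \<in> Act then ?Z else rec_applied Act d ?X)"
      by (simp_all add: rec_srule_def Let_def)
    from 1(4) obtain a b e where H': "H' = [(a, b, e)]" "tree_inst \<sigma> \<tau> ?X a" "tree_inst \<sigma> \<tau> ?Y b"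
      "tree_inst \<sigma> \<tau> ?Z e" unfolding H by (auto simp: list_all2_Cons1)
    from 1(10) H' have s: "succ T (a, b, e)" by simp
    from 1(5) have ti: "tree_inst \<sigma> \<tau> (rec_applied Act d ?X) (rec_applied Act c t1)"
      "tree_inst \<sigma> \<tau> (rec_applied Act d ?Y) (rec_applied Act c' v1)"
      "tree_inst \<sigma> \<tau> (if ya \<in> Act then ?Z else rec_applied Act d ?X) t'"
      and m: "matches \<sigma> \<tau> (rec_applied Act d ?Y)"
      by (simp_all add: l)
    \<comment> \<open>\<open>tx\<close> and \<open>ty\<close> occur in the premise and in the
      conclusion, so the premise was derived for \<open>t1\<close> and \<open>v1\<close>
      themselves.\<close>
    from ti(1) have "tree_inst \<sigma> \<tau> ?X t1" by (auto simp: rec_applied_def elim: tree_inst_NodeE)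
    then have a: "a = t1" using H'(2) tree_inst_unique by blast
    from ti(2) have "tree_inst \<sigma> \<tau> ?Y v1" by (auto simp: rec_applied_def elim: tree_inst_NodeE)
    then have b: "b = v1" using H'(3) tree_inst_unique by blast
    have ya: "lab v1 = ya"
      using tree_inst_root[OF ti(2) m] unfolding lit_inst_root lab_rec_applied by (simp add: lab_def)
    have "t' = (if lab v1 \<in> Act then e else rec_applied Act c t1)"
      unfolding ya using ti(1,3) H'(4) by (auto dest: tree_inst_unique split: if_splits)
    then show ?thesis using that s a b by blast
  next
    case ds
    then have "\<exists>m r ts u v. l = (Node m (Name r) ts, u, v)" by (rule ds_sruleE) blast
    \<comment> \<open>The remaining successor rules have a constructor name at the root, which
      differs from both recursion names.\<close>
    then obtain m r ts u v where l: "l = (Node m (Name r) ts, u, v)" by blast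
    from 1(5) have "tree_inst \<sigma> \<tau> (Node m (Name r) ts) (rec_applied Act c t1)" by (simp add: l)
    then show ?thesis by (auto simp: rec_applied_def rec_name_def elim: tree_inst_NodeE split: if_splits)
  qed
qed

lemma succ_recI:
  assumes c: "c \<in> cexpr \<Sigma>" "unfolds c p" and t1: "src t1 = p" and s: "succ T (t1, v1, t1')"
  shows "succ T (rec_applied Act c t1, rec_applied Act c v1, if lab v1 \<in> Act then t1' else rec_applied Act c t1)"
proof -
  have fc: "fv c = {}" "c \<in> expr \<Sigma>" using c(1) by (auto simp: cexpr_def)
  \<comment> \<open>The format supplies the rule only if three distinct variables not free in
    \<open>c\<close> exist. As \<open>c\<close> is closed, any three will do.\<close>
  obtain x0 where "x0 \<notin> ({} :: 'v set)" by blast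
  obtain x1 where x1: "x1 \<notin> {x0}" using ex_new_if_finite[OF infinite_vars, of "{x0}"] by blast
  obtain x2 where x2: "x2 \<notin> {x0, x1}" using ex_new_if_finite[OF infinite_vars, of "{x0, x1}"] by blast
  have ex: "\<exists>x' y' z'. distinct [x', y', z'] \<and> {x', y', z'} \<inter> fv c = {}"
    by (rule exI[of _ x0], rule exI[of _ x1], rule exI[of _ x2]) (use x1 x2 fc in auto)
  have "\<forall>c \<in> expr (signature T). \<forall>p xa ya za. unfolds c p \<longrightarrow>
        (\<exists>x' y' z'. distinct [x', y', z'] \<and> {x', y', z'} \<inter> fv c = {}) \<longrightarrow>
        (\<exists>x' y' z' tx ty tz. rec_srule_vars c x' y' z' tx ty tz \<and>
           rec_srule Act c p xa ya za x' y' z' tx ty tz \<in> srules T)"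
    using de_simone unfolding de_simone_tsss_def by (elim conjE)
  note R = bspec[OF this fc(2), THEN spec, THEN spec, THEN spec, THEN spec, THEN mp, OF c(2), THEN mp, OF ex]
  obtain x' y' z' tx ty tz where
    v: "rec_srule_vars c x' y' z' tx ty tz"
    and ru: "rec_srule Act c p (lab t1) (lab v1) (lab t1') x' y' z' tx ty tz \<in> srules T"
    by (rule exE[OF R[of "lab t1" "lab v1" "lab t1'"]], elim exE conjE) (rule that)
  note cl = succD[OF s]
  have fp: "fv p = {}" using fv_unfolds[OF c(2)] fc by simp
  have sv: "src v1 = p" using cl(4) t1 by simp
  let ?X = "TVar tx (p, lab t1, PVar x')" and ?Y = "TVar ty (p, lab v1, PVar y')"
    and ?Z = "TVar tz (PVar y', lab t1', PVar z')"
  let ?\<sigma> = "[x' \<mapsto> tar t1, y' \<mapsto> tar v1, z' \<mapsto> tar t1']"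
  let ?\<tau> = "[tx \<mapsto> t1, ty \<mapsto> v1, tz \<mapsto> t1']"
  have dx: "x' \<noteq> y'" "x' \<noteq> z'" "y' \<noteq> z'" and dt: "tx \<noteq> ty" "tx \<noteq> tz" "ty \<noteq> tz"
    using v by (auto simp: rec_srule_vars_def)
  have root: "root t = (src t, lab t, tar t)" for t :: "('v, 'w, 'o, 'l, 'n) otree"
    by (simp add: src_def lab_def tar_def)
  have cs: "subst_to ?\<sigma> c c" "subst_to ?\<sigma> p p" using fc fp by (simp_all add: subst_to_disjoint)
  have ti: "tree_inst ?\<sigma> ?\<tau> ?X t1" "tree_inst ?\<sigma> ?\<tau> ?Y v1" "tree_inst ?\<sigma> ?\<tau> ?Z t1'"
    using dt by (auto intro!: tree_inst.intros(1))
  have m: "matches ?\<sigma> ?\<tau> ?X" "matches ?\<sigma> ?\<tau> ?Y" "matches ?\<sigma> ?\<tau> ?Z"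
    using dx dt cs t1 sv cl by (auto simp: matches_def root subst_to_PVar sapp_def)
  have mr: "matches ?\<sigma> ?\<tau> (rec_applied Act c ?X)" "matches ?\<sigma> ?\<tau> (rec_applied Act c ?Y)"
    using m by (simp_all add: matches_def rec_applied_def)
  have tr: "tree_inst ?\<sigma> ?\<tau> (rec_applied Act c ?X) (rec_applied Act c t1)"
    "tree_inst ?\<sigma> ?\<tau> (rec_applied Act c ?Y) (rec_applied Act c v1)"
    using ti cs dx
    by (auto intro!: tree_inst_rec_applied simp: lab_def tar_def subst_to_PVar sapp_def)
  have ct: "rec_applied Act c t1 \<in> Tr" "rec_applied Act c v1 \<in> Tr"
    by (intro closed_recI; simp add: c t1 sv cl(1,2))+
  show ?thesis
  proof (rule succ.intros[OF ru[unfolded rec_srule_def Let_def]])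
    show "is_subst \<Sigma> ?\<sigma>" using closed_trans_cexpr cl by (auto simp: is_subst_def cexpr_def ran_def)
    show "is_tsubst T ?\<tau>" using open_trans_closed cl by (auto simp: is_tsubst_def ran_def)
    show "list_all2 (slit_inst ?\<sigma> ?\<tau>) [(?X, ?Y, ?Z)] [(t1, v1, t1')]" using ti m by simp
    show "slit_inst ?\<sigma> ?\<tau> (rec_applied Act c ?X, rec_applied Act c ?Y, if lab v1 \<in> Act then ?Z else rec_applied Act c ?X)
      (rec_applied Act c t1, rec_applied Act c v1, if lab v1 \<in> Act then t1' else rec_applied Act c t1)"
      using tr mr m ti by simp
    show "is_slit T (rec_applied Act c t1, rec_applied Act c v1, if lab v1 \<in> Act then t1' else rec_applied Act c t1)"
      using ct cl by (simp add: tar_rec_applied open_trans_closed)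
    show "\<forall>s \<in> set [(t1, v1, t1')]. succ T s" using s by simp
  qed (use ct cl in simp_all)
qed

text \<open>The labels of \<open>ts\<close> complete the name to a rule; the source and the targets
  of \<open>ts\<close> then fix the values of all variables that can occur in its target.\<close>

lemma closed_Name_unique:
  assumes "Node m (Name r) ts \<in> Tr" "Node m' (Name r) ts \<in> Tr" "fst m = fst m'"
  shows "m = m'"
  using assms(1)
proof (cases rule: closed_Name)
  case *: (1 f g a q x y \<sigma> tf)
  show ?thesis
  proof (rule closed_Name_at[OF *(1) assms(2)[unfolded *(3)]])
    show "lab (tf i) = the (g ! i)" if "i \<in> trigger_set g" for i using *(4)[OF that] by simp
  next
    fix \<sigma>'
    assume 1: "\<And>z. \<sigma>' z \<in> cexpr \<Sigma>"
      "\<And>i. i \<in> trigger_set g \<Longrightarrow> tf i \<in> Tr \<and> src (tf i) = \<sigma>' (x i) \<and> tar (tf i) = \<sigma>' (y i)"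
      "m' = (POp f (map (\<lambda>i. \<sigma>' (x i)) [0..<length g]), a, psubst q (Some \<circ> \<sigma>'))"
    have x: "\<sigma> (x i) = \<sigma>' (x i)" if "i < length g" for i
      using assms(3) *(5) 1(3) that by (simp add: POp_eq_iff)
    have y: "\<sigma> (y i) = \<sigma>' (y i)" if "i \<in> trigger_set g" for i using *(4)[OF that] 1(2)[OF that] by simp
    have "psubst q (Some \<circ> \<sigma>) = psubst q (Some \<circ> \<sigma>')"
    proof (rule psubst_cong)
      show "ground (Some \<circ> \<sigma>)" using *(2) by (auto simp: ground_def cexpr_def)
      fix z assume "z \<in> fv q"
      then have "z \<in> x ` {..<length g} \<or> z \<in> y ` trigger_set g" using *(1) unfolding op_rule_def by blast
      then show "(Some \<circ> \<sigma>) z = (Some \<circ> \<sigma>') z" using x y by auto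
    qed
    then show ?thesis using *(5) 1(3) x by (simp add: POp_eq_iff map_upt_eq)
  qed
qed


section \<open>Successors of transitions of an operator application\<close>

lemma closed_children:
  "Node m (Name r) (along I tf) \<in> Tr \<Longrightarrow> finite I \<Longrightarrow> i \<in> I \<Longrightarrow> tf i \<in> Tr"
  by (auto simp: closed_trans_Node)

lemma tree_inst_applied:
  assumes "tree_inst \<sigma> \<tau> (Node m (Name r) (along A X)) (Node m' (Name r') (along A' tf))"
    and "constructor Act T r n A" "constructor Act T r' n' A'"
  shows "r' = r" "n' = n" "A' = A" "\<And>i. i \<in> A \<Longrightarrow> tree_inst \<sigma> \<tau> (X i) (tf i)"
proof -
  from assms(1) have r: "r' = r" and l: "list_all2 (tree_inst \<sigma> \<tau>) (along A X) (along A' tf)"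
    by (auto elim: tree_inst_NodeE)
  show "r' = r" by fact
  from constructor_unique[OF assms(2)] assms(3) r have nA: "n' = n" "A' = A" by auto
  then show "n' = n" "A' = A" by simp_all
  show "tree_inst \<sigma> \<tau> (X i) (tf i)" if "i \<in> A" for i
    using l that finite_constructor[OF assms(2)]
    by (auto simp: nA list_all2_map1 list_all2_map2 list_all2_same)
qed

text \<open>Shows that a given transition, and not merely some transition, is the instance of a
  transition in a rule. \<open>ex_tree_inst\<close> provides an instance, which agrees with the
  given one in name, subtransitions and source, hence by \<open>closed_Name_unique\<close>
  entirely.\<close>

lemma tree_inst_unique_root:
  assumes \<sigma>: "\<And>z. \<sigma> z \<in> cexpr \<Sigma>"
    and d: "derivation T (Node (POp f (map (\<lambda>i. PVar (x i)) [0..<n]), a, q) (Name r)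
      (along A (\<lambda>i. var_leaf (tx i) (x i) (xa i) (x' i))))"
    and A: "finite A"
    and uf: "\<And>i. i \<in> A \<Longrightarrow> \<tau> (tx i) = Some (uf i) \<and> src (uf i) = \<sigma> (x i) \<and> lab (uf i) = xa i \<and>
      tar (uf i) = \<sigma> (x' i)"
    and u: "Node (POp f (map (\<lambda>i. \<sigma> (x i)) [0..<n]), b, p) (Name r) (along A uf) \<in> Tr"
  shows "tree_inst (Some \<circ> \<sigma>) \<tau>
    (Node (POp f (map (\<lambda>i. PVar (x i)) [0..<n]), a, q) (Name r)
      (along A (\<lambda>i. var_leaf (tx i) (x i) (xa i) (x' i))))
    (Node (POp f (map (\<lambda>i. \<sigma> (x i)) [0..<n]), b, p) (Name r) (along A uf))"
proof -
  let ?X = "\<lambda>i. var_leaf (tx i) (x i) (xa i) (x' i)" and ?L = "sorted_list_of_set A"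
  let ?t = "Node (POp f (map (\<lambda>i. PVar (x i)) [0..<n]), a, q) (Name r) (map ?X ?L)"
  have "\<exists>t' \<in> Tr. tree_inst (Some \<circ> \<sigma>) \<tau> ?t t' \<and> lit_inst (Some \<circ> \<sigma>) (root ?t) (root t')"
  proof (rule ex_tree_inst[OF \<sigma> d])
    fix w k assume "(w, k) \<in> set (leaves ?t)"
    then obtain i where "i \<in> A" "w = tx i" "k = (PVar (x i), xa i, PVar (x' i))" using A by auto
    then show "\<exists>t \<in> Tr. \<tau> w = Some t \<and> lit_inst (Some \<circ> \<sigma>) k (root t)"
      using uf closed_children[OF u A] by (auto simp: lit_inst_vars)
  qed
  then obtain t' where t': "t' \<in> Tr" "tree_inst (Some \<circ> \<sigma>) \<tau> ?t t'"
    "lit_inst (Some \<circ> \<sigma>) (root ?t) (root t')" by blast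
  from t'(2) obtain m ts where m: "t' = Node m (Name r) ts"
    "list_all2 (tree_inst (Some \<circ> \<sigma>) \<tau>) (map ?X ?L) ts"
    by (rule tree_inst_NodeE) blast
  have "ts = map uf ?L"
  proof (rule nth_equalityI)
    show l: "length ts = length (map uf ?L)" using m(2) by (simp add: list_all2_conv_all_nth)
    fix k assume "k < length ts"
    then have k: "k < length ?L" using l by simp
    then have "?L ! k \<in> A" using A nth_mem[OF k] by simp
    moreover have "tree_inst (Some \<circ> \<sigma>) \<tau> (?X (?L ! k)) (ts ! k)"
      using list_all2_nthD[OF m(2), of k] k by simp
    moreover from uf[OF \<open>?L ! k \<in> A\<close>] have "tree_inst (Some \<circ> \<sigma>) \<tau> (?X (?L ! k)) (uf (?L ! k))"
      by (blast intro: tree_inst_var_leafI)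
    ultimately show "ts ! k = map uf ?L ! k" using k by (simp add: tree_inst_unique)
  qed
  moreover have "subst_to (Some \<circ> \<sigma>) (POp f (map (\<lambda>i. PVar (x i)) [0..<n])) (fst m)"
    using t'(3) unfolding m(1) by (cases m) simp
  then have "fst m = POp f (map (\<lambda>i. \<sigma> (x i)) [0..<n])"
    by (auto simp: subst_to_POp_iff POp_eq_iff list_all2_conv_all_nth subst_to_PVar intro!: nth_equalityI)
  ultimately have "m = (POp f (map (\<lambda>i. \<sigma> (x i)) [0..<n]), b, p)"
    using t'(1) u by (intro closed_Name_unique[of m r ts]) (simp_all add: m(1))
  then show ?thesis using t'(2) m(1) \<open>ts = _\<close> by simp
qed

text \<open>\<open>P\<close> and \<open>Q\<close> are the arguments on the left and on the right,
  \<open>Rs\<close> the correspondences between them, and \<open>Rs'\<close> those between the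
  targets of the arguments that moved. In the replayed successor rule, \<open>tx\<close> and
  \<open>ty\<close> receive the given right-hand transitions. The choice of \<open>tz\<close> is the
  real task: it must satisfy the premises and also correspond to the left-hand value.\<close>

lemma succ_op:
  fixes P Q :: "nat \<Rightarrow> ('v, 'o) pexp"
    and Rs Rs' :: "nat \<Rightarrow> (('v, 'w, 'o, 'l, 'n) otree \<times> ('v, 'w, 'o, 'l, 'n) otree) set"
  assumes s: "op_rule s f g a q x y"
    and v: "Node (POp f (map P [0..<length g]), av, qv) (Name s) (along (trigger_set g) vf) \<in> Tr"
    and w: "Node (POp f (map Q [0..<length g]), aw, qw) (Name s) (along (trigger_set g) hf) \<in> Tr"
    and lv: "\<And>i. i \<in> trigger_set g \<Longrightarrow> lab (vf i) = the (g ! i)"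
    and lw: "\<And>i. i \<in> trigger_set g \<Longrightarrow> lab (hf i) = the (g ! i)"
    and m: "\<And>i. i < length g \<Longrightarrow> matching (P i) (Q i) (Rs i)"
    and m': "\<And>i. i \<in> trigger_set g \<Longrightarrow> matching (tar (vf i)) (tar (hf i)) (Rs' i)"
    and succ_transfer: "\<And>i t u t'. i \<in> trigger_set g \<Longrightarrow> (t, u) \<in> Rs i \<Longrightarrow> succ T (t, vf i, t') \<Longrightarrow>
      \<exists>u'. succ T (u, hf i, u') \<and> (t', u') \<in> Rs' i"
    and cr: "constructor Act T r (length g) A"
    and t: "Node mt (Name r) (along A tf) \<in> Tr"
    and u: "Node (POp f (map Q [0..<length g]), au, qu) (Name r) (along A uf) \<in> Tr"
    and tu: "\<And>i. i \<in> A \<Longrightarrow> (tf i, uf i) \<in> Rs i"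
    and W1: "\<And>i. i < length g \<Longrightarrow> i \<notin> trigger_set g \<Longrightarrow> Rs i \<subseteq> W' (x i)"
    and W2: "\<And>i. i \<in> trigger_set g \<Longrightarrow> Rs' i \<subseteq> W' (y i)"
    and succ: "succ T (Node mt (Name r) (along A tf),
      Node (POp f (map P [0..<length g]), av, qv) (Name s) (along (trigger_set g) vf), t')"
  shows "\<exists>u'. succ T (Node (POp f (map Q [0..<length g]), au, qu) (Name r) (along A uf),
      Node (POp f (map Q [0..<length g]), aw, qw) (Name s) (along (trigger_set g) hf), u') \<and>
      ctx_rel W' (ctx_of q) t' u'"
  using succ
proof cases
  case (1 H c \<sigma> \<tau> H')
  let ?t = "Node mt (Name r) (along A tf)"
  let ?v = "Node (POp f (map P [0..<length g]), av, qv) (Name s) (along (trigger_set g) vf)"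
  let ?u = "Node (POp f (map Q [0..<length g]), au, qu) (Name r) (along A uf)"
  let ?w = "Node (POp f (map Q [0..<length g]), aw, qw) (Name s) (along (trigger_set g) hf)"
  \<comment> \<open>Successor rules for recursive calls have \<open>RecAct\<close> or
    \<open>RecIn\<close> at the root, never a constructor.\<close>
  from 1(1) have "ds_srule Act T (H, c)"
  proof (cases rule: srule_cases)
    case (rec d p xa ya za x' y' z' tx ty tz)
    from rec(4) obtain X v u where "c = (rec_applied Act d X, v, u)"
      by (auto simp: rec_srule_def Let_def)
    with 1(5) have "tree_inst \<sigma> \<tau> (rec_applied Act d X) ?t" by simp
    then show ?thesis
      by (auto simp: rec_applied_def rec_name_def elim: tree_inst_NodeE split: if_splits)
  qed
  then show ?thesis
  proof (cases rule: ds_sruleE)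
    case ds: (1 n I A0 B0 xx x' y' z' xa ya za tx ty tz r0 s0 f1 a1 q1 f2 a2 q2 vo)
    let ?X = "\<lambda>i. var_leaf (tx i) (xx i) (xa i) (x' i) :: ('v, 'w, 'o, 'l, 'n) otree"
    let ?Y = "\<lambda>i. var_leaf (ty i) (xx i) (ya i) (y' i) :: ('v, 'w, 'o, 'l, 'n) otree"
    let ?Z = "\<lambda>i. var_leaf (tz i) (y' i) (za i) (z' i) :: ('v, 'w, 'o, 'l, 'n) otree"
    let ?tt = "Node (POp f1 (map (\<lambda>i. PVar (xx i)) [0..<n]), a1, q1) (Name r0) (along A0 ?X)"
    let ?uu = "Node (POp f2 (map (\<lambda>i. PVar (xx i)) [0..<n]), a2, q2) (Name s0) (along B0 ?Y)"
    note ru = ds(1) and cA = ds(2) and cB = ds(3) and dx = ds(6) and dt = ds(7) and dtt = ds(8)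
      and duu = ds(9) and dvo = ds(10) and svo = ds(11) and lvs = ds(12)
    from ru have H: "H = along I (\<lambda>i. (?X i, ?Y i, ?Z i))" and c: "c = (?tt, ?uu, vo)"
      by simp_all
    from 1(5) have mt: "matches \<sigma> \<tau> ?tt" and mu: "matches \<sigma> \<tau> ?uu" and mv: "matches \<sigma> \<tau> vo"
      and it: "tree_inst \<sigma> \<tau> ?tt ?t" and iu: "tree_inst \<sigma> \<tau> ?uu ?v" and iv: "tree_inst \<sigma> \<tau> vo t'"
      by (simp_all add: c)
    let ?B = "trigger_set g"
    note tA = tree_inst_applied[OF it cA cr]
    note tB = tree_inst_applied[OF iu cB op_rule_constructor[OF s]]
    have n: "n = length g" and A0: "A0 = A" and B0: "B0 = ?B" and r0: "r0 = r" and s0: "s0 = s"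
      using tA(1-3) tB(1-3) by simp_all
    have IA: "I \<subseteq> A" and IB: "I \<subseteq> ?B" using ds(4,5) A0 B0 by auto
    have fA: "finite A" and fB: "finite ?B" using finite_constructor[OF cr] by auto
    have An: "\<And>i. i \<in> A \<Longrightarrow> i < n" and Bn: "\<And>i. i \<in> ?B \<Longrightarrow> i < n"
      using constructor_sub[OF cr] trigger_sub[of g] n by auto
    have fI: "finite I" using IA fA by (rule finite_subset)
    have ct: "tf i \<in> Tr" "uf i \<in> Tr" if "i \<in> A" for i
      using closed_children[OF t fA that] closed_children[OF u fA that] by simp_all
    have cv: "vf i \<in> Tr" "hf i \<in> Tr" if "i \<in> ?B" for i
      using closed_children[OF v fB that] closed_children[OF w fB that] by simp_all
    have tx: "\<tau> (tx i) = Some (tf i)" if "i \<in> A" for i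
      by (rule tree_inst_var_leafD[OF tA(4) ct(1)]) (use that A0 in simp_all)
    have ty: "\<tau> (ty i) = Some (vf i)" if "i \<in> ?B" for i
      by (rule tree_inst_var_leafD[OF tB(4) cv(1)]) (use that B0 in simp_all)
    have mX: "matches \<sigma> \<tau> (?X i)" if "i \<in> A" for i
      using mt that fA unfolding matches_Node A0 by simp
    have mY: "matches \<sigma> \<tau> (?Y i)" if "i \<in> ?B" for i
      using mu that fB unfolding matches_Node B0 by simp
    have xa: "lab (tf i) = xa i" if "i \<in> A" for i
      using mX[OF that] tx[OF that] unfolding matches_var_leaf by simp
    have ya: "lab (vf i) = ya i" "tar (vf i) = sapp \<sigma> (y' i)" if "i \<in> ?B" for i
      using mY[OF that] ty[OF that] unfolding matches_var_leaf by simp_all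
    have "subst_to \<sigma> (POp f2 (map (\<lambda>i. PVar (xx i)) [0..<n])) (POp f (map P [0..<n]))"
      using tree_inst_root[OF iu mu] n by simp
    then have f2: "f2 = f" and sx: "\<And>i. i < n \<Longrightarrow> sapp \<sigma> (xx i) = P i"
      by (auto simp: subst_to_POp_iff POp_eq_iff list_all2_conv_all_nth subst_to_PVar)
    from dt have itx: "inj_on tx {0..<n}" and ity: "inj_on ty {0..<n}" and itz: "inj_on tz {0..<n}"
      and dxz: "tx ` {0..<n} \<inter> tz ` {0..<n} = {}"
      by (auto simp: distinct_map)
    from dx have ixx: "inj_on xx {0..<n}" and iy': "inj_on y' {0..<n}"
      and dxy: "xx ` {0..<n} \<inter> y' ` {0..<n} = {}"
      by (auto simp: distinct_map)
    \<comment> \<open>By distinctness of the transition variables, the literal at a leaf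
      \<open>tz i\<close> depends only on whether position \<open>i\<close> moved: it starts in the
      target variable \<open>y' i\<close> if so and in the argument \<open>xx i\<close>
      otherwise.\<close>
    have leaf: "i \<notin> A \<and> i \<notin> ?B \<and> k = (PVar (xx i), za i, PVar (z' i)) \<or>
        i \<in> ?B \<and> k = (PVar (y' i), za i, PVar (z' i))"
      if i: "i < n" and k: "(tz i, k) \<in> set (leaves vo)" for i k
    proof -
      have e: "i = j" if "tz i = tz j" "j < n" for j
        using inj_onD[OF itz that(1)] i that(2) by simp
      have ne: "tz i \<noteq> tx j" if "j \<in> A" for j
        using image_disjoint_neq[OF dxz, of j i] i An[OF that] by auto
      from lvs[OF k] e ne An Bn show ?thesis unfolding A0 B0 by (elim disjE exE bexE conjE) auto
    qed
    \<comment> \<open>The positions at which \<open>tz\<close> needs a value: those of the premises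
      and those whose \<open>tz i\<close> occurs in the resulting transition.\<close>
    define K where "K = I \<union> {i. i < n \<and> (\<exists>k. (tz i, k) \<in> set (leaves vo))}"
    have Kn: "i < n" if "i \<in> K" for i using that IA An unfolding K_def by auto
    have prem: "\<exists>z1. \<tau> (tz i) = Some z1 \<and> succ T (tf i, vf i, z1) \<and> lab z1 = za i" if i: "i \<in> I" for i
    proof -
      from 1(4) have "length H' = length (sorted_list_of_set I)" unfolding H by (simp add: list_all2_conv_all_nth)
      then obtain h where h: "H' = along I h" using ex_map[OF distinct_sorted_list_of_set] by blast
      have hi: "slit_inst \<sigma> \<tau> (?X i, ?Y i, ?Z i) (h i)"
        using 1(4) i fI unfolding H h by (auto simp: list_all2_map1 list_all2_map2 list_all2_same)
      obtain h1 h2 h3 where h3: "h i = (h1, h2, h3)" by (cases "h i")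
      have su: "succ T (h1, h2, h3)" using 1(10) i fI h h3 by force
      have "\<tau> (tx i) = Some h1" "\<tau> (ty i) = Some h2" "\<tau> (tz i) = Some h3" and mz: "matches \<sigma> \<tau> (?Z i)"
        using hi succD[OF su] by (auto simp: h3 intro: tree_inst_var_leafD)
      moreover from this mz have "lab h3 = za i" unfolding matches_var_leaf by simp
      ultimately show ?thesis using su tx[of i] ty[of i] i IA IB by auto
    qed
    \<comment> \<open>At a premise the value comes from transferring the successor literal.
      Elsewhere \<open>tz i\<close> stands for a freely chosen transition of the argument or of its
      target, and \<open>matching\<close> provides a partner for the left-hand choice.\<close>
    have "\<forall>i \<in> K. \<exists>z2. z2 \<in> Tr \<and> (i \<in> I \<longrightarrow> succ T (uf i, hf i, z2)) \<and> lab z2 = za i \<and>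
      src z2 = (if i \<in> ?B then tar (hf i) else Q i) \<and>
      (\<exists>z1. \<tau> (tz i) = Some z1 \<and> (z1, z2) \<in> (if i \<in> ?B then Rs' i else Rs i))"
    proof
      fix i assume i: "i \<in> K"
      show "\<exists>z2. z2 \<in> Tr \<and> (i \<in> I \<longrightarrow> succ T (uf i, hf i, z2)) \<and> lab z2 = za i \<and>
        src z2 = (if i \<in> ?B then tar (hf i) else Q i) \<and>
        (\<exists>z1. \<tau> (tz i) = Some z1 \<and> (z1, z2) \<in> (if i \<in> ?B then Rs' i else Rs i))"
      proof (cases "i \<in> I")
        case True
        then have iA: "i \<in> A" and iB: "i \<in> ?B" using IA IB by auto
        from prem[OF True] obtain z1 where z1: "\<tau> (tz i) = Some z1" "succ T (tf i, vf i, z1)" "lab z1 = za i"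
          by blast
        from succ_transfer[OF iB tu[OF iA] z1(2)] obtain z2 where z2: "succ T (uf i, hf i, z2)" "(z1, z2) \<in> Rs' i"
          by blast
        have "lab z2 = lab z1" using m'[OF iB] z2(2) unfolding matching_def by auto
        then show ?thesis using z1 z2 succD[OF z2(1)] iB by auto
      next
        case False
        with i obtain k where k: "(tz i, k) \<in> set (leaves vo)" by (auto simp: K_def)
        from tree_inst_leaves[OF iv 1(8) k] obtain z1 where z1: "z1 \<in> Tr" "\<tau> (tz i) = Some z1"
          by blast
        have lk: "lit_inst \<sigma> k (root z1)" using mv k z1(2) unfolding matches_def by auto
        from leaf[OF Kn[OF i] k] show ?thesis
        proof (elim disjE conjE)
          assume nB: "i \<notin> ?B" and "k = (PVar (xx i), za i, PVar (z' i))"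
          with lk have 2: "src z1 = P i" "lab z1 = za i" using sx[OF Kn[OF i]] by (simp_all add: lit_inst_vars)
          with z1 have "z1 \<in> trans_from (P i)" by (simp add: trans_from_def)
          from matchingD[OF m this] Kn[OF i] n obtain z2 where "z2 \<in> trans_from (Q i)" "(z1, z2) \<in> Rs i" "lab z2 = lab z1"
            by auto
          then show ?thesis using False nB z1(2) 2 by (auto simp: trans_from_def)
        next
          assume iB: "i \<in> ?B" and "k = (PVar (y' i), za i, PVar (z' i))"
          with lk have 2: "src z1 = tar (vf i)" "lab z1 = za i" using ya[OF iB] by (simp_all add: lit_inst_vars)
          with z1 have "z1 \<in> trans_from (tar (vf i))" by (simp add: trans_from_def)
          from matchingD[OF m'[OF iB] this] obtain z2 where "z2 \<in> trans_from (tar (hf i))" "(z1, z2) \<in> Rs' i" "lab z2 = lab z1"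
            by auto
          then show ?thesis using False iB z1(2) 2 by (auto simp: trans_from_def)
        qed
      qed
    qed
    from bchoice[OF this] obtain zf where zf: "\<And>i. i \<in> K \<Longrightarrow> zf i \<in> Tr \<and>
      (i \<in> I \<longrightarrow> succ T (uf i, hf i, zf i)) \<and> lab (zf i) = za i \<and>
      src (zf i) = (if i \<in> ?B then tar (hf i) else Q i) \<and>
      (\<exists>z1. \<tau> (tz i) = Some z1 \<and> (z1, zf i) \<in> (if i \<in> ?B then Rs' i else Rs i))"
      by blast
    \<comment> \<open>A closed expression to fill in where a variable has no meaning, for instance
      \<open>x' i\<close> with \<open>i\<close> outside \<open>A\<close>.\<close>
    let ?d = "src ?u"
    have cQ: "Q i \<in> cexpr \<Sigma>" if "i < n" for i using m[of i] that n by (simp add: matching_def)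
    have cd: "?d \<in> cexpr \<Sigma>" using closed_trans_cexpr[OF u] by blast
    have ctar: "i \<in> A \<Longrightarrow> tar (uf i) \<in> cexpr \<Sigma>" "i \<in> ?B \<Longrightarrow> tar (hf i) \<in> cexpr \<Sigma>"
      "i \<in> K \<Longrightarrow> tar (zf i) \<in> cexpr \<Sigma>" for i
      using closed_trans_cexpr[of "uf i"] closed_trans_cexpr[of "hf i"] closed_trans_cexpr[of "zf i"]
        ct[of i] cv[of i] zf[of i] by auto
    let ?l = "map (\<lambda>i. (xx i, Q i)) [0..<n] @ map (\<lambda>i. (x' i, if i \<in> A then tar (uf i) else ?d)) [0..<n] @
      map (\<lambda>i. (y' i, if i \<in> ?B then tar (hf i) else ?d)) [0..<n] @ map (\<lambda>i. (z' i, if i \<in> K then tar (zf i) else ?d)) [0..<n]"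
    have "\<exists>\<sigma>2. (\<forall>(k, v) \<in> set ?l. \<sigma>2 k = v) \<and> (\<forall>z. \<sigma>2 z \<in> cexpr \<Sigma>)"
    proof (rule ex_env_list)
      show "distinct (map fst ?l)" using dx by (simp add: comp_def)
      show "v \<in> cexpr \<Sigma>" if "(k, v) \<in> set ?l" for k v
        using that cQ cd ctar by (auto split: if_splits)
      show "?d \<in> cexpr \<Sigma>" by fact
    qed
    then obtain \<sigma>2 where s20: "\<forall>(k, v) \<in> set ?l. \<sigma>2 k = v" "\<forall>z. \<sigma>2 z \<in> cexpr \<Sigma>" by blast
    have s2: "i < n \<Longrightarrow> \<sigma>2 (xx i) = Q i" "i \<in> A \<Longrightarrow> \<sigma>2 (x' i) = tar (uf i)"
      "i \<in> ?B \<Longrightarrow> \<sigma>2 (y' i) = tar (hf i)" "i \<in> K \<Longrightarrow> \<sigma>2 (z' i) = tar (zf i)" "\<And>z. \<sigma>2 z \<in> cexpr \<Sigma>" for i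
      using s20 An[of i] Bn[of i] Kn[of i] by (simp_all add: ball_Un)
    \<comment> \<open>Transition variables without a meaning remain undefined, so no closed
      transition has to be found for them.\<close>
    let ?k = "map (\<lambda>i. (tx i, if i \<in> A then Some (uf i) else None)) [0..<n] @
      map (\<lambda>i. (ty i, if i \<in> ?B then Some (hf i) else None)) [0..<n] @ map (\<lambda>i. (tz i, if i \<in> K then Some (zf i) else None)) [0..<n]"
    have "\<exists>\<tau>2. (\<forall>(k, v) \<in> set ?k. \<tau>2 k = v) \<and> (\<forall>z. \<forall>t. \<tau>2 z = Some t \<longrightarrow> t \<in> Tr)"
    proof (rule ex_env_list)
      show "distinct (map fst ?k)" using dt by (simp add: comp_def)
      show "\<forall>t. v = Some t \<longrightarrow> t \<in> Tr" if "(k, v) \<in> set ?k" for k v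
        using that ct cv zf by (auto split: if_splits)
      show "\<forall>t. None = Some t \<longrightarrow> t \<in> Tr" by simp
    qed
    then obtain \<tau>2 where t20: "\<forall>(k, v) \<in> set ?k. \<tau>2 k = v" "\<forall>z. \<forall>t. \<tau>2 z = Some t \<longrightarrow> t \<in> Tr" by blast
    have t2: "i \<in> A \<Longrightarrow> \<tau>2 (tx i) = Some (uf i)" "i \<in> ?B \<Longrightarrow> \<tau>2 (ty i) = Some (hf i)"
      "i \<in> K \<Longrightarrow> \<tau>2 (tz i) = Some (zf i)" "\<And>z t. \<tau>2 z = Some t \<Longrightarrow> t \<in> Tr" for i
      using t20 An[of i] Bn[of i] Kn[of i] by (simp_all add: ball_Un)
    let ?s = "Some \<circ> \<sigma>2"
    have gs: "ground ?s" using s2(5) by (auto simp: ground_def cexpr_def)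
    have uf: "src (uf i) = Q i" "lab (uf i) = xa i" if "i \<in> A" for i
      using m[of i] tu[OF that] An[OF that] n xa[OF that] unfolding matching_def trans_from_def by auto
    \<comment> \<open>The \<open>uf i\<close> are related to the \<open>tf i\<close>, which locates
      their sources. Nothing of the kind is assumed of the \<open>hf i\<close>; their sources come
      from inverting the right-hand transition with respect to the rule of \<open>s\<close>.\<close>
    obtain \<sigma>w where sw: "\<And>i. i \<in> ?B \<Longrightarrow> src (hf i) = \<sigma>w (x i)"
      "map Q [0..<length g] = map (\<lambda>i. \<sigma>w (x i)) [0..<length g]"
    proof (rule closed_Name_at[OF s w])
      show "lab (hf i) = the (g ! i)" if "i \<in> ?B" for i using that by (rule lw)
    next
      fix \<sigma>w
      assume "\<And>i. i \<in> ?B \<Longrightarrow> hf i \<in> Tr \<and> src (hf i) = \<sigma>w (x i) \<and> tar (hf i) = \<sigma>w (y i)"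
        "(POp f (map Q [0..<length g]), aw, qw) =
          (POp f (map (\<lambda>i. \<sigma>w (x i)) [0..<length g]), a, psubst q (Some \<circ> \<sigma>w))"
      then show thesis by (intro that[of \<sigma>w]) (simp_all add: POp_eq_iff)
    qed
    have hf: "src (hf i) = Q i" "lab (hf i) = ya i" if "i \<in> ?B" for i
    proof -
      show "src (hf i) = Q i" using sw(1)[OF that] sw(2) Bn[OF that] n unfolding map_upt_eq by simp
      show "lab (hf i) = ya i" using lw[OF that] lv[OF that] ya(1)[OF that] by simp
    qed
    have MX: "matches ?s \<tau>2 (?X i)" if "i \<in> A" for i
      unfolding matches_var_leaf using t2(1)[OF that] uf[OF that] s2(1)[OF An[OF that]] s2(2)[OF that] by simp
    have MY: "matches ?s \<tau>2 (?Y i)" if "i \<in> ?B" for i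
      unfolding matches_var_leaf using t2(2)[OF that] hf[OF that] s2(1)[OF Bn[OF that]] s2(3)[OF that] by simp
    have MZ: "matches ?s \<tau>2 (?Z i)" if "i \<in> K" "i \<in> ?B" for i
      unfolding matches_var_leaf using t2(3)[OF that(1)] zf[OF that(1)] that(2) s2(3)[OF that(2)] s2(4)[OF that(1)] by simp
    have Mt: "matches ?s \<tau>2 ?tt" using MX fA unfolding matches_Node A0 by simp
    have Mu: "matches ?s \<tau>2 ?uu" using MY fB unfolding matches_Node B0 by simp
    \<comment> \<open>Every leaf of the resulting transition has a value that matches it, so the
      result can be instantiated to a closed transition.\<close>
    have lvo: "\<exists>b. \<tau>2 tx' = Some b \<and> lit_inst ?s k (root b)"
      if l: "(tx', k) \<in> set (leaves vo)" for tx' k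
      using lvs[OF l] unfolding A0 B0
    proof (elim disjE exE bexE conjE)
      fix i assume i: "i < n" "i \<notin> A" "i \<notin> ?B" and e: "(tx', k) = (tz i, PVar (xx i), za i, PVar (z' i))"
      have K: "i \<in> K" using l i e unfolding K_def by auto
      show ?thesis using e t2(3)[OF K] zf[OF K] i s2(1)[OF i(1)] s2(4)[OF K] by (simp add: lit_inst_vars)
    next
      fix i assume i: "i \<in> A" and e: "(tx', k) = (tx i, PVar (xx i), xa i, PVar (x' i))"
      show ?thesis using e t2(1)[OF i] uf[OF i] s2(1)[OF An[OF i]] s2(2)[OF i] by (simp add: lit_inst_vars)
    next
      fix i assume i: "i \<in> ?B" and e: "(tx', k) = (tz i, PVar (y' i), za i, PVar (z' i))"
      have K: "i \<in> K" using l Bn[OF i] e unfolding K_def by auto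
      show ?thesis using e t2(3)[OF K] zf[OF K] i s2(3)[OF i] s2(4)[OF K] by (simp add: lit_inst_vars)
    qed
    have Mv: "matches ?s \<tau>2 vo" unfolding matches_def using lvo by fastforce
    have "\<exists>u' \<in> Tr. tree_inst ?s \<tau>2 vo u' \<and> lit_inst ?s (root vo) (root u')"
      by (rule ex_tree_inst[OF s2(5) dvo]) (use lvo t2(4) in blast)
    then obtain u' where u': "u' \<in> Tr" "tree_inst ?s \<tau>2 vo u'" "lit_inst ?s (root vo) (root u')"
      by blast
    have f1: "f1 = f"
    proof -
      have "subst_to \<sigma> (POp f1 (map (\<lambda>i. PVar (xx i)) [0..<n])) (fst mt)"
        using tree_inst_root[OF it mt] by (cases mt) simp
      moreover have "fst mt = POp f (map P [0..<n])" using succD(4)[OF succ] n by (simp add: src_def)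
      ultimately show ?thesis by (auto simp: subst_to_POp_iff POp_eq_iff)
    qed
    have mQ: "map Q [0..<length g] = map (\<lambda>i. \<sigma>2 (xx i)) [0..<n]" using s2(1) n by simp
    have It: "tree_inst ?s \<tau>2 ?tt ?u"
      unfolding r0 A0 f1 mQ
      by (rule tree_inst_unique_root[OF s2(5) dtt[unfolded r0 A0 f1] fA _ u[unfolded mQ]])
        (use t2(1) uf s2(1)[OF An] s2(2) in auto)
    have Iu: "tree_inst ?s \<tau>2 ?uu ?w"
      unfolding s0 B0 f2 mQ
      by (rule tree_inst_unique_root[OF s2(5) duu[unfolded s0 B0 f2] fB _ w[unfolded mQ]])
        (use t2(2) hf s2(1)[OF Bn] s2(3) in auto)
    \<comment> \<open>Both sides are instances of \<open>q2\<close>, which is the source of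
      \<open>vo\<close> and the target of \<open>?uu\<close>.\<close>
    have stu: "src u' = tar ?w"
    proof -
      have "subst_to ?s q2 (src u')" using u'(3) svo unfolding lit_inst_root by simp
      moreover have "subst_to ?s q2 (tar ?w)"
        using tree_inst_root[OF Iu Mu] unfolding lit_inst_root by (simp add: tar_def)
      ultimately show ?thesis by (rule subst_to_unique)
    qed
    have "succ T (?u, ?w, u')"
    proof (rule succ.intros[OF 1(1)])
      show "is_subst \<Sigma> ?s" using s2(5) by (auto simp: is_subst_def ran_def cexpr_def)
      show "is_tsubst T \<tau>2" using t2(4) by (auto simp: is_tsubst_def ran_def open_trans_closed)
      have "slit_inst ?s \<tau>2 (?X i, ?Y i, ?Z i) (uf i, hf i, zf i)" if "i \<in> I" for i
      proof -
        have iA: "i \<in> A" and iB: "i \<in> ?B" and iK: "i \<in> K" using that IA IB by (auto simp: K_def)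
        show ?thesis
          using MX[OF iA] MY[OF iB] MZ[OF iK iB] t2(1)[OF iA] t2(2)[OF iB] t2(3)[OF iK]
          by (simp add: tree_inst_var_leafI)
      qed
      then show "list_all2 (slit_inst ?s \<tau>2) H (along I (\<lambda>i. (uf i, hf i, zf i)))"
        unfolding H using fI by (simp add: list_all2_map1 list_all2_map2 list_all2_same)
      show "slit_inst ?s \<tau>2 c (?u, ?w, u')" unfolding c using Mt Mu Mv It Iu u'(2) by simp
      show "is_slit T (?u, ?w, u')"
        using u w u'(1) stu by (simp add: open_trans_closed src_def)
      show "\<forall>s \<in> set (along I (\<lambda>i. (uf i, hf i, zf i))). succ T s"
        using zf fI unfolding K_def by auto
    qed (use u w u'(1) in simp_all)
    moreover have "ctx_rel W' (ctx_of q) t' u'"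
    proof -
      \<comment> \<open>Correspondences in the variables of the successor rule: an argument that
        stayed is known there as \<open>xx i\<close>, the target of one that moved as
        \<open>y' i\<close>.\<close>
      define W where "W z = {(t, u). (\<exists>i < n. i \<notin> ?B \<and> z = xx i \<and> (t, u) \<in> Rs i) \<or>
        (\<exists>i \<in> ?B. z = y' i \<and> (t, u) \<in> Rs' i)}" for z
      have 1: "ctx_rel W (ctx_of (src vo)) t' u'"
        using dvo iv 1(8) u'(2,1)
      proof (rule ctx_rel_tree_inst)
        fix tx' k w1 w2 assume l: "(tx', k) \<in> set (leaves vo)" and e1: "\<tau> tx' = Some w1" and e2: "\<tau>2 tx' = Some w2"
        from lvs[OF l] show "ctx_rel W (ctx_of (fst k)) w1 w2" unfolding A0 B0
        proof (elim disjE exE bexE conjE)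
          fix i assume i: "i < n" "i \<notin> A" "i \<notin> ?B" and e: "(tx', k) = (tz i, PVar (xx i), za i, PVar (z' i))"
          have K: "i \<in> K" using l i e unfolding K_def by auto
          have "(w1, w2) \<in> Rs i" using e e1 e2 t2(3)[OF K] zf[OF K] i(3) by auto
          then show ?thesis using e i by (auto simp: W_def)
        next
          fix i assume i: "i \<in> A" "i \<notin> ?B" and e: "(tx', k) = (tx i, PVar (xx i), xa i, PVar (x' i))"
          have "(w1, w2) \<in> Rs i" using e e1 e2 t2(1)[OF i(1)] tx[OF i(1)] tu[OF i(1)] by auto
          then show ?thesis using e i An[OF i(1)] by (auto simp: W_def)
        next
          fix i assume i: "i \<in> ?B" and e: "(tx', k) = (tz i, PVar (y' i), za i, PVar (z' i))"
          have K: "i \<in> K" using l Bn[OF i] e unfolding K_def by auto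
          have "(w1, w2) \<in> Rs' i" using e e1 e2 t2(3)[OF K] zf[OF K] i by auto
          then show ?thesis using e i by (auto simp: W_def)
        qed
      qed
      \<comment> \<open>The open transition \<open>?uu\<close> has the labels of the trigger
        \<open>g\<close>, so it is an instance of the transition rule fixed for \<open>s\<close>.
        The substitution \<open>\<sigma>0\<close> found by inversion renames \<open>x i\<close> to
        \<open>xx i\<close> and \<open>y i\<close> to \<open>y' i\<close>, and
        \<open>ctx_rel_subst\<close> translates along it back to the variables of
        \<open>q\<close>.\<close>
      have duu': "derivation T (Node (POp f2 (map (\<lambda>i. PVar (xx i)) [0..<n]), a2, q2) (Name s) (along ?B ?Y))"
        using duu unfolding s0 B0 .
      show ?thesis
      proof (rule derivation_Name_at[OF s duu'])
        show "lab (?Y i) = the (g ! i)" if "i \<in> ?B" for i using ya(1)[OF that] lv[OF that] by simp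
      next
        fix \<sigma>0 qq
        assume *: "\<And>i. i \<in> ?B \<Longrightarrow> derivation T (?Y i) \<and> src (?Y i) = sapp \<sigma>0 (x i) \<and> tar (?Y i) = sapp \<sigma>0 (y i)"
          "subst_to \<sigma>0 q qq"
          "(POp f2 (map (\<lambda>i. PVar (xx i)) [0..<n]), a2, q2) = (POp f (map (\<lambda>i. sapp \<sigma>0 (x i)) [0..<length g]), a, qq)"
        have sy: "sapp \<sigma>0 (y i) = PVar (y' i)" if "i \<in> ?B" for i using *(1)[OF that] by simp
        have sx0: "sapp \<sigma>0 (x i) = PVar (xx i)" if "i < n" for i
          using *(3) that n by (auto simp: POp_eq_iff map_upt_eq)
        have "ctx_rel W (ctx_of qq) t' u'" using 1 svo *(3) by simp
        with s show ?thesis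
          unfolding op_rule_def
        proof (elim conjE, intro ctx_rel_subst[OF _ _ *(2)])
          assume fvq: "fv q \<subseteq> x ` ({..<length g} - ?B) \<union> y ` ?B"
          fix z t u assume z: "z \<in> fv q" and tr: "ctx_rel W (ctx_of (sapp \<sigma>0 z)) t u"
          from z fvq consider i where "i < n" "i \<notin> ?B" "z = x i" | i where "i \<in> ?B" "z = y i"
            using n by blast
          then show "(t, u) \<in> W' z"
          proof cases
            case 1
            from tr have "(t, u) \<in> W (xx i)" by (simp add: 1 sx0)
            moreover have "xx i \<noteq> y' j" if "j \<in> ?B" for j
              using image_disjoint_neq[OF dxy, of i j] Bn[OF that] 1(1) by simp
            moreover have "j = i" if "xx i = xx j" "j < n" for j
              using inj_onD[OF ixx that(1)] that(2) 1(1) by simp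
            ultimately have "(t, u) \<in> Rs i" by (auto simp: W_def)
            then show ?thesis using W1[of i] 1 n by auto
          next
            case 2
            from tr have "(t, u) \<in> W (y' i)" by (simp add: 2 sy)
            moreover have "y' i \<noteq> xx j" if "j < n" for j
              using image_disjoint_neq[OF dxy, of j i] Bn[OF 2(1)] that by auto
            moreover have "j = i" if "y' i = y' j" "j \<in> ?B" for j
              using inj_onD[OF iy' that(1)] Bn[OF that(2)] Bn[OF 2(1)] by simp
            ultimately have "(t, u) \<in> Rs' i" by (auto simp: W_def)
            then show ?thesis using W2[of i] 2 by auto
          qed
        qed (assumption | blast)+
      qed
    qed
    ultimately show ?thesis by blast
  qed
qed


section \<open>Closure of ep-bisimulations under contexts\<close>

definition succ_transfer where
  "succ_transfer R R' v w \<longleftrightarrow> (\<forall>t u t'. (t, u) \<in> R \<longrightarrow> succ T (t, v, t') \<longrightarrow>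
     (\<exists>u'. succ T (u, w, u') \<and> (t', u') \<in> R'))"

text \<open>
  Clause (b) in the definition of ep-bisimulations is clause (a) for the converse relations.
\<close>

definition ep_step where
  "ep_step S R v w \<longleftrightarrow> (\<exists>R'. (tar v, tar w, R') \<in> S \<and> succ_transfer R R' v w \<and> succ_transfer (R\<inverse>) (R'\<inverse>) w v)"

text \<open>The second rule has to be iterable: after a step the holes are filled with targets that
  are themselves related along contexts, and not by an ep-bisimulation given at the start.\<close>

inductive_set ctx_closure where
  base: "ep_bisimulation (ltss_of T) \<R> \<Longrightarrow> (p, q, R) \<in> \<R> \<Longrightarrow> (p, q, R) \<in> ctx_closure"
| ctx: "p \<in> cexpr \<Sigma>' \<Longrightarrow> \<forall>k. (\<rho> k, \<nu> k, W k) \<in> ctx_closure \<Longrightarrow> (fill \<rho> p, fill \<nu> p, ctx_trans \<rho> \<nu> W p) \<in> ctx_closure"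

lemma en_ltss_of: "en (ltss_of T) p = trans_from p"
  by (simp add: en_def ltss_of_def trans_from_def)

lemma ltss_of_simps [simp]: "states (ltss_of T) = cexpr \<Sigma>" "transitions (ltss_of T) = Tr"
  "source (ltss_of T) = src" "target (ltss_of T) = tar" "label (ltss_of T) = lab"
  "s \<in> successors (ltss_of T) \<longleftrightarrow> succ T s"
  by (simp_all add: ltss_of_def)

lemma ep_bisimulation_iff: "ep_bisimulation (ltss_of T) \<R> \<longleftrightarrow>
    (\<forall>(p, q, R) \<in> \<R>. matching p q R \<and> (\<forall>(v, w) \<in> R. ep_step \<R> R v w))"
proof -
  have m: "matching p q R \<longleftrightarrow> p \<in> cexpr \<Sigma> \<and> q \<in> cexpr \<Sigma> \<and> R \<subseteq> Tr \<times> Tr \<and>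
      R \<subseteq> trans_from p \<times> trans_from q \<and>
      (\<forall>t \<in> trans_from p. \<exists>u \<in> trans_from q. (t, u) \<in> R) \<and>
      (\<forall>u \<in> trans_from q. \<exists>t \<in> trans_from p. (t, u) \<in> R) \<and> (\<forall>(t, u) \<in> R. lab t = lab u)" for p q R
    unfolding matching_def trans_from_def by blast
  have s: "ep_step \<R> R v w \<longleftrightarrow> (\<exists>R'. (tar v, tar w, R') \<in> \<R> \<and>
        (\<forall>t u t'. (t, u) \<in> R \<longrightarrow> succ T (t, v, t') \<longrightarrow> (\<exists>u'. succ T (u, w, u') \<and> (t', u') \<in> R')) \<and>
        (\<forall>t u u'. (t, u) \<in> R \<longrightarrow> succ T (u, w, u') \<longrightarrow> (\<exists>t'. succ T (t, v, t') \<and> (t', u') \<in> R')))" for R v w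
    unfolding ep_step_def succ_transfer_def converse_iff by blast
  show ?thesis
    unfolding ep_bisimulation_def en_ltss_of ltss_of_simps m s by (auto 0 4)
qed

lemma closed_Name_src:
  assumes "Node m (Name r) (along A tf) \<in> Tr" "constructor Act T r n A"
    "fst m = POp f (map P [0..<n])" "i \<in> A"
  shows "tf i \<in> Tr" "src (tf i) = P i"
proof -
  from assms(2,1) obtain f' g a q x y \<sigma> where "op_rule r f' g a q x y" "n = length g" "A = trigger_set g"
    "\<And>i. i \<in> A \<Longrightarrow> tf i \<in> Tr \<and> src (tf i) = \<sigma> (x i) \<and>
       lab (tf i) = the (g ! i) \<and> tar (tf i) = \<sigma> (y i)"
    "m = (POp f' (map (\<lambda>i. \<sigma> (x i)) [0..<n]), a, psubst q (Some \<circ> \<sigma>))"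
    by (rule constructor_op_rule) (rule that, assumption+)
  then show "tf i \<in> Tr" "src (tf i) = P i"
    using assms(3,4) constructor_sub[OF assms(2)] by (auto simp: POp_eq_iff)
qed

text \<open>\<open>succ_op\<close> for the arguments of two filled contexts. Its hypotheses keep
  their form when both sides are exchanged and all relations are reversed, so the same lemma yields
  both clauses on successors.\<close>

lemma succ_transfer_op:
  assumes cl: "\<And>k. \<rho> k \<in> cexpr \<Sigma>" "\<And>k. \<nu> k \<in> cexpr \<Sigma>"
    and len: "length g = length ps"
    and s: "op_rule s f g a q x y"
    and v: "Node mv (Name s) (along (trigger_set g) vf) \<in> trans_from (fill \<rho> (POp (Inl f) ps))"
    and w: "Node mw (Name s) (along (trigger_set g) hf) \<in> trans_from (fill \<nu> (POp (Inl f) ps))"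
    and lv: "\<And>i. i \<in> trigger_set g \<Longrightarrow> lab (vf i) = the (g ! i)"
    and lw: "\<And>i. i \<in> trigger_set g \<Longrightarrow> lab (hf i) = the (g ! i)"
    and m: "\<And>i. i < length g \<Longrightarrow> matching (fill \<rho> (ps ! i)) (fill \<nu> (ps ! i)) (ctx_trans \<rho> \<nu> W (ps ! i))"
    and m': "\<And>i. i \<in> trigger_set g \<Longrightarrow> matching (tar (vf i)) (tar (hf i)) (Rs' i)"
    and f: "\<And>i. i \<in> trigger_set g \<Longrightarrow> succ_transfer (ctx_trans \<rho> \<nu> W (ps ! i)) (Rs' i) (vf i) (hf i)"
    and W1: "\<And>i. i < length g \<Longrightarrow> i \<notin> trigger_set g \<Longrightarrow> ctx_trans \<rho> \<nu> W (ps ! i) \<subseteq> W' (x i)"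
    and W2: "\<And>i. i \<in> trigger_set g \<Longrightarrow> Rs' i \<subseteq> W' (y i)"
    and R': "trans_from (snd (snd mv)) \<times> trans_from (snd (snd mw)) \<inter> {(t, u). ctx_rel W' (ctx_of q) t u} \<subseteq> R'"
  shows "succ_transfer (ctx_trans \<rho> \<nu> W (POp (Inl f) ps)) R'
    (Node mv (Name s) (along (trigger_set g) vf))
    (Node mw (Name s) (along (trigger_set g) hf))"
  unfolding succ_transfer_def
proof (intro allI impI)
  fix t u t'
  let ?v = "Node mv (Name s) (along (trigger_set g) vf)"
  let ?w = "Node mw (Name s) (along (trigger_set g) hf)"
  assume tu: "(t, u) \<in> ctx_trans \<rho> \<nu> W (POp (Inl f) ps)" and su: "succ T (t, ?v, t')"
  have fr: "fv (\<rho> k) = {}" "fv (\<nu> k) = {}" for k using cl by (simp_all add: cexpr_def)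
  let ?P = "\<lambda>i. fill \<rho> (ps ! i)" and ?Q = "\<lambda>i. fill \<nu> (ps ! i)"
  have mp: "map (fill \<rho>) ps = map ?P [0..<length g]" "map (fill \<nu>) ps = map ?Q [0..<length g]"
    using len by (auto intro!: nth_equalityI)
  have h: "fill \<rho> (POp (Inl f) ps) = POp f (map ?P [0..<length g])"
    "fill \<nu> (POp (Inl f) ps) = POp f (map ?Q [0..<length g])"
    using mp fr by (simp_all add: fill_POp)
  from tu have tc: "t \<in> Tr" "src t = POp f (map ?P [0..<length g])"
    and uc: "u \<in> Tr" "src u = POp f (map ?Q [0..<length g])"
    and tr: "ctx_rel W (POp (Inl f) ps) t u" by (simp_all add: ctx_trans_def trans_from_def h)
  from tr obtain m m' r A tf uf where cr: "constructor Act T r (length ps) A"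
    and t: "t = Node m (Name r) (along A tf)"
    and u: "u = Node m' (Name r) (along A uf)"
    and tri: "\<And>i. i \<in> A \<Longrightarrow> ctx_rel W (ps ! i) (tf i) (uf i)"
    by (rule ctx_rel_POp) (rule that, assumption+)
  have cr': "constructor Act T r (length g) A" using cr len by simp
  obtain au qu where m'e: "m' = (POp f (map ?Q [0..<length g]), au, qu)"
    using uc(2) unfolding u by (cases m') (simp add: src_def)
  obtain av qv where mve: "mv = (POp f (map ?P [0..<length g]), av, qv)"
    using v h by (cases mv) (simp add: trans_from_def src_def)
  obtain aw qw where mwe: "mw = (POp f (map ?Q [0..<length g]), aw, qw)"
    using w h by (cases mw) (simp add: trans_from_def src_def)
  have vc: "?v \<in> Tr" and wc: "?w \<in> Tr" using v w by (simp_all add: trans_from_def)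
  have tui: "(tf i, uf i) \<in> ctx_trans \<rho> \<nu> W (ps ! i)" if "i \<in> A" for i
    using closed_Name_src[OF tc(1)[unfolded t] cr' _ that, of f ?P]
      closed_Name_src[OF uc(1)[unfolded u] cr' _ that, of f ?Q] tc(2) uc(2) tri[OF that]
    unfolding t u by (simp add: ctx_trans_def trans_from_def src_def)
  have "\<exists>u'. succ T (u, ?w, u') \<and> ctx_rel W' (ctx_of q) t' u'"
    unfolding u m'e mwe
  proof (rule succ_op[OF s vc[unfolded mve] wc[unfolded mwe] lv lw m m' _ cr' tc(1)[unfolded t] uc(1)[unfolded u m'e] tui W1 W2])
    show "succ T (Node m (Name r) (along A tf),
        Node (POp f (map ?P [0..<length g]), av, qv) (Name s) (along (trigger_set g) vf), t')"
      using su unfolding t mve .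
    show "\<exists>u'. succ T (u, hf i, u') \<and> (t', u') \<in> Rs' i"
      if "i \<in> trigger_set g" "(t, u) \<in> ctx_trans \<rho> \<nu> W (ps ! i)" "succ T (t, vf i, t')" for i t u t'
      using f[OF that(1)] that(2,3) unfolding succ_transfer_def by blast
  qed
  then obtain u' where u': "succ T (u, ?w, u')" "ctx_rel W' (ctx_of q) t' u'" by blast
  have "t' \<in> trans_from (snd (snd mv))" using succD[OF su] by (simp add: trans_from_def tar_def)
  moreover have "u' \<in> trans_from (snd (snd mw))" using succD[OF u'(1)] by (simp add: trans_from_def tar_def)
  ultimately have "(t', u') \<in> R'" using u'(2) R' by blast
  with u'(1) show "\<exists>u'. succ T (u, ?w, u') \<and> (t', u') \<in> R'" by blast
qed

text \<open>A step with a label outside \<open>Act\<close> returns to the recursive call, and each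
  successor it has is the transition it started from. The correspondence must then be reproduced
  unchanged, hence the case distinction on the label.\<close>

lemma succ_transfer_rec:
  assumes cl: "\<And>k. \<rho> k \<in> cexpr \<Sigma>" "\<And>k. \<nu> k \<in> cexpr \<Sigma>"
    and c: "c \<in> cexpr \<Sigma>'" "unfolds c p"
    and v: "v \<in> Tr" and w: "w \<in> Tr" and vw: "lab v = lab w"
    and f: "succ_transfer (ctx_trans \<rho> \<nu> W p) R' v w"
  shows "succ_transfer (ctx_trans \<rho> \<nu> W c) (if lab v \<in> Act then R' else ctx_trans \<rho> \<nu> W c)
    (rec_applied Act (fill \<rho> c) v) (rec_applied Act (fill \<nu> c) w)"
  unfolding succ_transfer_def
proof (intro allI impI)
  fix t u t'
  assume tu: "(t, u) \<in> ctx_trans \<rho> \<nu> W c" and su: "succ T (t, rec_applied Act (fill \<rho> c) v, t')"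
  have fr: "fv (\<rho> k) = {}" "fv (\<nu> k) = {}" for k using cl by (simp_all add: cexpr_def)
  have un: "unfolds (fill \<rho> c) (fill \<rho> p)" "unfolds (fill \<nu> c) (fill \<nu> p)"
    using fill_unfolds[OF _ c(2)] fr by simp_all
  from tu have tc: "t \<in> Tr" "src t = fill \<rho> c" and uc: "u \<in> Tr" "src u = fill \<nu> c"
    and tr: "ctx_rel W c t u" by (simp_all add: ctx_trans_def trans_from_def)
  from tr c(2) obtain m m' r r' t1 u1 where r: "\<forall>s. r \<noteq> Name s" "\<forall>s. r' \<noteq> Name s"
    and t: "t = Node m r [t1]" and u: "u = Node m' r' [u1]" and tr1: "ctx_rel W p t1 u1"
    by (rule ctx_rel_Rec)
  have mt: "fst m = fill \<rho> c" using tc(2) by (simp add: t src_def)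
  have mu: "fst m' = fill \<nu> c" using uc(2) by (simp add: u src_def)
  note t1 = closed_rec1[OF tc(1)[unfolded t] r(1), unfolded mt]
  note u1 = closed_rec1[OF uc(1)[unfolded u] r(2), unfolded mu]
  have s1: "src t1 = fill \<rho> p" "src u1 = fill \<nu> p"
    using t1(2) u1(2) un unfolds_unique by blast+
  have "(t1, u1) \<in> ctx_trans \<rho> \<nu> W p" using t1(1) u1(1) s1 tr1 by (simp add: ctx_trans_def trans_from_def)
  note te = t[unfolded t1(3)] and ue = u[unfolded u1(3)]
  from su[unfolded te] t1(1) v obtain t1' where t1': "succ T (t1, v, t1')"
    "t' = (if lab v \<in> Act then t1' else rec_applied Act (fill \<rho> c) t1)" by (rule succ_rec)
  from f t1'(1) \<open>(t1, u1) \<in> ctx_trans \<rho> \<nu> W p\<close> obtain u1' where u1': "succ T (u1, w, u1')" "(t1', u1') \<in> R'"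
    unfolding succ_transfer_def by blast
  have "succ T (rec_applied Act (fill \<nu> c) u1, rec_applied Act (fill \<nu> c) w,
      if lab w \<in> Act then u1' else rec_applied Act (fill \<nu> c) u1)"
    by (rule succ_recI[OF fill_cexpr[OF c(1) cl(2)] un(2) s1(2) u1'(1)])
  then have "succ T (u, rec_applied Act (fill \<nu> c) w, if lab v \<in> Act then u1' else u)"
    unfolding ue vw .
  moreover have "(t', if lab v \<in> Act then u1' else u) \<in> (if lab v \<in> Act then R' else ctx_trans \<rho> \<nu> W c)"
    using t1'(2) u1'(2) tu te by auto
  ultimately show "\<exists>u'. succ T (u, rec_applied Act (fill \<nu> c) w, u') \<and>
      (t', u') \<in> (if lab v \<in> Act then R' else ctx_trans \<rho> \<nu> W c)" by blast
qed

lemma ctx_closure_matching: "(p, q, R) \<in> ctx_closure \<Longrightarrow> matching p q R"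
proof (induction rule: ctx_closure.induct)
  case (base \<R> p q R)
  then show ?case unfolding ep_bisimulation_iff by blast
next
  case (ctx p \<rho> \<nu> W)
  then show ?case by (blast intro: matching_ctx_trans)
qed

lemma ep_step_mono: "ep_step S R v w \<Longrightarrow> S \<subseteq> S' \<Longrightarrow> ep_step S' R v w"
  unfolding ep_step_def by blast

text \<open>Induction along the derivation that \<open>v\<close> and \<open>w\<close> are related,
  since its recursive clause moves to the unfolding of the context.\<close>

lemma ep_step_ctx_trans:
  assumes E: "\<And>k. (\<rho> k, \<nu> k, W k) \<in> ctx_closure" and st: "\<And>k v w. (v, w) \<in> W k \<Longrightarrow> ep_step ctx_closure (W k) v w"
  shows "ctx_rel W p v w \<Longrightarrow> p \<in> cexpr \<Sigma>' \<Longrightarrow> v \<in> trans_from (fill \<rho> p) \<Longrightarrow> w \<in> trans_from (fill \<nu> p) \<Longrightarrow>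
    ep_step ctx_closure (ctx_trans \<rho> \<nu> W p) v w"
proof (induction rule: ctx_rel.induct)
  case (hole v w k)
  note mk = ctx_closure_matching[OF E[of k]]
  then have "fv (\<rho> k) = {}" "fv (\<nu> k) = {}" for k
    using ctx_closure_matching[OF E[of k]] by (simp_all add: matching_def cexpr_def)
  then have "ctx_trans \<rho> \<nu> W (hole k) = W k"
    using mk by (auto simp: ctx_trans_def fill_hole matching_def)
  then show ?case using st hole.hyps by simp
next
  case (Op s ps I vf hf f mv mw)
  have cl: "\<rho> k \<in> cexpr \<Sigma>" "\<nu> k \<in> cexpr \<Sigma>" for k
    using ctx_closure_matching[OF E[of k]] by (simp_all add: matching_def)
  have fr: "fv (\<rho> k) = {}" "fv (\<nu> k) = {}" for k using cl by (simp_all add: cexpr_def)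
  have labW: "lab t = lab u" if "(t, u) \<in> W k" for t u k
    using ctx_closure_matching[OF E[of k]] that by (simp add: matching_def)
  let ?p = "POp (Inl f) ps"
  let ?v = "Node mv (Name s) (along I vf)"
  let ?w = "Node mw (Name s) (along I hf)"
  have vc: "?v \<in> Tr" and wc: "?w \<in> Tr" using Op.prems by (simp_all add: trans_from_def)
  have ps: "ps ! i \<in> cexpr \<Sigma>'" if "i < length ps" for i
    using Op.prems(1) nth_mem[OF that] by (auto simp: cexpr_def expr_POp_iff)
  from Op.hyps(1) vc obtain f' g a q x y \<sigma> where s: "op_rule s f' g a q x y" and len: "length ps = length g"
    and I: "I = trigger_set g" and s1: "\<And>z. \<sigma> z \<in> cexpr \<Sigma>"
    and v1: "\<And>i. i \<in> I \<Longrightarrow> vf i \<in> Tr \<and> src (vf i) = \<sigma> (x i) \<and>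
       lab (vf i) = the (g ! i) \<and> tar (vf i) = \<sigma> (y i)"
    and mv: "mv = (POp f' (map (\<lambda>i. \<sigma> (x i)) [0..<length ps]), a, psubst q (Some \<circ> \<sigma>))"
    by (rule constructor_op_rule) (rule that, assumption+)
  have hp: "POp f' (map (\<lambda>i. \<sigma> (x i)) [0..<length ps]) = POp f (map (fill \<rho>) ps)"
    using Op.prems(2) fr by (simp add: trans_from_def src_def mv fill_POp)
  then have f': "f' = f" and ml: "map (\<lambda>i. \<sigma> (x i)) [0..<length ps] = map (fill \<rho>) ps"
    by (simp_all add: POp_eq_iff)
  have sx: "\<sigma> (x i) = fill \<rho> (ps ! i)" if "i < length g" for i
    using arg_cong[OF ml, of "\<lambda>l. l ! i"] that len by simp
  have In: "i < length g" if "i \<in> I" for i using that trigger_sub[of g] I by auto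
  have wt: "hf i \<in> Tr" if "i \<in> I" for i
    using wc that I by (auto simp: closed_trans_Node)
  have tri: "ctx_rel W (ps ! i) (vf i) (hf i)" if "i \<in> I" for i using Op.IH that by blast
  \<comment> \<open>The labels on the right equal those on the left, so the right-hand transition is
    an instance of the same rule with the same target \<open>q\<close>.\<close>
  have lw: "lab (hf i) = the (g ! i)" if "i \<in> I" for i
    using ctx_rel_lab[OF labW tri[OF that]] v1[OF that] wt[OF that] by simp
  obtain \<sigma>w where s2: "\<And>z. \<sigma>w z \<in> cexpr \<Sigma>"
    and w1: "\<And>i. i \<in> I \<Longrightarrow> src (hf i) = \<sigma>w (x i) \<and> tar (hf i) = \<sigma>w (y i)"
    and mw: "mw = (POp f' (map (\<lambda>i. \<sigma>w (x i)) [0..<length g]), a, psubst q (Some \<circ> \<sigma>w))"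
  proof (rule closed_Name_at[OF s wc[unfolded I]])
    show "lab (hf i) = the (g ! i)" if "i \<in> trigger_set g" for i using lw that I by simp
  next
    fix \<sigma>w
    assume "\<And>z. \<sigma>w z \<in> cexpr \<Sigma>"
      "\<And>i. i \<in> trigger_set g \<Longrightarrow> hf i \<in> Tr \<and> src (hf i) = \<sigma>w (x i) \<and> tar (hf i) = \<sigma>w (y i)"
      "mw = (POp f' (map (\<lambda>i. \<sigma>w (x i)) [0..<length g]), a, psubst q (Some \<circ> \<sigma>w))"
    then show thesis by (intro that[of \<sigma>w]) (simp_all add: I)
  qed
  have mlw: "map (\<lambda>i. \<sigma>w (x i)) [0..<length g] = map (fill \<nu>) ps"
    using Op.prems(3) fr by (simp add: trans_from_def src_def mw fill_POp POp_eq_iff)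
  have sxw: "\<sigma>w (x i) = fill \<nu> (ps ! i)" if "i < length g" for i
    using arg_cong[OF mlw, of "\<lambda>l. l ! i"] that len by simp
  have "\<exists>R'. (tar (vf i), tar (hf i), R') \<in> ctx_closure \<and> succ_transfer (ctx_trans \<rho> \<nu> W (ps ! i)) R' (vf i) (hf i) \<and>
      succ_transfer ((ctx_trans \<rho> \<nu> W (ps ! i))\<inverse>) (R'\<inverse>) (hf i) (vf i)" if i: "i \<in> I" for i
  proof -
    have "ep_step ctx_closure (ctx_trans \<rho> \<nu> W (ps ! i)) (vf i) (hf i)"
      using Op.IH i ps[of i] In[OF i] len v1[OF i] wt[OF i] w1[OF i] sx sxw
      by (simp add: trans_from_def)
    then show ?thesis unfolding ep_step_def .
  qed
  then obtain Rs' where R1: "\<And>i. i \<in> I \<Longrightarrow> (tar (vf i), tar (hf i), Rs' i) \<in> ctx_closure"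
    and R2: "\<And>i. i \<in> I \<Longrightarrow> succ_transfer (ctx_trans \<rho> \<nu> W (ps ! i)) (Rs' i) (vf i) (hf i)"
    and R3: "\<And>i. i \<in> I \<Longrightarrow> succ_transfer ((ctx_trans \<rho> \<nu> W (ps ! i))\<inverse>) ((Rs' i)\<inverse>) (hf i) (vf i)"
    by metis
  \<comment> \<open>One triple per process variable fills the holes of the next context: the triple
    of the argument at \<open>x i\<close>, the one obtained by induction at \<open>y i\<close>, and
    the original triple of the variable anywhere else.\<close>
  have "\<exists>\<xi>. (\<forall>i \<in> {..<length g}. \<xi> (x i) = (fill \<rho> (ps ! i), fill \<nu> (ps ! i), ctx_trans \<rho> \<nu> W (ps ! i))) \<and>
      (\<forall>i \<in> I. \<xi> (y i) = (tar (vf i), tar (hf i), Rs' i)) \<and> (\<forall>z. \<xi> z \<in> ctx_closure)"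
  proof (rule ex_env)
    show "inj_on x {..<length g}" "inj_on y I" "x ` {..<length g} \<inter> y ` I = {}"
      using s by (simp_all add: op_rule_def I)
    show "(fill \<rho> (ps ! i), fill \<nu> (ps ! i), ctx_trans \<rho> \<nu> W (ps ! i)) \<in> ctx_closure" if "i \<in> {..<length g}" for i
      using ps that len E by (auto intro: ctx_closure.ctx)
    show "(tar (vf i), tar (hf i), Rs' i) \<in> ctx_closure" if "i \<in> I" for i using that by (rule R1)
    show "(\<rho> z, \<nu> z, W z) \<in> ctx_closure" for z by (rule E)
  qed
  then obtain \<xi> where xi1: "\<And>i. i < length g \<Longrightarrow> \<xi> (x i) = (fill \<rho> (ps ! i), fill \<nu> (ps ! i), ctx_trans \<rho> \<nu> W (ps ! i))"
    and xi2: "\<And>i. i \<in> I \<Longrightarrow> \<xi> (y i) = (tar (vf i), tar (hf i), Rs' i)" and xi3: "\<And>z. \<xi> z \<in> ctx_closure" by auto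
  define \<rho>' \<nu>' W' where "\<rho>' z = fst (\<xi> z)" and "\<nu>' z = fst (snd (\<xi> z))" and "W' z = snd (snd (\<xi> z))" for z
  have E': "(\<rho>' z, \<nu>' z, W' z) \<in> ctx_closure" for z using xi3 by (simp add: \<rho>'_def \<nu>'_def W'_def)
  have cl': "\<rho>' k \<in> cexpr \<Sigma>" "\<nu>' k \<in> cexpr \<Sigma>" for k
    using ctx_closure_matching[OF E'[of k]] by (simp_all add: matching_def)
  then have fr': "fv (\<rho>' k) = {}" "fv (\<nu>' k) = {}" for k by (simp_all add: cexpr_def)
  have q: "q \<in> expr \<Sigma>" and fvq: "fv q \<subseteq> x ` {..<length g} \<union> y ` I"
    using s by (auto simp: op_rule_def I)
  have ag: "\<rho>' z = \<sigma> z" "\<nu>' z = \<sigma>w z" if "z \<in> fv q" for z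
    using subsetD[OF fvq that] xi1 xi2 sx sxw v1 w1 by (auto simp: \<rho>'_def \<nu>'_def)
  have tgv: "fill \<rho>' (ctx_of q) = tar ?v"
  proof -
    have "psubst q (Some \<circ> \<rho>') = psubst q (Some \<circ> \<sigma>)"
      by (rule psubst_cong) (use fr' ag in \<open>auto simp: ground_def\<close>)
    then show ?thesis using fill_ctx_of[of \<rho>' q] fr' by (simp add: tar_def mv)
  qed
  have tgw: "fill \<nu>' (ctx_of q) = tar ?w"
  proof -
    have "psubst q (Some \<circ> \<nu>') = psubst q (Some \<circ> \<sigma>w)"
      by (rule psubst_cong) (use fr' ag in \<open>auto simp: ground_def\<close>)
    then show ?thesis using fill_ctx_of[of \<nu>' q] fr' by (simp add: tar_def mw)
  qed
  \<comment> \<open>the target \<open>q\<close> of the rule is the context of the residuals\<close>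
  let ?R = "ctx_trans \<rho>' \<nu>' W' (ctx_of q)"
  have cq: "ctx_of q \<in> cexpr \<Sigma>'" using ctx_of_expr[OF q] by (simp add: cexpr_def)
  have "(tar ?v, tar ?w, ?R) \<in> ctx_closure"
    unfolding tgv[symmetric] tgw[symmetric] using cq E' by (intro ctx_closure.ctx) auto
  moreover have mi: "matching (fill \<rho> (ps ! i)) (fill \<nu> (ps ! i)) (ctx_trans \<rho> \<nu> W (ps ! i))" if "i < length g" for i
    using that len by (intro matching_ctx_trans ps ctx_closure_matching E) simp
  have mi': "matching (tar (vf i)) (tar (hf i)) (Rs' i)" if "i \<in> I" for i
    using R1[OF that] by (rule ctx_closure_matching)
  have W1: "ctx_trans \<rho> \<nu> W (ps ! i) \<subseteq> W' (x i)" if "i < length g" for i using xi1[OF that] by (simp add: W'_def)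
  have W2: "Rs' i \<subseteq> W' (y i)" if "i \<in> I" for i using xi2[OF that] by (simp add: W'_def)
  have "succ_transfer (ctx_trans \<rho> \<nu> W ?p) ?R ?v ?w"
    unfolding I
  proof (rule succ_transfer_op[OF cl len[symmetric] s[unfolded f'] Op.prems(2)[unfolded I] Op.prems(3)[unfolded I],
        where W' = W' and Rs' = Rs'])
    show "trans_from (snd (snd mv)) \<times> trans_from (snd (snd mw)) \<inter> {(t, u). ctx_rel W' (ctx_of q) t u} \<subseteq> ?R"
      using tgv tgw by (auto simp: ctx_trans_def tar_def)
  qed (use v1 lw mi mi' R2 W1 W2 I in simp_all)
  \<comment> \<open>The mirror image: left and right are exchanged and every correspondence is
    reversed.\<close>
  moreover have "succ_transfer ((ctx_trans \<rho> \<nu> W ?p)\<inverse>) (?R\<inverse>) ?w ?v"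
    unfolding I ctx_trans_converse
  proof (rule succ_transfer_op[OF cl(2,1) len[symmetric] s[unfolded f'] Op.prems(3)[unfolded I] Op.prems(2)[unfolded I],
        where W' = "\<lambda>z. (W' z)\<inverse>" and Rs' = "\<lambda>i. (Rs' i)\<inverse>"])
    show "trans_from (snd (snd mw)) \<times> trans_from (snd (snd mv)) \<inter> {(t, u). ctx_rel (\<lambda>z. (W' z)\<inverse>) (ctx_of q) t u} \<subseteq>
        ctx_trans \<nu>' \<rho>' (\<lambda>k. (W' k)\<inverse>) (ctx_of q)"
      using tgv tgw by (auto simp: ctx_trans_def tar_def)
  qed (use v1 lw mi mi' R3 W1 W2 I in \<open>simp_all add: ctx_trans_converse[symmetric] matching_converse\<close>)
  ultimately show ?case unfolding ep_step_def by blast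
next
  case (Rec c p v w r r' mv mw)
  have cl: "\<rho> k \<in> cexpr \<Sigma>" "\<nu> k \<in> cexpr \<Sigma>" for k
    using ctx_closure_matching[OF E[of k]] by (simp_all add: matching_def)
  have fr: "fv (\<rho> k) = {}" "fv (\<nu> k) = {}" for k using cl by (simp_all add: cexpr_def)
  have labW: "lab t = lab u" if "(t, u) \<in> W k" for t u k
    using ctx_closure_matching[OF E[of k]] that by (simp add: matching_def)
  have un: "unfolds (fill \<rho> c) (fill \<rho> p)" "unfolds (fill \<nu> c) (fill \<nu> p)"
    using fill_unfolds[OF _ Rec.hyps(1)] fr by simp_all
  have vc: "Node mv r [v] \<in> Tr" "fst mv = fill \<rho> c"
    and wc: "Node mw r' [w] \<in> Tr" "fst mw = fill \<nu> c"
    using Rec.prems by (simp_all add: trans_from_def src_def)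
  note v = closed_rec1[OF vc(1) Rec.hyps(3), unfolded vc(2)]
  note w = closed_rec1[OF wc(1) Rec.hyps(4), unfolded wc(2)]
  have sv: "src v = fill \<rho> p" "src w = fill \<nu> p" using v(2) w(2) un unfolds_unique by blast+
  have p: "p \<in> cexpr \<Sigma>'"
    using Rec.prems(1) Rec.hyps(1) fv_unfolds expr_unfolds by (fastforce simp: cexpr_def)
  have l: "lab v = lab w" using ctx_rel_lab[OF labW Rec.hyps(2)] v(1) w(1) by simp
  from Rec.IH[OF p] v(1) w(1) sv obtain R' where R': "(tar v, tar w, R') \<in> ctx_closure"
    "succ_transfer (ctx_trans \<rho> \<nu> W p) R' v w" "succ_transfer ((ctx_trans \<rho> \<nu> W p)\<inverse>) (R'\<inverse>) w v"
    by (auto simp: trans_from_def ep_step_def)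
  let ?R = "if lab v \<in> Act then R' else ctx_trans \<rho> \<nu> W c"
  have "(tar (Node mv r [v]), tar (Node mw r' [w]), ?R) \<in> ctx_closure"
    unfolding v(3) w(3) tar_rec_applied using R'(1) l ctx_closure.ctx[OF Rec.prems(1), of \<rho> \<nu> W] E by simp
  moreover have "succ_transfer (ctx_trans \<rho> \<nu> W c) ?R (Node mv r [v]) (Node mw r' [w])"
    unfolding v(3) w(3) by (rule succ_transfer_rec[OF cl Rec.prems(1) Rec.hyps(1) v(1) w(1) l R'(2)])
  moreover have "succ_transfer ((ctx_trans \<rho> \<nu> W c)\<inverse>) (?R\<inverse>) (Node mw r' [w]) (Node mv r [v])"
  proof -
    have "succ_transfer (ctx_trans \<nu> \<rho> (\<lambda>k. (W k)\<inverse>) c) (if lab w \<in> Act then R'\<inverse> else ctx_trans \<nu> \<rho> (\<lambda>k. (W k)\<inverse>) c)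
        (rec_applied Act (fill \<nu> c) w) (rec_applied Act (fill \<rho> c) v)"
      by (rule succ_transfer_rec[OF cl(2,1) Rec.prems(1) Rec.hyps(1) w(1) v(1) l[symmetric] R'(3)[unfolded ctx_trans_converse]])
    then show ?thesis unfolding v(3) w(3) ctx_trans_converse[symmetric] l by (simp split: if_splits)
  qed
  ultimately show ?case unfolding ep_step_def by blast
qed

lemma ctx_closure_step: "(p, q, R) \<in> ctx_closure \<Longrightarrow> (v, w) \<in> R \<Longrightarrow> ep_step ctx_closure R v w"
proof (induction arbitrary: v w rule: ctx_closure.induct)
  case (base \<R> p q R)
  then have "ep_step \<R> R v w" unfolding ep_bisimulation_iff by blast
  moreover have "\<R> \<subseteq> ctx_closure" using base.hyps(1) ctx_closure.base by auto
  ultimately show ?case by (rule ep_step_mono)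
next
  case (ctx p \<rho> \<nu> W)
  show ?case
  proof (rule ep_step_ctx_trans)
    show "(\<rho> k, \<nu> k, W k) \<in> ctx_closure" for k using ctx.IH by blast
    show "ep_step ctx_closure (W k) v w" if "(v, w) \<in> W k" for k v w using ctx.IH that by blast
    show "ctx_rel W p v w" "v \<in> trans_from (fill \<rho> p)" "w \<in> trans_from (fill \<nu> p)"
      using ctx.prems by (simp_all add: ctx_trans_def)
  qed (rule ctx.hyps)
qed

lemma ep_bisimulation_ctx_closure: "ep_bisimulation (ltss_of T) ctx_closure"
  unfolding ep_bisimulation_iff using ctx_closure_matching ctx_closure_step by blast

text \<open>The witnessing ep-bisimulations may differ from variable to variable. All of them lie in
  \<open>ctx_closure\<close>, so it serves as a common one.\<close>

lemma lean_congruence: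
  assumes "p \<in> expr \<Sigma>" and "\<And>x. ep_bisimilar (ltss_of T) (\<rho> x) (\<nu> x)"
  shows "ep_bisimilar (ltss_of T) (psubst p (Some \<circ> \<rho>)) (psubst p (Some \<circ> \<nu>))"
proof -
  have "\<forall>x. \<exists>R. (\<rho> x, \<nu> x, R) \<in> ctx_closure"
    using assms(2) unfolding ep_bisimilar_def by (blast intro: ctx_closure.base)
  then obtain W where W: "\<And>x. (\<rho> x, \<nu> x, W x) \<in> ctx_closure" by metis
  have fr: "fv (\<rho> x) = {}" "fv (\<nu> x) = {}" for x
    using ctx_closure_matching[OF W[of x]] by (simp_all add: matching_def cexpr_def)
  have "ctx_of p \<in> cexpr \<Sigma>'" using ctx_of_expr[OF assms(1)] by (simp add: cexpr_def)
  with W have "(fill \<rho> (ctx_of p), fill \<nu> (ctx_of p), ctx_trans \<rho> \<nu> W (ctx_of p)) \<in> ctx_closure" by (blast intro: ctx_closure.ctx)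
  then show ?thesis
    using ep_bisimulation_ctx_closure fr unfolding ep_bisimilar_def by (auto simp: fill_ctx_of)
qed

end

theorem theorem7p2:
  fixes T :: "('v, 'w, 'o, 'l, 'n) tsss"
    and Act :: "'l set"
    and p :: "('v, 'o) pexp"
    and \<rho> \<nu> :: "'v \<rightharpoonup> ('v, 'o) pexp"
  assumes "infinite (UNIV :: 'v set)"
    and "infinite (UNIV :: 'w set)"
    and "de_simone_tsss Act T"
    and "p \<in> expr (signature T)"
    and "closed_subst (signature T) \<rho>"
    and "closed_subst (signature T) \<nu>"
    and "\<forall>x. ep_bisimilar (ltss_of T) (the (\<rho> x)) (the (\<nu> x))"
  shows "ep_bisimilar (ltss_of T) (psubst p \<rho>) (psubst p \<nu>)"
proof -
  interpret de_simone Act T by unfold_locales fact+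
  \<comment> \<open>Closed substitutions are total, so they can be treated as functions.\<close>
  have total: "Some \<circ> (the \<circ> \<sigma>) = \<sigma>" if "closed_subst (signature T) \<sigma>" for \<sigma>
  proof
    fix x
    have "x \<in> dom \<sigma>" using that by (simp add: closed_subst_def)
    then show "(Some \<circ> (the \<circ> \<sigma>)) x = \<sigma> x" by auto
  qed
  show ?thesis
    using lean_congruence[OF assms(4), of "the \<circ> \<rho>" "the \<circ> \<nu>"] assms(7)
    by (simp add: total[OF assms(5)] total[OF assms(6)])
qed

end
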